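(* Let $b,\sigma$ satisfy the local regularity assumption and the linear growth assumption stated in the context. Let $\phi:[0,\infty)\to\mathbb{R}$ be such that the associated backward solution $$u(t,x):=\mathbb{E}[\phi(Y_T)\mid Y_t=x],\qquad (t,x)\in[0,T]\times[0,\infty),$$ of $$\partial_t u+b\,\partial_xu+\tfrac{\sigma^2}{2}\partial_{xx}u=0,\qquad u(T,x)=\phi(x),\qquad \tfrac{\sigma^2}{2}\partial_xu\Big|_{x=0}=\kappa\Bigl(b\,\partial_xu+\tfrac{\sigma^2}{2}\partial_{xx}u\Bigr)\Big|_{x=0},$$ satisfies $\sup_{[0,T]\times[0,\infty)}|\partial_x^ju|<\infty$ for $j=1,2,3,4$, and has time derivatives up to order $2$ with $\sup_{[0,T]\times[0,\infty)}|\partial_{tt}u|<\infty$. Assume $X_0=Y_0=x_0$ deterministically, $x_0\ge 0$. Then there exist constants $\delta>0$ and $C>0$, independent of $h$ and $x_0$, such that for all $h<\delta$ (with $N=T/h\in\mathbb{Z}$), $$\bigl|\mathbb{E}\bigl(\phi(X_N)-\phi(Y_T)\bigr)\bigr|\le C(1+x_0^4)\,h.$$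
   Context: Fix $\kappa>0$, $T>0$ and (Borel) functions $b,\sigma:[0,\infty)\to\mathbb{R}$. $Y$ is the sticky diffusion on $[0,\infty)$, i.e. a weak solution of $dY_t=b(Y_t)1_{(0,\infty)}(Y_t)dt+\sigma(Y_t)1_{(0,\infty)}(Y_t)dW_t+dL_t$, $\ \tfrac{\sigma^2(Y_t)}{2}1_{\{0\}}(Y_t)dt=\kappa\,dL_t$, where $W$ is a Brownian motion and $L$ is nondecreasing and increases only when $Y_t=0$. Local regularity assumption: there exists $r_0>0$ such that $b,\sigma\in C^2([0,r_0])$, $\sigma(0)>0$, $\max_{0\le j\le2}\bigl(\sup_{[0,r_0]}|\partial_x^jb|+\sup_{[0,r_0]}|\partial_x^j\sigma|\bigr)<\infty$, and (after decreasing $r_0$ if necessary) $\sigma(x)\ge\sigma_*>0$ for $x\in[0,r_0]$. Linear growth assumption: there exists $L>0$ such that $|b(x)|+|\sigma(x)|\le L(1+x)$ for all $x\ge0$. Numerical scheme: for a time step $h>0$ with $N:=T/h$ an integer, let $\Omega_b=\{x\ge0: x\le\sigma(x)\sqrt{3h}\}$ and $$\lambda(x)=\frac{(\sigma^2(x)-2\kappa b(x))x^2+2\kappa\sigma^2(x)x+\sigma^4(x)h}{\left(\frac{\kappa\sigma(x)}{\sqrt{3h}}+\sigma^2(x)-2\kappa b(x)\right)x^2+\sigma^3(x)\kappa\sqrt{3h}+\sigma^4(x)h},\qquad x\in\Omega_b,$$ which lies in $[0,1]$ for all sufficiently small $h$ under the two assumptions. Let $Z_0,\dots,Z_{N-1}$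 be i.i.d. uniform on $[-\sqrt{3h},\sqrt{3h}]$. The Markov chain $\{X_k\}_{k=0}^N$ on $[0,\infty)$ is: if $X_k\notin\Omega_b$, then $X_{k+1}=|X_k+\sigma(X_k)Z_k+b(X_k)h|$; if $X_k\in\Omega_b$, then, using independent randomness, $X_{k+1}=\bigl||X_k+\sigma(X_k)Z_k|+b(X_k)h\bigr|$ with probability $\lambda(X_k)$ and $X_{k+1}=0$ with probability $1-\lambda(X_k)$. *)

theory Defs
  imports "HOL-Probability.Probability"
begin

section \<open>Derivatives on closed sets and the assumptions on the coefficients\<close>

text \<open>\<open>D j\<close> is the \<open>j\<close>-th derivative of \<open>f\<close> on \<open>S\<close> for \<open>j \<le> k\<close>. Derivatives are taken within \<open>S\<close>,
  hence are one-sided at the endpoints of an interval.\<close>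

definition derivs_on :: "real set \<Rightarrow> nat \<Rightarrow> (real \<Rightarrow> real) \<Rightarrow> (nat \<Rightarrow> real \<Rightarrow> real) \<Rightarrow> bool" where
  "derivs_on S k f D \<longleftrightarrow>
     (\<forall>x\<in>S. D 0 x = f x) \<and>
     (\<forall>j<k. \<forall>x\<in>S. (D j has_real_derivative D (Suc j) x) (at x within S))"

definition bounded_C2_on :: "real set \<Rightarrow> (real \<Rightarrow> real) \<Rightarrow> bool" where
  "bounded_C2_on S f \<longleftrightarrow>
     (\<exists>D. derivs_on S 2 f D \<and> (\<forall>j\<le>2. continuous_on S (D j) \<and> bounded (D j ` S)))"

definition locally_regular :: "(real \<Rightarrow> real) \<Rightarrow> (real \<Rightarrow> real) \<Rightarrow> bool" where
  "locally_regular b \<sigma> \<longleftrightarrow>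
     (\<exists>r\<^sub>0>0. bounded_C2_on {0..r\<^sub>0} b \<and> bounded_C2_on {0..r\<^sub>0} \<sigma> \<and> \<sigma> 0 > 0 \<and>
        (\<exists>\<sigma>\<^sub>m>0. \<forall>x\<in>{0..r\<^sub>0}. \<sigma>\<^sub>m \<le> \<sigma> x))"

definition linear_growth :: "(real \<Rightarrow> real) \<Rightarrow> (real \<Rightarrow> real) \<Rightarrow> bool" where
  "linear_growth b \<sigma> \<longleftrightarrow> (\<exists>K>0. \<forall>x\<ge>0. \<bar>b x\<bar> + \<bar>\<sigma> x\<bar> \<le> K * (1 + x))"


section \<open>Brownian motion and the Ito integral\<close>

text \<open>Processes live on a time interval \<open>[s,T]\<close> and are written \<open>X t \<omega>\<close>. The values of a filtration
  \<open>F\<close> outside \<open>[s,T]\<close> play no role.\<close>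

definition filtered_prob_space :: "'a measure \<Rightarrow> (real \<Rightarrow> 'a measure) \<Rightarrow> bool" where
  "filtered_prob_space M F \<longleftrightarrow>
     prob_space M \<and> filtration (space M) F \<and> (\<forall>t. sets (F t) \<subseteq> sets M)"

definition adapted_on :: "real \<Rightarrow> real \<Rightarrow> (real \<Rightarrow> 'a measure) \<Rightarrow> (real \<Rightarrow> 'a \<Rightarrow> real) \<Rightarrow> bool" where
  "adapted_on s T F X \<longleftrightarrow> (\<forall>t\<in>{s..T}. X t \<in> borel_measurable (F t))"

definition brownian_motion ::
  "real \<Rightarrow> real \<Rightarrow> 'a measure \<Rightarrow> (real \<Rightarrow> 'a measure) \<Rightarrow> (real \<Rightarrow> 'a \<Rightarrow> real) \<Rightarrow> bool" where
  "brownian_motion s T M F W \<longleftrightarrow>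
     adapted_on s T F W \<and>
     (AE \<omega> in M. W s \<omega> = 0 \<and> continuous_on {s..T} (\<lambda>t. W t \<omega>)) \<and>
     (\<forall>r t. s \<le> r \<and> r < t \<and> t \<le> T \<longrightarrow>
        distributed M lborel (\<lambda>\<omega>. W t \<omega> - W r \<omega>) (\<lambda>y. ennreal (normal_density 0 (sqrt (t - r)) y)) \<and>
        prob_space.indep_set M (sets (F r))
          {(\<lambda>\<omega>. W t \<omega> - W r \<omega>) -` A \<inter> space M | A. A \<in> sets borel})"

text \<open>The simple process \<open>\<Sum>i<n. \<xi> i \<cdot> 1\<^bsub>(\<tau> i, \<tau> (i+1)]\<^esub>\<close> with bounded \<open>\<xi> i\<close>, each known at time \<open>\<tau> i\<close>,
  and its integral from \<open>s\<close> to \<open>t\<close> against \<open>W\<close>.\<close>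

definition simple_data ::
  "real \<Rightarrow> real \<Rightarrow> 'a measure \<Rightarrow> (real \<Rightarrow> 'a measure) \<Rightarrow> nat \<Rightarrow> (nat \<Rightarrow> real) \<Rightarrow> (nat \<Rightarrow> 'a \<Rightarrow> real) \<Rightarrow> bool" where
  "simple_data s T M F n \<tau> \<xi> \<longleftrightarrow>
     (\<forall>i<n. s \<le> \<tau> i \<and> \<tau> i \<le> \<tau> (Suc i) \<and> \<tau> (Suc i) \<le> T \<and> \<xi> i \<in> borel_measurable (F (\<tau> i)) \<and>
        (\<exists>B. \<forall>\<omega>\<in>space M. \<bar>\<xi> i \<omega>\<bar> \<le> B))"

definition simple_proc :: "nat \<Rightarrow> (nat \<Rightarrow> real) \<Rightarrow> (nat \<Rightarrow> 'a \<Rightarrow> real) \<Rightarrow> real \<Rightarrow> 'a \<Rightarrow> real" where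
  "simple_proc n \<tau> \<xi> t \<omega> = (\<Sum>i<n. \<xi> i \<omega> * indicator {\<tau> i<..\<tau> (Suc i)} t)"

definition simple_integral ::
  "(real \<Rightarrow> 'a \<Rightarrow> real) \<Rightarrow> nat \<Rightarrow> (nat \<Rightarrow> real) \<Rightarrow> (nat \<Rightarrow> 'a \<Rightarrow> real) \<Rightarrow> real \<Rightarrow> 'a \<Rightarrow> real" where
  "simple_integral W n \<tau> \<xi> t \<omega> =
     (\<Sum>i<n. \<xi> i \<omega> * (W (min (\<tau> (Suc i)) t) \<omega> - W (min (\<tau> i) t) \<omega>))"

text \<open>\<open>I t = \<integral>\<^sub>s\<^sup>t H dW\<close> for \<open>t \<in> [s,T]\<close>: \<open>I\<close> is the limit of integrals of simple processes that approximate
  \<open>H\<close> in \<open>L\<^sup>2([s,T])\<close>, the integrals converging uniformly in time. The usual definition takes both limits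
  in probability; passing to a subsequence one may take them almost surely, as done here. The first
  limit forces \<open>\<integral>\<^sub>s\<^sup>T H\<^sup>2 dt < \<infinity>\<close> almost surely.\<close>

definition is_ito_integral ::
  "real \<Rightarrow> real \<Rightarrow> 'a measure \<Rightarrow> (real \<Rightarrow> 'a measure) \<Rightarrow> (real \<Rightarrow> 'a \<Rightarrow> real) \<Rightarrow>
   (real \<Rightarrow> 'a \<Rightarrow> real) \<Rightarrow> (real \<Rightarrow> 'a \<Rightarrow> real) \<Rightarrow> bool" where
  "is_ito_integral s T M F W H I \<longleftrightarrow>
     (\<exists>n \<tau> \<xi>. (\<forall>m. simple_data s T M F (n m) (\<tau> m) (\<xi> m)) \<and>
        (AE \<omega> in M.
           (\<lambda>r. H r \<omega>) \<in> borel_measurable (restrict_space borel {s..T}) \<and>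
           (\<lambda>m. \<integral>\<^sup>+r\<in>{s..T}. ennreal ((simple_proc (n m) (\<tau> m) (\<xi> m) r \<omega> - H r \<omega>)\<^sup>2) \<partial>lborel)
             \<longlonglongrightarrow> 0 \<and>
           uniform_limit {s..T} (\<lambda>m t. simple_integral W (n m) (\<tau> m) (\<xi> m) t \<omega>) (\<lambda>t. I t \<omega>) sequentially))"


section \<open>The sticky diffusion\<close>

text \<open>\<open>Y\<close> is a weak solution on \<open>[s,T]\<close>, carried by the probability space \<open>M\<close> and started at \<open>Y s = x\<close>, of
    \<open>dY = b(Y) 1\<^bsub>(0,\<infinity>)\<^esub>(Y) dt + \<sigma>(Y) 1\<^bsub>(0,\<infinity>)\<^esub>(Y) dW + dL\<close>,  \<open>\<sigma>(Y)\<^sup>2/2 1\<^bsub>{0}\<^esub>(Y) dt = \<kappa> dL\<close>.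
  The last conjunct says that \<open>L\<close> increases only when \<open>Y = 0\<close>: no time \<open>t\<close> with \<open>Y t > 0\<close> is a point of
  increase of \<open>L\<close>.\<close>

definition sticky_diffusion ::
  "real \<Rightarrow> (real \<Rightarrow> real) \<Rightarrow> (real \<Rightarrow> real) \<Rightarrow> real \<Rightarrow> real \<Rightarrow> real \<Rightarrow> 'a measure \<Rightarrow> (real \<Rightarrow> 'a \<Rightarrow> real) \<Rightarrow> bool" where
  "sticky_diffusion \<kappa> b \<sigma> s T x M Y \<longleftrightarrow>
     (\<exists>F W L I. filtered_prob_space M F \<and> brownian_motion s T M F W \<and>
        adapted_on s T F Y \<and> adapted_on s T F L \<and>
        is_ito_integral s T M F W (\<lambda>r \<omega>. \<sigma> (Y r \<omega>) * indicator {0<..} (Y r \<omega>)) I \<and>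
        (AE \<omega> in M.
           Y s \<omega> = x \<and> (\<forall>t\<in>{s..T}. 0 \<le> Y t \<omega>) \<and> continuous_on {s..T} (\<lambda>t. Y t \<omega>) \<and>
           L s \<omega> = 0 \<and> mono_on {s..T} (\<lambda>t. L t \<omega>) \<and> continuous_on {s..T} (\<lambda>t. L t \<omega>) \<and>
           set_integrable lborel {s..T} (\<lambda>r. b (Y r \<omega>) * indicator {0<..} (Y r \<omega>)) \<and>
           (\<forall>t\<in>{s..T}. Y t \<omega> = x + (LBINT r:{s..t}. b (Y r \<omega>) * indicator {0<..} (Y r \<omega>))
                                 + I t \<omega> + L t \<omega>) \<and>
           (\<forall>t\<in>{s..T}. (LBINT r:{s..t}. (\<sigma> (Y r \<omega>))\<^sup>2 / 2 * indicator {0} (Y r \<omega>)) = \<kappa> * L t \<omega>) \<and>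
           (\<forall>t\<in>{s..T}. Y t \<omega> > 0 \<longrightarrow>
              (\<exists>\<epsilon>>0. \<forall>r\<in>{s..T} \<inter> {t - \<epsilon><..<t + \<epsilon>}. L r \<omega> = L t \<omega>))))"

text \<open>\<open>u(t,x) = E[\<phi>(Y\<^sub>T) | Y\<^sub>t = x]\<close>, where \<open>Y t x\<close> (on the probability space \<open>P t x\<close>) is the diffusion
  which is at \<open>x\<close> at time \<open>t\<close>.\<close>

definition backward_value ::
  "real \<Rightarrow> (real \<Rightarrow> real) \<Rightarrow> (real \<Rightarrow> real \<Rightarrow> 'a measure) \<Rightarrow> (real \<Rightarrow> real \<Rightarrow> real \<Rightarrow> 'a \<Rightarrow> real) \<Rightarrow>
   real \<Rightarrow> real \<Rightarrow> real" where
  "backward_value T \<phi> P Y t x = (\<integral>\<omega>. \<phi> (Y t x T \<omega>) \<partial>P t x)"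

text \<open>\<open>u\<close> solves the backward equation with the sticky boundary condition and has the required bounded
  derivatives; \<open>ux j\<close> and \<open>ut j\<close> are the \<open>j\<close>-th space and time derivatives of \<open>u\<close>.\<close>

definition regular_backward_solution ::
  "real \<Rightarrow> (real \<Rightarrow> real) \<Rightarrow> (real \<Rightarrow> real) \<Rightarrow> real \<Rightarrow> (real \<Rightarrow> real) \<Rightarrow> (real \<Rightarrow> real \<Rightarrow> real) \<Rightarrow> bool" where
  "regular_backward_solution \<kappa> b \<sigma> T \<phi> u \<longleftrightarrow>
     (\<exists>ux ut :: nat \<Rightarrow> real \<Rightarrow> real \<Rightarrow> real.
        (\<forall>t\<in>{0..T}. derivs_on {0..} 4 (\<lambda>x. u t x) (\<lambda>j x. ux j t x)) \<and>
        (\<forall>x\<ge>0. derivs_on {0..T} 2 (\<lambda>t. u t x) (\<lambda>j t. ut j t x)) \<and>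
        (\<forall>t\<in>{0..T}. \<forall>x\<ge>0. ut 1 t x + b x * ux 1 t x + (\<sigma> x)\<^sup>2 / 2 * ux 2 t x = 0) \<and>
        (\<forall>x\<ge>0. u T x = \<phi> x) \<and>
        (\<forall>t\<in>{0..T}. (\<sigma> 0)\<^sup>2 / 2 * ux 1 t 0 = \<kappa> * (b 0 * ux 1 t 0 + (\<sigma> 0)\<^sup>2 / 2 * ux 2 t 0)) \<and>
        (\<forall>j\<in>{1..4}. bounded ((\<lambda>(t, x). ux j t x) ` ({0..T} \<times> {0..}))) \<and>
        bounded ((\<lambda>(t, x). ut 2 t x) ` ({0..T} \<times> {0..})))"


section \<open>The numerical scheme\<close>

definition boundary_region :: "(real \<Rightarrow> real) \<Rightarrow> real \<Rightarrow> real set" where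
  "boundary_region \<sigma> h = {x. 0 \<le> x \<and> x \<le> \<sigma> x * sqrt (3 * h)}"

definition move_prob :: "real \<Rightarrow> (real \<Rightarrow> real) \<Rightarrow> (real \<Rightarrow> real) \<Rightarrow> real \<Rightarrow> real \<Rightarrow> real" where
  "move_prob \<kappa> b \<sigma> h x =
     (((\<sigma> x)^2 - 2 * \<kappa> * b x) * x^2 + 2 * \<kappa> * (\<sigma> x)^2 * x + (\<sigma> x)^4 * h) /
     ((\<kappa> * \<sigma> x / sqrt (3 * h) + (\<sigma> x)^2 - 2 * \<kappa> * b x) * x^2
        + (\<sigma> x)^3 * \<kappa> * sqrt (3 * h) + (\<sigma> x)^4 * h)"

text \<open>\<open>z\<close> is the noise of the step; \<open>v\<close>, uniform on \<open>[0,1]\<close>, decides between moving and jumping to \<open>0\<close>.\<close>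

definition scheme_step ::
  "real \<Rightarrow> (real \<Rightarrow> real) \<Rightarrow> (real \<Rightarrow> real) \<Rightarrow> real \<Rightarrow> real \<Rightarrow> real \<Rightarrow> real \<Rightarrow> real" where
  "scheme_step \<kappa> b \<sigma> h x z v =
     (if x \<notin> boundary_region \<sigma> h then \<bar>x + \<sigma> x * z + b x * h\<bar>
      else if v \<le> move_prob \<kappa> b \<sigma> h x then \<bar>\<bar>x + \<sigma> x * z\<bar> + b x * h\<bar>
      else 0)"

definition sticky_scheme ::
  "real \<Rightarrow> (real \<Rightarrow> real) \<Rightarrow> (real \<Rightarrow> real) \<Rightarrow> real \<Rightarrow> nat \<Rightarrow> real \<Rightarrow> 'a measure \<Rightarrow> (nat \<Rightarrow> 'a \<Rightarrow> real) \<Rightarrow> bool" where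
  "sticky_scheme \<kappa> b \<sigma> h N x\<^sub>0 M X \<longleftrightarrow>
     prob_space M \<and>
     (\<exists>Z V :: nat \<Rightarrow> 'a \<Rightarrow> real.
        prob_space.indep_vars M (\<lambda>_. borel) (case_sum Z V) ({..<N} <+> {..<N}) \<and>
        (\<forall>k<N. distr M borel (Z k) = uniform_measure lborel {- sqrt (3 * h)..sqrt (3 * h)}) \<and>
        (\<forall>k<N. distr M borel (V k) = uniform_measure lborel {0..1}) \<and>
        (\<forall>\<omega>\<in>space M. X 0 \<omega> = x\<^sub>0 \<and>
           (\<forall>k<N. X (Suc k) \<omega> = scheme_step \<kappa> b \<sigma> h (X k \<omega>) (Z k \<omega>) (V k \<omega>))))"

end

theory Submission
  imports Defs
begin

text \<open>Since \<open>u\<close> solves the backward equation, \<open>E u(t\<^sub>k, X\<^sub>k)\<close> is almost constant in \<open>k\<close>, and the weak error is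
  the sum of its increments. Put \<open>q = sqrt (3 h)\<close>. Away from the boundary a Taylor expansion gives a
  local error of order \<open>q\<^sup>4\<close>. In the boundary region \<open>\<lambda>\<close> is chosen so that, by the sticky boundary
  condition, all terms up to second order cancel exactly; the remainder is \<open>O(q\<^sup>3 \<lambda>(x))\<close>. A further error
  \<open>O(q\<^sup>3)\<close> comes from points just outside the region, from which the drift may cause a reflection.
  The expected sum of these weights is only \<open>O(1/q)\<close>: the convex function \<open>V(x) = max 0 (x - c q)\<close> is a
  submartingale along the chain up to \<open>O(q\<^sup>2)\<close> per step, and it gains a multiple of \<open>q\<close> times the weight
  in each step. So the total error is \<open>O(N q\<^sup>4 + q\<^sup>3/q) = O(h)\<close>, with fourth moments of the chain
  controlling the growth at infinity.\<close>

section \<open>The uniform noise\<close>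

text \<open>The obstacle is the local error of order q^3 near 0: charged to each of the
  \<open>N\<close> steps it would sum to N q^3, which is only of order sqrt h. Hence the weights are
  never estimated one by one. Each q^3-error is bounded by q^2 times the mean increment of V, up to
  O(q^4), and these increments telescope along the chain.

  This forces the factor \<lambda> in the boundary estimate. At x = 0 the value of \<lambda> is
  itself of order q, so the chain rests at 0 for many steps, during which V gains next to nothing;
  an error without the factor \<lambda> could not be paid for there. The factor appears for two
  reasons: a jump lands exactly at 0 and needs no expansion, so the error of the moved point is
  multiplied by \<lambda>; and what remains vanishes linearly in x, while x is at most a constant
  times q \<lambda>(x).

  All constants are explicit in \<kappa>, \<open>K\<close>, \<open>m\<close> and bounds on the
  derivatives of u, so that uniformity in \<open>h\<close> and \<open>x\<^sub>0\<close> can be read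
  off.\<close>

abbreviation U :: "real \<Rightarrow> real measure" where
  "U q \<equiv> uniform_measure lborel {-q..q}"

lemma U_density:
  assumes "q > 0"
  shows "U q = density lborel (\<lambda>z. ennreal (indicator {-q..q} z / (2 * q)))"
proof -
  have "emeasure lborel {-q..q} = ennreal (2 * q)"
    using assms by simp
  then show ?thesis
    unfolding uniform_measure_def using assms
    by (intro arg_cong[where f = "density lborel"] ext)
       (auto simp: indicator_def divide_ennreal ennreal_1[symmetric] simp del: ennreal_1)
qed

lemma prob_space_U: "q > 0 \<Longrightarrow> prob_space (U q)"
  by (rule prob_space_uniform_measure) (auto simp: emeasure_lborel_Icc_eq)

lemma AE_U: "AE z in U q. z \<in> {-q..q}"
  by (rule AE_uniform_measureI) auto

lemma integral_U:
  assumes "q > 0" and "g \<in> borel_measurable borel"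
  shows "(\<integral>z. g z \<partial>U q) = (\<integral>z. g z * indicator {-q..q} z \<partial>lborel) / (2 * q)"
proof -
  have "(\<integral>z. g z \<partial>U q) = (\<integral>z. (indicator {-q..q} z / (2 * q)) *\<^sub>R g z \<partial>lborel)"
    unfolding U_density[OF assms(1)] using assms
    by (intro integral_density) auto
  also have "\<dots> = (\<integral>z. (g z * indicator {-q..q} z) / (2 * q) \<partial>lborel)"
    by (intro Bochner_Integration.integral_cong) auto
  finally show ?thesis by simp
qed

lemma integral_U_FTC:
  assumes "q > 0" and "\<And>z. (G has_real_derivative g z) (at z)" and "continuous_on UNIV g"
  shows "(\<integral>z. g z \<partial>U q) = (G q - G (-q)) / (2 * q)"
proof -
  have "(\<integral>z. g z * indicator {-q..q} z \<partial>lborel) = G q - G (-q)"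
    using assms by (intro integral_FTC_Icc_real) (auto simp: continuous_on_eq_continuous_at)
  then show ?thesis
    using assms by (subst integral_U) (auto intro: borel_measurable_continuous_onI)
qed

lemma integrable_U:
  assumes "q > 0" and "g \<in> borel_measurable borel" and "\<And>z. \<bar>z\<bar> \<le> q \<Longrightarrow> \<bar>g z\<bar> \<le> (C::real)"
  shows "integrable (U q) g"
proof -
  interpret prob_space "U q" using assms by (rule_tac prob_space_U)
  show ?thesis
    using assms AE_U[of q] by (intro integrable_const_bound[of _ C]) (auto simp: abs_le_iff)
qed

lemma integral_U_mono:
  fixes f g :: "real \<Rightarrow> real"
  assumes "integrable (U q) f" "integrable (U q) g" "\<And>z. \<bar>z\<bar> \<le> q \<Longrightarrow> f z \<le> g z"
  shows "(\<integral>z. f z \<partial>U q) \<le> (\<integral>z. g z \<partial>U q)"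
  using assms AE_U[of q] by (intro integral_mono_AE) (auto simp: abs_le_iff)

lemma integrable_U_cont:
  assumes "q > 0" and "continuous_on UNIV (g :: real \<Rightarrow> real)"
  shows "integrable (U q) g"
proof -
  have "bounded (g ` {-q..q})"
    using assms by (intro compact_imp_bounded compact_continuous_image) (auto intro: continuous_on_subset)
  then obtain C where "\<forall>z\<in>{-q..q}. \<bar>g z\<bar> \<le> C" by (auto simp: bounded_iff)
  then show ?thesis using assms
    by (intro integrable_U[of _ _ C]) (auto intro: borel_measurable_continuous_onI simp: abs_le_iff)
qed

text \<open>Odd powers average to zero by symmetry, and the variance \<open>q^2 / 3\<close> is the
  step size: the noise matches a Brownian increment up to the third moment, which is what a local
  error of order q^4 needs.\<close>

lemma integral_U_cubic:
  assumes "q > 0"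
  shows "(\<integral>z. a0 + a1 * z + a2 * z^2 + a3 * z^3 \<partial>U q) = a0 + a2 * q^2 / 3"
proof -
  have "(\<integral>z. a0 + a1 * z + a2 * z^2 + a3 * z^3 \<partial>U q)
      = ((a0 * q + a1 * q^2/2 + a2 * q^3/3 + a3 * q^4/4)
          - (a0 * (-q) + a1 * (-q)^2/2 + a2 * (-q)^3/3 + a3 * (-q)^4/4)) / (2 * q)"
    using assms by (intro integral_U_FTC) (auto intro!: derivative_eq_intros continuous_intros)
  also have "\<dots> = a0 + a2 * q^2 / 3"
    using assms by (simp add: field_simps power2_eq_square power3_eq_cube)
  finally show ?thesis .
qed

text \<open>Supplies an antiderivative of the modulus. Away from 0 the sign is locally constant; at
  0 the difference quotient is the modulus itself.\<close>

lemma DERIV_mult_abs: "((\<lambda>y::real. y * \<bar>y\<bar>) has_real_derivative 2 * \<bar>y\<bar>) (at y)"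
proof (cases "y = 0")
  case True
  have "(\<lambda>h. (h * \<bar>h\<bar>) / h) \<midarrow>0\<rightarrow> (0::real)"
  proof (rule Lim_transform_eventually)
    show "(\<lambda>h. \<bar>h\<bar>) \<midarrow>0\<rightarrow> (0::real)" by (auto intro!: tendsto_eq_intros)
    show "\<forall>\<^sub>F h in at (0::real). \<bar>h\<bar> = (h * \<bar>h\<bar>) / h" by (auto simp: eventually_at_filter intro!: always_eventually)
  qed
  then show ?thesis using True by (simp add: DERIV_def)
next
  case False
  have "((\<lambda>y. y * (sgn y0 * y)) has_real_derivative 2 * (sgn y0 * y0)) (at y0)" for y0 :: real
    by (auto intro!: derivative_eq_intros)
  then have "((\<lambda>x. x * (sgn y * x)) has_real_derivative 2 * \<bar>y\<bar>) (at y)"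
    by (simp add: abs_sgn mult.commute)
  moreover have "\<forall>\<^sub>F x in nhds y. x * \<bar>x\<bar> = x * (sgn y * x)"
  proof (cases "y > 0")
    case True
    then have "\<forall>\<^sub>F x in nhds y. x > 0" using eventually_nhds_in_open[of "{0<..}" y] by auto
    then show ?thesis by eventually_elim (use True in auto)
  next
    case False
    with \<open>y \<noteq> 0\<close> have y: "y < 0" by simp
    have "\<forall>\<^sub>F x in nhds y. x < 0" using eventually_nhds_in_open[of "{..<0}" y] y by auto
    then show ?thesis by eventually_elim (use y in auto)
  qed
  ultimately show ?thesis by (subst DERIV_cong_ev[OF refl _ refl])
qed

text \<open>\<open>x \<le> \<sigma> * q\<close> puts the zero of \<open>x + \<sigma> * z\<close>
  inside the noise range, which fixes the signs at both endpoints. This mean is the source of the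
  terms with \<open>\<kappa> * \<sigma> x / q\<close> and
  \<open>(\<sigma> x)^3 * \<kappa> * q\<close> in the denominator of \<lambda>.\<close>

lemma integral_U_abs:
  assumes "q > 0" "\<sigma> > 0" "0 \<le> x" "x \<le> \<sigma> * q"
  shows "(\<integral>z. \<bar>x + \<sigma> * z\<bar> \<partial>U q) = (x\<^sup>2 + (\<sigma> * q)\<^sup>2) / (2 * (\<sigma> * q))"
proof -
  define G where "G = (\<lambda>z. (x + \<sigma> * z) * \<bar>x + \<sigma> * z\<bar> / (2 * \<sigma>))"
  have "(G has_real_derivative \<bar>x + \<sigma> * z\<bar>) (at z)" for z
  proof -
    have "((\<lambda>z. (x + \<sigma> * z) * \<bar>x + \<sigma> * z\<bar>) has_real_derivative 2 * \<bar>x + \<sigma> * z\<bar> * \<sigma>) (at z)"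
      by (rule DERIV_chain2[OF DERIV_mult_abs]) (auto intro!: derivative_eq_intros)
    from DERIV_cdivide[OF this, of "2 * \<sigma>"] show ?thesis
      using assms unfolding G_def by simp
  qed
  then have "(\<integral>z. \<bar>x + \<sigma> * z\<bar> \<partial>U q) = (G q - G (-q)) / (2 * q)"
    using assms by (intro integral_U_FTC) (auto intro!: continuous_intros)
  also have "\<dots> = ((x + \<sigma> * q)\<^sup>2 + (\<sigma> * q - x)\<^sup>2) / (2 * \<sigma>) / (2 * q)"
    using assms unfolding G_def
    by (simp add: abs_if field_simps power2_eq_square)
  also have "\<dots> = (x\<^sup>2 + (\<sigma> * q)\<^sup>2) / (2 * (\<sigma> * q))"
    using assms by (simp add: field_simps power2_eq_square)
  finally show ?thesis .
qed

lemma integral_U_interval_le: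
  assumes "q > 0" "a \<le> b"
  shows "(\<integral>z. indicator {a..b} z \<partial>U q) \<le> (b - a) / (2 * q)"
proof -
  have "(\<integral>z. indicator {a..b} z * indicator {-q..q} z \<partial>lborel) \<le> (\<integral>z. indicat_real {a..b} z \<partial>lborel)"
    by (intro integral_mono integrable_real_mult_indicator integrable_real_indicator)
       (auto split: split_indicator simp: emeasure_lborel_Icc_eq)
  then show ?thesis using assms
    by (subst integral_U) (auto simp: divide_right_mono)
qed

text \<open>An upper bound suffices for the probability of a reflection; a gain of the hinge
  function needs the exact value, hence a target inside the noise range.\<close>

lemma integral_U_interval:
  assumes "q > 0" "a \<le> b" "-q \<le> a" "b \<le> q"
  shows "(\<integral>z. indicator {a..b} z \<partial>U q) = (b - a) / (2 * q)"
proof -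
  have "(\<integral>z. indicator {a..b} z * indicator {-q..q} z \<partial>lborel) = (\<integral>z. indicat_real {a..b} z \<partial>lborel)"
    using assms by (intro Bochner_Integration.integral_cong) (auto simp: indicator_def)
  then show ?thesis using assms by (subst integral_U) auto
qed

text \<open>Here \<open>y + \<sigma> * z\<close> is uniform on \<open>[y - \<sigma> q, y + \<sigma> q]\<close>.\<close>

lemma indicator_affine:
  fixes \<sigma> :: real
  assumes "\<sigma> > 0"
  shows "indicator {a..b} (y + \<sigma> * z) = indicator {(a - y) / \<sigma>..(b - y) / \<sigma>} z"
  using assms by (auto simp: indicator_def field_simps)

lemma integral_U_affine_le:
  assumes "q > 0" "\<sigma> > 0" "a \<le> b"
  shows "(\<integral>z. indicator {a..b} (y + \<sigma> * z) \<partial>U q) \<le> (b - a) / (2 * (\<sigma> * q))"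
proof -
  have "(\<integral>z. indicator {a..b} (y + \<sigma> * z) \<partial>U q) \<le> ((b - y) / \<sigma> - (a - y) / \<sigma>) / (2 * q)"
    unfolding indicator_affine[OF assms(2)] using assms
    by (intro integral_U_interval_le) (auto simp: field_simps)
  also have "\<dots> = (b - a) / (2 * (\<sigma> * q))"
    using assms by (simp add: field_simps)
  finally show ?thesis .
qed

lemma integral_U_affine:
  assumes "q > 0" "\<sigma> > 0" "a \<le> b" "y - \<sigma> * q \<le> a" "b \<le> y + \<sigma> * q"
  shows "(\<integral>z. indicator {a..b} (y + \<sigma> * z) \<partial>U q) = (b - a) / (2 * (\<sigma> * q))"
proof -
  have "(\<integral>z. indicator {a..b} (y + \<sigma> * z) \<partial>U q) = ((b - y) / \<sigma> - (a - y) / \<sigma>) / (2 * q)"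
    unfolding indicator_affine[OF assms(2)] using assms
    by (intro integral_U_interval) (auto simp: field_simps)
  also have "\<dots> = (b - a) / (2 * (\<sigma> * q))"
    using assms by (simp add: field_simps)
  finally show ?thesis .
qed

lemma integrable_U_indicator_affine:
  "q > 0 \<Longrightarrow> integrable (U q) (\<lambda>z. indicator {a..b} (y + \<sigma> * z) :: real)"
  by (rule integrable_U[of _ _ 1]) (auto simp: indicator_def)

section \<open>The transition kernel of the scheme\<close>

definition kernel ::
  "real \<Rightarrow> (real \<Rightarrow> real) \<Rightarrow> (real \<Rightarrow> real) \<Rightarrow> real \<Rightarrow> (real \<Rightarrow> real) \<Rightarrow> real \<Rightarrow> real" where
  "kernel \<kappa> b \<sigma> h g x =
     (\<integral>z. \<integral>v. g (scheme_step \<kappa> b \<sigma> h x z v) \<partial>uniform_measure lborel {0..1} \<partial>U (sqrt (3 * h)))"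

lemma prob_space_uniform_01: "prob_space (uniform_measure lborel {0..1::real})"
  by (rule prob_space_uniform_measure) auto

lemma integral_coin:
  fixes p :: real
  assumes "0 \<le> p" "p \<le> 1"
  shows "(\<integral>v. (if v \<le> p then A else B) \<partial>uniform_measure lborel {0..1}) = p * A + (1 - p) * B"
proof -
  interpret prob_space "uniform_measure lborel {0..1::real}" by (rule prob_space_uniform_01)
  have "{0..1} \<inter> {..p} = {0..p}" using assms by auto
  then have m: "measure (uniform_measure lborel {0..1}) {..p} = p"
    using assms by (subst measure_uniform_measure) (auto simp: Int_commute)
  have "(\<integral>v. (if v \<le> p then A else B) \<partial>uniform_measure lborel {0..1})
      = (\<integral>v. B + (A - B) * indicator {..p} v \<partial>uniform_measure lborel {0..1})"
    by (intro Bochner_Integration.integral_cong) (auto simp: indicator_def)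
  also have "\<dots> = B + (A - B) * p"
    using m prob_space by (simp add: integrable_const_bound[of _ 1])
  finally show ?thesis by (simp add: algebra_simps)
qed

lemma kernel_outside:
  assumes "x \<notin> boundary_region \<sigma> h"
  shows "kernel \<kappa> b \<sigma> h g x = (\<integral>z. g \<bar>x + \<sigma> x * z + b x * h\<bar> \<partial>U (sqrt (3 * h)))"
proof -
  interpret prob_space "uniform_measure lborel {0..1::real}" by (rule prob_space_uniform_01)
  show ?thesis
    using assms by (simp add: kernel_def scheme_step_def prob_space)
qed

lemma kernel_boundary:
  assumes "x \<in> boundary_region \<sigma> h" "h > 0"
    and "0 \<le> move_prob \<kappa> b \<sigma> h x" "move_prob \<kappa> b \<sigma> h x \<le> 1" "continuous_on {0..} g"
  shows "kernel \<kappa> b \<sigma> h g x =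
    move_prob \<kappa> b \<sigma> h x * (\<integral>z. g \<bar>\<bar>x + \<sigma> x * z\<bar> + b x * h\<bar> \<partial>U (sqrt (3 * h)))
    + (1 - move_prob \<kappa> b \<sigma> h x) * g 0"
proof -
  define p where "p = move_prob \<kappa> b \<sigma> h x"
  interpret prob_space "U (sqrt (3 * h))" using assms by (intro prob_space_U) simp
  have int: "integrable (U (sqrt (3 * h))) (\<lambda>z. g \<bar>\<bar>x + \<sigma> x * z\<bar> + b x * h\<bar>)"
    using assms(2,5)
    by (intro integrable_U_cont continuous_on_compose2[OF assms(5)]) (auto intro!: continuous_intros)
  have "g (scheme_step \<kappa> b \<sigma> h x z v) = (if v \<le> p then g \<bar>\<bar>x + \<sigma> x * z\<bar> + b x * h\<bar> else g 0)" for z v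
    using assms(1) by (simp add: scheme_step_def p_def)
  then have "kernel \<kappa> b \<sigma> h g x
      = (\<integral>z. p * g \<bar>\<bar>x + \<sigma> x * z\<bar> + b x * h\<bar> + (1 - p) * g 0 \<partial>U (sqrt (3 * h)))"
    using assms(3,4) by (simp add: kernel_def integral_coin p_def)
  also have "\<dots> = p * (\<integral>z. g \<bar>\<bar>x + \<sigma> x * z\<bar> + b x * h\<bar> \<partial>U (sqrt (3 * h))) + (1 - p) * g 0"
    using int prob_space by simp
  finally show ?thesis by (simp add: p_def)
qed

section \<open>The chain as a function of its noise, and the Markov property\<close>

primrec scheme_path ::
  "real \<Rightarrow> (real \<Rightarrow> real) \<Rightarrow> (real \<Rightarrow> real) \<Rightarrow> real \<Rightarrow> real \<Rightarrow> nat \<Rightarrow> (nat + nat \<Rightarrow> real) \<Rightarrow> real" where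
  "scheme_path \<kappa> b \<sigma> h x\<^sub>0 0 p = x\<^sub>0"
| "scheme_path \<kappa> b \<sigma> h x\<^sub>0 (Suc k) p =
     scheme_step \<kappa> b \<sigma> h (scheme_path \<kappa> b \<sigma> h x\<^sub>0 k p) (p (Inl k)) (p (Inr k))"

lemma measurable_scheme_step:
  assumes [measurable]: "b \<in> borel_measurable borel" "\<sigma> \<in> borel_measurable borel"
  shows "(\<lambda>(x, z, v). scheme_step \<kappa> b \<sigma> h x z v) \<in> borel_measurable (borel \<Otimes>\<^sub>M borel \<Otimes>\<^sub>M borel)"
proof -
  have *: "(\<lambda>(x, z, v). scheme_step \<kappa> b \<sigma> h x z v) = (\<lambda>y.
      if \<not> (0 \<le> fst y \<and> fst y \<le> \<sigma> (fst y) * sqrt (3 * h))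
      then \<bar>fst y + \<sigma> (fst y) * fst (snd y) + b (fst y) * h\<bar>
      else if snd (snd y) \<le> move_prob \<kappa> b \<sigma> h (fst y)
      then \<bar>\<bar>fst y + \<sigma> (fst y) * fst (snd y)\<bar> + b (fst y) * h\<bar> else 0)"
    by (auto simp: fun_eq_iff scheme_step_def boundary_region_def)
  have [measurable]: "move_prob \<kappa> b \<sigma> h \<in> borel_measurable borel"
    unfolding move_prob_def[abs_def] by measurable
  show ?thesis unfolding * by measurable
qed

lemma measurable_scheme_path:
  assumes b: "b \<in> borel_measurable borel" "\<sigma> \<in> borel_measurable borel"
    and "{..<k} <+> {..<k} \<subseteq> I"
  shows "scheme_path \<kappa> b \<sigma> h x\<^sub>0 k \<in> borel_measurable (PiM I (\<lambda>_. borel))"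
  using assms(3)
proof (induction k)
  case (Suc k)
  have [measurable]: "scheme_path \<kappa> b \<sigma> h x\<^sub>0 k \<in> borel_measurable (PiM I (\<lambda>_. borel))"
    by (rule Suc.IH) (use Suc.prems in auto)
  have I: "Inl k \<in> I" "Inr k \<in> I" using Suc.prems by auto
  have "(\<lambda>p. (scheme_path \<kappa> b \<sigma> h x\<^sub>0 k p, p (Inl k), p (Inr k)))
      \<in> PiM I (\<lambda>_. borel) \<rightarrow>\<^sub>M borel \<Otimes>\<^sub>M borel \<Otimes>\<^sub>M borel"
    using I by measurable
  from measurable_compose[OF this measurable_scheme_step[OF b]] show ?case by simp
qed (simp add: scheme_path.simps(1)[abs_def])

text \<open>The state at time \<open>k\<close> reads only noise with index below \<open>k\<close>.
  This is the source of its independence from the noise of step \<open>k\<close>; the sum type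
  merges displacements (\<open>Inl\<close>) and coins (\<open>Inr\<close>) into one independent
  family.\<close>

lemma scheme_path_cong:
  assumes "\<And>i. i \<in> {..<k} <+> {..<k} \<Longrightarrow> p i = p' i"
  shows "scheme_path \<kappa> b \<sigma> h x\<^sub>0 k p = scheme_path \<kappa> b \<sigma> h x\<^sub>0 k p'"
  using assms
proof (induction k)
  case (Suc k)
  have "scheme_path \<kappa> b \<sigma> h x\<^sub>0 k p = scheme_path \<kappa> b \<sigma> h x\<^sub>0 k p'"
    by (rule Suc.IH) (auto intro!: Suc.prems)
  moreover have "p (Inl k) = p' (Inl k)" "p (Inr k) = p' (Inr k)"
    by (auto intro!: Suc.prems)
  ultimately show ?case by simp
qed simp

lemma scheme_step_nonneg: "0 \<le> scheme_step \<kappa> b \<sigma> h x z v"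
  by (simp add: scheme_step_def)

locale scheme_run = prob_space M
  for M :: "'b measure" +
  fixes \<kappa> :: real and b \<sigma> :: "real \<Rightarrow> real" and h :: real and N :: nat and x\<^sub>0 :: real
    and X :: "nat \<Rightarrow> 'b \<Rightarrow> real" and Z V :: "nat \<Rightarrow> 'b \<Rightarrow> real" and K :: real
  assumes h_pos: "h > 0" and x0_nonneg: "0 \<le> x\<^sub>0"
    and b_meas: "b \<in> borel_measurable borel" and \<sigma>_meas: "\<sigma> \<in> borel_measurable borel"
    and growth: "\<And>x. 0 \<le> x \<Longrightarrow> \<bar>b x\<bar> \<le> K * (1 + x)" "\<And>x. 0 \<le> x \<Longrightarrow> \<bar>\<sigma> x\<bar> \<le> K * (1 + x)"
    and indep: "indep_vars (\<lambda>_. borel) (case_sum Z V) ({..<N} <+> {..<N})"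
    and Z_distr: "\<And>k. k < N \<Longrightarrow> distr M borel (Z k) = U (sqrt (3 * h))"
    and V_distr: "\<And>k. k < N \<Longrightarrow> distr M borel (V k) = uniform_measure lborel {0..1}"
    and X_0: "\<And>\<omega>. \<omega> \<in> space M \<Longrightarrow> X 0 \<omega> = x\<^sub>0"
    and X_Suc: "\<And>k \<omega>. k < N \<Longrightarrow> \<omega> \<in> space M \<Longrightarrow>
      X (Suc k) \<omega> = scheme_step \<kappa> b \<sigma> h (X k \<omega>) (Z k \<omega>) (V k \<omega>)"
begin

abbreviation "q \<equiv> sqrt (3 * h)"

lemma Z_meas: "k < N \<Longrightarrow> Z k \<in> borel_measurable M"
  using indep unfolding indep_vars_def by force

lemma V_meas: "k < N \<Longrightarrow> V k \<in> borel_measurable M"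
  using indep unfolding indep_vars_def by force

lemma X_scheme_path: "k \<le> N \<Longrightarrow> \<omega> \<in> space M \<Longrightarrow> X k \<omega> = scheme_path \<kappa> b \<sigma> h x\<^sub>0 k (\<lambda>i. case_sum Z V i \<omega>)"
  by (induction k) (auto simp: X_0 X_Suc)

lemma X_nonneg: "k \<le> N \<Longrightarrow> \<omega> \<in> space M \<Longrightarrow> 0 \<le> X k \<omega>"
  by (cases k) (auto simp: X_0 X_Suc x0_nonneg scheme_step_nonneg)

lemma X_meas: "k \<le> N \<Longrightarrow> X k \<in> borel_measurable M"
proof (induction k)
  case 0
  then show ?case using X_0 by (subst measurable_cong[of _ _ "\<lambda>_. x\<^sub>0"]) auto
next
  case (Suc k)
  then have [measurable]: "X k \<in> borel_measurable M" "Z k \<in> borel_measurable M" "V k \<in> borel_measurable M"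
    using Z_meas V_meas by auto
  have "(\<lambda>\<omega>. (X k \<omega>, Z k \<omega>, V k \<omega>)) \<in> M \<rightarrow>\<^sub>M borel \<Otimes>\<^sub>M borel \<Otimes>\<^sub>M borel" by measurable
  from measurable_compose[OF this measurable_scheme_step[OF b_meas \<sigma>_meas]]
  show ?case using Suc.prems X_Suc by (subst measurable_cong) auto
qed

lemma indep_noise:
  assumes "k < N"
  shows "indep_var borel (Z k) borel (V k)"
proof -
  let ?A = "{Inl k} :: (nat + nat) set" and ?B = "{Inr k} :: (nat + nat) set"
  have "indep_var (PiM ?A (\<lambda>_. borel)) (\<lambda>\<omega>. restrict (\<lambda>i. case_sum Z V i \<omega>) ?A)
      (PiM ?B (\<lambda>_. borel)) (\<lambda>\<omega>. restrict (\<lambda>i. case_sum Z V i \<omega>) ?B)"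
    using assms by (intro indep_var_restrict[OF indep]) auto
  from indep_var_compose[OF this, of "\<lambda>p. p (Inl k)" borel "\<lambda>p. p (Inr k)" borel]
  show ?thesis by (auto simp: comp_def)
qed

text \<open>\<open>indep_var\<close> relates random variables of one type only, so the independence of \<open>X k\<close> from the
  pair \<open>(Z k, V k)\<close> is stated as a product form of the joint distribution.\<close>

lemma distr_joint:
  assumes "k < N"
  shows "distr M (borel \<Otimes>\<^sub>M borel \<Otimes>\<^sub>M borel) (\<lambda>\<omega>. (X k \<omega>, Z k \<omega>, V k \<omega>))
    = distr M borel (X k) \<Otimes>\<^sub>M (U q \<Otimes>\<^sub>M uniform_measure lborel {0..1})"
proof -
  \<comment> \<open>Past noise and the noise of step \<open>k\<close> occupy disjoint blocks of
    indices, so their restrictions are independent.\<close>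
  let ?A = "{..<k} <+> {..<k}" and ?B = "{Inl k, Inr k} :: (nat + nat) set"
  let ?F = "scheme_path \<kappa> b \<sigma> h x\<^sub>0 k" and ?G = "\<lambda>p :: nat + nat \<Rightarrow> real. (p (Inl k), p (Inr k))"
  let ?MA = "PiM ?A (\<lambda>_. borel)" and ?MB = "PiM ?B (\<lambda>_. borel)"
  define RA where "RA = (\<lambda>\<omega>. restrict (\<lambda>i. case_sum Z V i \<omega>) ?A)"
  define RB where "RB = (\<lambda>\<omega>. restrict (\<lambda>i. case_sum Z V i \<omega>) ?B)"
  have ind: "indep_var ?MA RA ?MB RB"
    unfolding RA_def RB_def using assms by (intro indep_var_restrict[OF indep]) auto
  then have [measurable]: "RA \<in> M \<rightarrow>\<^sub>M ?MA" "RB \<in> M \<rightarrow>\<^sub>M ?MB"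
    and D: "distr M (?MA \<Otimes>\<^sub>M ?MB) (\<lambda>\<omega>. (RA \<omega>, RB \<omega>)) = distr M ?MA RA \<Otimes>\<^sub>M distr M ?MB RB"
    by (auto simp: indep_var_distribution_eq)
  have F [measurable]: "?F \<in> ?MA \<rightarrow>\<^sub>M borel"
    by (rule measurable_scheme_path[OF b_meas \<sigma>_meas order_refl])
  have G [measurable]: "?G \<in> ?MB \<rightarrow>\<^sub>M borel \<Otimes>\<^sub>M borel" by measurable
  have FX: "?F (RA \<omega>) = X k \<omega>" if "\<omega> \<in> space M" for \<omega>
    using that assms by (auto simp: X_scheme_path RA_def intro!: scheme_path_cong)
  have GB: "?G (RB \<omega>) = (Z k \<omega>, V k \<omega>)" for \<omega> by (simp add: RB_def)
  have dF: "distr (distr M ?MA RA) borel ?F = distr M borel (X k)"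
    using FX by (subst distr_distr) (auto intro!: distr_cong)
  have dG: "distr (distr M ?MB RB) (borel \<Otimes>\<^sub>M borel) ?G = U q \<Otimes>\<^sub>M uniform_measure lborel {0..1}"
    using indep_noise[OF assms] Z_distr[OF assms] V_distr[OF assms] GB
    by (subst distr_distr) (auto simp: indep_var_distribution_eq comp_def)
  have "distr M borel (X k) \<Otimes>\<^sub>M (U q \<Otimes>\<^sub>M uniform_measure lborel {0..1})
      = distr (distr M ?MA RA) borel ?F \<Otimes>\<^sub>M distr (distr M ?MB RB) (borel \<Otimes>\<^sub>M borel) ?G"
    by (simp only: dF dG)
  also have "\<dots> = distr (distr M ?MA RA \<Otimes>\<^sub>M distr M ?MB RB) (borel \<Otimes>\<^sub>M (borel \<Otimes>\<^sub>M borel))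
      (\<lambda>(x, y). (?F x, ?G y))"
  proof (rule pair_measure_distr)
    have "prob_space (distr (distr M ?MB RB) (borel \<Otimes>\<^sub>M borel) ?G)"
      by (intro prob_space.prob_space_distr prob_space_distr) auto
    then show "sigma_finite_measure (distr (distr M ?MB RB) (borel \<Otimes>\<^sub>M borel) ?G)"
      by (rule prob_space_imp_sigma_finite)
  qed auto
  also have "\<dots> = distr M (borel \<Otimes>\<^sub>M borel \<Otimes>\<^sub>M borel) ((\<lambda>(x, y). (?F x, ?G y)) \<circ> (\<lambda>\<omega>. (RA \<omega>, RB \<omega>)))"
    unfolding D[symmetric] by (rule distr_distr) measurable
  also have "\<dots> = distr M (borel \<Otimes>\<^sub>M borel \<Otimes>\<^sub>M borel) (\<lambda>\<omega>. (X k \<omega>, Z k \<omega>, V k \<omega>))"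
    using FX GB by (intro distr_cong) auto
  finally show ?thesis by simp
qed

lemma step_bound:
  assumes "0 \<le> x" "x \<le> R" "\<bar>z\<bar> \<le> q"
  shows "scheme_step \<kappa> b \<sigma> h x z v \<le> R + K * (1 + R) * q + K * (1 + R) * h"
proof -
  have K: "0 \<le> K" using growth(1)[of 0] by simp
  then have KR: "K * (1 + x) \<le> K * (1 + R)" using assms by (intro mult_left_mono) auto
  have "\<bar>\<sigma> x * z\<bar> \<le> (K * (1 + R)) * q"
    unfolding abs_mult using growth(2)[of x] assms K KR by (intro mult_mono) auto
  moreover have "\<bar>b x * h\<bar> \<le> (K * (1 + R)) * h"
    unfolding abs_mult using growth(1)[of x] assms K KR h_pos by (intro mult_mono) auto
  ultimately show ?thesis using assms by (auto simp: scheme_step_def)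
qed

lemma AE_Z: "k < N \<Longrightarrow> AE \<omega> in M. \<bar>Z k \<omega>\<bar> \<le> q"
proof -
  assume "k < N"
  then have "AE z in distr M borel (Z k). z \<in> {-q..q}" by (simp only: Z_distr AE_U)
  then show ?thesis using Z_meas[OF \<open>k < N\<close>] by (subst (asm) AE_distr_iff) (auto simp: abs_le_iff)
qed

text \<open>Bounded noise moves a bounded state by a bounded amount. The bound depends on
  \<open>k\<close> and serves integrability only; uniform control comes from the fourth
  moments.\<close>

lemma X_bounded: "k \<le> N \<Longrightarrow> \<exists>R. AE \<omega> in M. X k \<omega> \<le> R"
proof (induction k)
  case 0
  show ?case using X_0 by (intro exI[of _ x\<^sub>0]) auto
next
  case (Suc k)
  then obtain R where R: "AE \<omega> in M. X k \<omega> \<le> R" by auto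
  show ?case
    using R AE_Z[of k] Suc.prems X_nonneg[of k] X_Suc[of k]
    by (intro exI[of _ "R + K * (1 + R) * q + K * (1 + R) * h"]) (auto intro!: step_bound)
qed

lemma integrable_X:
  assumes "k \<le> N" "continuous_on UNIV (g :: real \<Rightarrow> real)"
  shows "integrable M (\<lambda>\<omega>. g (X k \<omega>))"
proof -
  obtain R where R: "AE \<omega> in M. X k \<omega> \<le> R" using X_bounded assms by blast
  have "bounded (g ` {0..R})"
    using assms by (intro compact_imp_bounded compact_continuous_image) (auto intro: continuous_on_subset)
  then obtain C where "\<forall>z\<in>{0..R}. \<bar>g z\<bar> \<le> C" by (auto simp: bounded_iff)
  then have C: "\<bar>g z\<bar> \<le> C" if "0 \<le> z" "z \<le> R" for z using that by simp
  have [measurable]: "g \<in> borel_measurable borel" "X k \<in> borel_measurable M"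
    using assms X_meas by (auto intro: borel_measurable_continuous_onI)
  show ?thesis
    using R X_nonneg[OF assms(1)] by (intro integrable_const_bound[of _ C]) (auto intro!: C)
qed

text \<open>The Markov property in integrated form: the joint law is a product, and Fubini averages
  the noise with the state held fixed.\<close>

lemma kernel_expectation:
  assumes "k < N" "continuous_on UNIV (g :: real \<Rightarrow> real)"
  shows "integrable M (\<lambda>\<omega>. kernel \<kappa> b \<sigma> h g (X k \<omega>))" (is ?int)
    and "(\<integral>\<omega>. g (X (Suc k) \<omega>) \<partial>M) = (\<integral>\<omega>. kernel \<kappa> b \<sigma> h g (X k \<omega>) \<partial>M)" (is ?eq)
proof -
  define \<mu> where "\<mu> = distr M borel (X k)"
  define \<nu> where "\<nu> = U q"
  define \<upsilon> where "\<upsilon> = uniform_measure lborel {0..1::real}"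
  define G where "G = (\<lambda>(x, z, v). g (scheme_step \<kappa> b \<sigma> h x z v))"
  note [measurable] = X_meas[OF less_imp_le[OF assms(1)]] Z_meas[OF assms(1)] V_meas[OF assms(1)]
  have q: "q > 0" using h_pos by simp
  interpret \<mu>: prob_space \<mu> unfolding \<mu>_def by (rule prob_space_distr) simp
  interpret \<nu>: prob_space \<nu> unfolding \<nu>_def using q by (rule prob_space_U)
  interpret \<upsilon>: prob_space \<upsilon> unfolding \<upsilon>_def by (rule prob_space_uniform_01)
  interpret \<nu>\<upsilon>: pair_prob_space \<nu> \<upsilon> ..
  interpret \<mu>\<nu>\<upsilon>: pair_prob_space \<mu> "\<nu> \<Otimes>\<^sub>M \<upsilon>" ..
  have sets [measurable_cong]: "sets \<mu> = sets borel" "sets \<nu> = sets borel" "sets \<upsilon> = sets borel"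
    by (auto simp: \<mu>_def \<nu>_def \<upsilon>_def)
  have g [measurable]: "g \<in> borel_measurable borel"
    using assms by (auto intro: borel_measurable_continuous_onI)
  have G [measurable]: "G \<in> borel_measurable (borel \<Otimes>\<^sub>M borel \<Otimes>\<^sub>M borel)"
    using measurable_compose[OF measurable_scheme_step[OF b_meas \<sigma>_meas] g] unfolding G_def
    by (simp add: split_def)
  have D: "distr M (borel \<Otimes>\<^sub>M borel \<Otimes>\<^sub>M borel) (\<lambda>\<omega>. (X k \<omega>, Z k \<omega>, V k \<omega>)) = \<mu> \<Otimes>\<^sub>M (\<nu> \<Otimes>\<^sub>M \<upsilon>)"
    using distr_joint[OF assms(1)] by (simp add: \<mu>_def \<nu>_def \<upsilon>_def)
  have XG: "g (X (Suc k) \<omega>) = G (X k \<omega>, Z k \<omega>, V k \<omega>)" if "\<omega> \<in> space M" for \<omega>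
    using X_Suc[OF assms(1) that] by (simp add: G_def)
  have "integrable M (\<lambda>\<omega>. g (X (Suc k) \<omega>))"
    using assms by (intro integrable_X) auto
  then have iG: "integrable M (\<lambda>\<omega>. G (X k \<omega>, Z k \<omega>, V k \<omega>))"
    using XG by (subst (asm) Bochner_Integration.integrable_cong) auto
  then have int: "integrable (\<mu> \<Otimes>\<^sub>M (\<nu> \<Otimes>\<^sub>M \<upsilon>)) G"
    unfolding D[symmetric] by (subst integrable_distr_eq) auto
  have "(\<integral>\<omega>. g (X (Suc k) \<omega>) \<partial>M) = (\<integral>\<omega>. G (X k \<omega>, Z k \<omega>, V k \<omega>) \<partial>M)"
    using XG by (intro Bochner_Integration.integral_cong) auto
  also have "\<dots> = (\<integral>p. G p \<partial>(\<mu> \<Otimes>\<^sub>M (\<nu> \<Otimes>\<^sub>M \<upsilon>)))"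
    unfolding D[symmetric] by (subst integral_distr) auto
  also have "\<dots> = (\<integral>x. \<integral>y. G (x, y) \<partial>(\<nu> \<Otimes>\<^sub>M \<upsilon>) \<partial>\<mu>)"
    using int by (rule \<mu>\<nu>\<upsilon>.integral_fst'[symmetric])
  also have "\<dots> = (\<integral>\<omega>. \<integral>y. G (X k \<omega>, y) \<partial>(\<nu> \<Otimes>\<^sub>M \<upsilon>) \<partial>M)"
    unfolding \<mu>_def by (subst integral_distr) auto
  finally have 1: "(\<integral>\<omega>. g (X (Suc k) \<omega>) \<partial>M) = (\<integral>\<omega>. \<integral>y. G (X k \<omega>, y) \<partial>(\<nu> \<Otimes>\<^sub>M \<upsilon>) \<partial>M)" .
  have "integrable \<mu> (\<lambda>x. \<integral>y. G (x, y) \<partial>(\<nu> \<Otimes>\<^sub>M \<upsilon>))"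
    using int by (rule \<mu>\<nu>\<upsilon>.integrable_fst')
  then have 2: "integrable M (\<lambda>\<omega>. \<integral>y. G (X k \<omega>, y) \<partial>(\<nu> \<Otimes>\<^sub>M \<upsilon>))"
    unfolding \<mu>_def by (subst (asm) integrable_distr_eq) auto
  \<comment> \<open>Fubini on the product gives integrability only for almost every state; the
    identity is wanted for every \<open>x \<ge> 0\<close>, so a bound for fixed \<open>x\<close> is
    supplied by \<open>step_bound\<close>.\<close>
  have 3: "(\<integral>y. G (x, y) \<partial>(\<nu> \<Otimes>\<^sub>M \<upsilon>)) = kernel \<kappa> b \<sigma> h g x" if "0 \<le> x" for x
  proof -
    define R where "R = x + K * (1 + x) * q + K * (1 + x) * h"
    have "bounded (g ` {0..R})"
      using assms by (intro compact_imp_bounded compact_continuous_image) (auto intro: continuous_on_subset)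
    then obtain C where "\<forall>z\<in>{0..R}. \<bar>g z\<bar> \<le> C" by (auto simp: bounded_iff)
  then have C: "\<bar>g z\<bar> \<le> C" if "0 \<le> z" "z \<le> R" for z using that by simp
    have Gx: "(\<lambda>y. G (x, y)) \<in> borel_measurable (\<nu> \<Otimes>\<^sub>M \<upsilon>)" by measurable
    have "AE z in \<nu>. \<bar>z\<bar> \<le> q"
      using AE_U[of q] unfolding \<nu>_def by eventually_elim (auto simp: abs_le_iff)
    then have "AE y in \<nu> \<Otimes>\<^sub>M \<upsilon>. \<bar>fst y\<bar> \<le> q"
      by (intro \<nu>\<upsilon>.AE_pair_measure) auto
    then have "AE y in \<nu> \<Otimes>\<^sub>M \<upsilon>. norm (G (x, y)) \<le> C"
      by eventually_elim
         (auto simp: G_def R_def split_def intro!: C scheme_step_nonneg step_bound that)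
    then have "integrable (\<nu> \<Otimes>\<^sub>M \<upsilon>) (\<lambda>y. G (x, y))"
      using Gx by (rule \<nu>\<upsilon>.P.integrable_const_bound)
    from \<nu>\<upsilon>.integral_fst'[OF this, symmetric] show ?thesis
      by (simp add: kernel_def G_def \<nu>_def \<upsilon>_def)
  qed
  have 4: "(\<integral>y. G (X k \<omega>, y) \<partial>(\<nu> \<Otimes>\<^sub>M \<upsilon>)) = kernel \<kappa> b \<sigma> h g (X k \<omega>)" if "\<omega> \<in> space M" for \<omega>
    using that assms by (intro 3 X_nonneg) auto
  show ?int using 2 4 by (subst Bochner_Integration.integrable_cong[OF refl 4[symmetric]]) auto
  show ?eq unfolding 1 using 4 by (intro Bochner_Integration.integral_cong) auto
qed

end

section \<open>The local error\<close>

text \<open>The remainder carries \<open>fact n\<close>, a weaker constant than Lagrange's form;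
  only its order in \<open>z - w\<close> matters.\<close>

lemma derivs_on_Taylor:
  assumes "derivs_on S k f D" "convex S" "n < k" "\<And>y. y \<in> S \<Longrightarrow> \<bar>D (Suc n) y\<bar> \<le> B" "w \<in> S" "z \<in> S"
  shows "\<bar>f z - (\<Sum>i\<le>n. D i w * (z - w)^i / fact i)\<bar> \<le> B * \<bar>z - w\<bar>^(Suc n) / fact n"
  using field_Taylor[of S n D B w z] assms unfolding derivs_on_def by auto

lemma derivs_on_shift: "derivs_on S (Suc k) f D \<Longrightarrow> derivs_on S k (D 1) (\<lambda>j. D (Suc j))"
  unfolding derivs_on_def by auto

lemma derivs_on_continuous: "derivs_on S (Suc k) f D \<Longrightarrow> continuous_on S f"
  unfolding derivs_on_def
  by (metis DERIV_continuous_on continuous_on_cong zero_less_Suc)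

text \<open>Two kinds of error are kept apart: \<beta> is uniform in the noise, whereas \<alpha> is
  the cost of a reflection and \<open>I\<close> the indicator of the noise that causes it. A cost of
  order q^2 on an event of probability of order q thus counts as q^3.\<close>

lemma integral_U_approx:
  fixes g P I :: "real \<Rightarrow> real"
  assumes q: "q > 0" and int: "integrable (U q) g" "integrable (U q) P" "integrable (U q) I"
    and le: "\<And>z. \<bar>z\<bar> \<le> q \<Longrightarrow> \<bar>g z - P z\<bar> \<le> \<alpha> * I z + \<beta>"
  shows "\<bar>(\<integral>z. g z \<partial>U q) - (\<integral>z. P z \<partial>U q)\<bar> \<le> \<alpha> * (\<integral>z. I z \<partial>U q) + \<beta>"
proof -
  interpret prob_space "U q" using q by (rule prob_space_U)
  have "\<bar>(\<integral>z. g z \<partial>U q) - (\<integral>z. P z \<partial>U q)\<bar> = \<bar>\<integral>z. g z - P z \<partial>U q\<bar>"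
    using int by simp
  also have "\<dots> \<le> (\<integral>z. \<bar>g z - P z\<bar> \<partial>U q)" by (rule integral_abs_bound)
  also have "\<dots> \<le> (\<integral>z. \<alpha> * I z + \<beta> \<partial>U q)"
    using int le by (intro integral_U_mono) auto
  also have "\<dots> = \<alpha> * (\<integral>z. I z \<partial>U q) + \<beta>"
    using int prob_space by simp
  finally show ?thesis .
qed

lemma integral_U_shift_square:
  assumes "q > 0"
  shows "(\<integral>z. (y + \<sigma> * z)^2 \<partial>U q) = y^2 + \<sigma>^2 * q^2 / 3"
  using integral_U_cubic[OF assms, of "y^2" "2 * y * \<sigma>" "\<sigma>^2" 0]
  by (simp add: power2_eq_square algebra_simps)

text \<open>Everything is measured in the half-width \<open>q\<close> of the noise. The three
  smallness conditions let the implicit bound \<open>x \<le> K * (1 + x) * (2 * q)\<close> be solved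
  for \<open>x\<close>, keep the drift of one step small against \<open>m * q\<close>, and place the
  boundary layer inside the interval of ellipticity.\<close>

locale sticky_coeffs =
  fixes \<kappa> :: real and b \<sigma> :: "real \<Rightarrow> real" and K m r h q :: real
  assumes \<kappa>_pos: "\<kappa> > 0" and K_ge_1: "K \<ge> 1" and m_pos: "m > 0"
    and growth_b: "\<And>x. 0 \<le> x \<Longrightarrow> \<bar>b x\<bar> \<le> K * (1 + x)"
    and growth_\<sigma>: "\<And>x. 0 \<le> x \<Longrightarrow> \<bar>\<sigma> x\<bar> \<le> K * (1 + x)"
    and elliptic: "\<And>x. 0 \<le> x \<Longrightarrow> x \<le> r \<Longrightarrow> m \<le> \<sigma> x"
    and Lip_b: "\<And>x. 0 \<le> x \<Longrightarrow> x \<le> r \<Longrightarrow> \<bar>b x - b 0\<bar> \<le> K * x"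
    and Lip_\<sigma>: "\<And>x. 0 \<le> x \<Longrightarrow> x \<le> r \<Longrightarrow> \<bar>\<sigma> x - \<sigma> 0\<bar> \<le> K * x"
    and q_pos: "q > 0" and h_eq: "h = q^2 / 3"
    and small: "8 * K * q \<le> 1" "8 * K * q \<le> m" "4 * K * q \<le> r"
begin

lemma h_pos: "h > 0" using q_pos by (simp add: h_eq)

lemma sqrt_eq: "sqrt (3 * h) = q" using q_pos by (simp add: h_eq)

lemma Kq: "K * q \<le> 1 / 8" "K * q \<le> m / 8" "q \<le> 1 / 8"
proof -
  show *: "K * q \<le> 1 / 8" "K * q \<le> m / 8" using small by auto
  have "1 * q \<le> K * q" using K_ge_1 q_pos by (intro mult_right_mono) auto
  with * show "q \<le> 1 / 8" by simp
qed

text \<open>The second hypothesis is common to points of the boundary region and to points from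
  which the drift can cause a reflection. Linear growth leaves \<open>x\<close> on its right side;
  as \<open>2 * K * q \<le> 1/4\<close>, that part is absorbed.\<close>

lemma near_zero:
  assumes "0 \<le> x" "x \<le> K * (1 + x) * (2 * q)"
  shows "x \<le> 4 * K * q" "x \<le> r" "x \<le> 1" "m \<le> \<sigma> x" "\<sigma> x \<le> 2 * K" "\<bar>b x\<bar> \<le> 2 * K"
    "\<bar>b x * h\<bar> \<le> K * q^2"
proof -
  have "x \<le> 2 * (K * q) + 2 * (K * q) * x" using assms(2) by (simp add: algebra_simps)
  moreover have "2 * (K * q) * x \<le> 1/4 * x" using Kq(1) assms(1) by (intro mult_right_mono) auto
  moreover have "0 \<le> K * q" using K_ge_1 q_pos by simp
  ultimately show x: "x \<le> 4 * K * q" by (simp add: mult.assoc)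
  then show "x \<le> r" "x \<le> 1" using small Kq by auto
  then show "m \<le> \<sigma> x" using elliptic assms by auto
  have "K * (1 + x) \<le> K * 2" using \<open>x \<le> 1\<close> K_ge_1 by (intro mult_left_mono) auto
  then show "\<sigma> x \<le> 2 * K" and b: "\<bar>b x\<bar> \<le> 2 * K" using growth_b growth_\<sigma> assms by fastforce+
  have "\<bar>b x * h\<bar> = \<bar>b x\<bar> * h" using h_pos by (simp add: abs_mult)
  also have "\<dots> \<le> 2 * K * (q^2/3)" using b h_eq h_pos by (intro mult_mono) auto
  also have "\<dots> \<le> K * q^2" using K_ge_1 by simp
  finally show "\<bar>b x * h\<bar> \<le> K * q^2" .
qed

lemma boundary_near_zero:
  assumes "x \<in> boundary_region \<sigma> h"
  shows "0 \<le> x" "x \<le> K * (1 + x) * (2 * q)" "x \<le> \<sigma> x * q"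
proof -
  show x: "0 \<le> x" "x \<le> \<sigma> x * q" using assms by (auto simp: boundary_region_def sqrt_eq)
  note x(2)
  also have "\<sigma> x * q \<le> (K * (1 + x)) * (2 * q)"
    using growth_\<sigma>[OF x(1)] q_pos x by (intro mult_mono) auto
  finally show "x \<le> K * (1 + x) * (2 * q)" .
qed

lemma move_prob_eq:
  "move_prob \<kappa> b \<sigma> h x =
     (((\<sigma> x)^2 - 2 * \<kappa> * b x) * x^2 + 2 * \<kappa> * (\<sigma> x)^2 * x + (\<sigma> x)^4 * (q^2/3)) /
     ((\<kappa> * \<sigma> x / q + (\<sigma> x)^2 - 2 * \<kappa> * b x) * x^2 + (\<sigma> x)^3 * \<kappa> * q + (\<sigma> x)^4 * (q^2/3))"
  unfolding move_prob_def sqrt_eq by (simp add: h_eq)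

section \<open>Size and defining identity of the jump probability\<close>

context
  fixes x assumes x: "x \<in> boundary_region \<sigma> h"
begin

private abbreviation (input) "s \<equiv> \<sigma> x"
private abbreviation (input) "den \<equiv> (\<kappa> * s / q + s^2 - 2 * \<kappa> * b x) * x^2 + s^3 * \<kappa> * q + s^4 * (q^2/3)"
private abbreviation (input) "num \<equiv> (s^2 - 2 * \<kappa> * b x) * x^2 + 2 * \<kappa> * s^2 * x + s^4 * (q^2/3)"

private lemmas bd = boundary_near_zero[OF x]
private lemmas nz = near_zero[OF bd(1,2)]

private lemma s_pos: "s > 0" using nz m_pos by linarith

text \<open>The drift term is the only possibly negative part of the numerator. Since
  \<open>x \<le> s * q\<close> and \<open>4 * K * q \<le> s\<close>, it consumes at most half of
  \<open>2 * \<kappa> * s^2 * x\<close>.\<close>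

private lemma bx2: "2 * \<kappa> * b x * x^2 \<le> \<kappa> * s^2 * x"
proof -
  have "2 * \<kappa> * b x * x^2 \<le> 2 * \<kappa> * (2 * K) * (x * (s * q))"
    using nz bd \<kappa>_pos q_pos K_ge_1 s_pos unfolding power2_eq_square
    by (intro mult_mono mult_mono[OF mult_left_mono]) auto
  also have "\<dots> = \<kappa> * (x * s) * (4 * (K * q))" by simp
  also have "\<dots> \<le> \<kappa> * (x * s) * s"
    using nz bd \<kappa>_pos Kq s_pos by (intro mult_left_mono) auto
  finally show ?thesis by (simp add: power2_eq_square mult_ac)
qed

lemma num_ge: "num \<ge> \<kappa> * s^2 * x"
proof -
  have "0 \<le> s^2 * x^2" "0 \<le> s^4 * (q^2/3)" using s_pos by auto
  with bx2 show ?thesis unfolding left_diff_distrib by linarith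
qed

text \<open>A complete square, so \<lambda> is at most 1, with equality exactly at the outer edge
  \<open>x = s * q\<close> of the region.\<close>

lemma den_minus_num: "den - num = \<kappa> * s / q * (x - s * q)^2"
  using q_pos by (simp add: field_simps power2_eq_square power3_eq_cube)

lemma den_ge: "den \<ge> \<kappa> * s / q * (x - s * q)^2 + \<kappa> * s^2 * x"
  using num_ge den_minus_num by linarith

lemma den_pos: "den > 0"
proof (cases "x = 0")
  case True
  have "s^3 * \<kappa> * q + s^4 * (q^2/3) > 0"
    using s_pos \<kappa>_pos q_pos by (intro add_pos_nonneg) auto
  then show ?thesis using True by simp
next
  case False
  then have "\<kappa> * s^2 * x > 0" using s_pos \<kappa>_pos bd by simp
  moreover have "\<kappa> * s / q * (x - s * q)^2 \<ge> 0" using s_pos \<kappa>_pos q_pos by simp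
  ultimately show ?thesis using den_ge by linarith
qed

text \<open>Because \<open>x \<le> s * q\<close>, every summand is of order q. Together with
  \<open>num_ge\<close> this bounds \<lambda> from below by a multiple of x / q.\<close>

lemma den_le: "den \<le> 32 * K^4 * (\<kappa> + 1) * q"
proof -
  have K0: "K \<ge> 0" and q1: "q \<le> 1" using K_ge_1 Kq by auto
  have x2: "x^2 \<le> (s * q)^2" using bd by (intro power_mono) auto
  have s3: "s^3 \<le> 8 * K^3"
    using power_mono[of s "2 * K" 3] nz s_pos by (simp add: power_mult_distrib)
  have s4: "s^4 \<le> 16 * K^4"
    using power_mono[of s "2 * K" 4] nz s_pos by (simp add: power_mult_distrib)
  have s2: "s^2 \<le> 4 * K^2"
    using power_mono[of s "2 * K" 2] nz s_pos by (simp add: power_mult_distrib)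
  have q2: "q^2 \<le> q" using q1 q_pos by (simp add: power2_eq_square mult_left_le)
  have K34: "K^3 \<le> K^4" using K_ge_1 by (intro power_increasing) auto
  have "\<kappa> * s / q * x^2 \<le> \<kappa> * s / q * (s * q)^2"
    using x2 s_pos q_pos \<kappa>_pos by (intro mult_left_mono) auto
  also have "\<dots> = \<kappa> * s^3 * q" using q_pos by (simp add: field_simps power2_eq_square power3_eq_cube)
  finally have 1: "\<kappa> * s / q * x^2 \<le> \<kappa> * s^3 * q" .
  have "s^2 * x^2 \<le> s^2 * (s * q)^2" using x2 by (intro mult_left_mono) auto
  also have "\<dots> = s^4 * q^2" by (simp add: power_mult_distrib flip: power_add)
  finally have 2: "s^2 * x^2 \<le> s^4 * q^2" .
  have "- (2 * \<kappa> * b x * x^2) = 2 * \<kappa> * (- b x) * x^2" by simp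
  also have "\<dots> \<le> 2 * \<kappa> * (2 * K) * (s * q)^2"
    using nz x2 \<kappa>_pos K0 by (intro mult_mono[OF mult_left_mono]) auto
  also have "\<dots> = 4 * \<kappa> * K * (s^2 * q^2)" by (simp add: power_mult_distrib)
  also have "\<dots> \<le> 4 * \<kappa> * K * ((4 * K^2) * q)"
    using s2 q2 \<kappa>_pos K0 by (intro mult_left_mono mult_mono) auto
  also have "\<dots> = 16 * \<kappa> * (K^3 * q)" by (simp add: power3_eq_cube power2_eq_square)
  also have "\<dots> \<le> 16 * \<kappa> * (K^4 * q)"
    using K34 \<kappa>_pos q_pos by (intro mult_left_mono mult_right_mono) auto
  finally have 3: "- (2 * \<kappa> * b x * x^2) \<le> 16 * \<kappa> * (K^4 * q)" .
  have 4: "\<kappa> * s^3 * q \<le> \<kappa> * (8 * K^4) * q"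
    using s3 K34 \<kappa>_pos q_pos by (intro mult_left_mono mult_right_mono) auto
  have 5: "s^4 * q^2 \<le> 16 * K^4 * q"
    using s4 q2 s_pos by (intro mult_mono) auto
  have "den = \<kappa> * s / q * x^2 + s^2 * x^2 - 2 * \<kappa> * b x * x^2 + \<kappa> * s^3 * q + s^4 * q^2/3"
    by (simp add: algebra_simps)
  moreover have "0 \<le> K^4 * q" using K0 q_pos by simp
  ultimately have "den \<le> 2 * (\<kappa> * (8 * K^4) * q) + 16 * \<kappa> * (K^4 * q) + 2 * (16 * K^4 * q)"
    using 1 2 3 4 5 by linarith
  then show ?thesis by (simp add: algebra_simps)
qed

lemma move_prob_nonneg: "0 \<le> move_prob \<kappa> b \<sigma> h x"
proof -
  have "0 \<le> \<kappa> * s^2 * x" using \<kappa>_pos bd by simp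
  then have "0 \<le> num" using num_ge by linarith
  then show ?thesis unfolding move_prob_eq using den_pos by (intro divide_nonneg_pos) auto
qed

lemma move_prob_le_1: "move_prob \<kappa> b \<sigma> h x \<le> 1"
proof -
  have "\<kappa> * s / q * (x - s * q)^2 \<ge> 0" using s_pos \<kappa>_pos q_pos by simp
  then have "num \<le> den" using den_minus_num by linarith
  then show ?thesis unfolding move_prob_eq using den_pos by (simp add: divide_le_eq_1)
qed

text \<open>Converts errors of size q^2 x, which lack the factor \<lambda>, into errors of size q^3
  \<lambda>.\<close>

lemma x_le_move_prob: "x \<le> 32 * K^4 * (\<kappa> + 1) / (\<kappa> * m^2) * q * move_prob \<kappa> b \<sigma> h x"
proof -
  have "\<kappa> * m^2 * x \<le> \<kappa> * s^2 * x"
    using nz m_pos \<kappa>_pos bd by (intro mult_left_mono mult_right_mono power_mono) auto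
  also have "\<dots> \<le> num" by (rule num_ge)
  also have "\<dots> = move_prob \<kappa> b \<sigma> h x * den" unfolding move_prob_eq using den_pos by simp
  also have "\<dots> \<le> move_prob \<kappa> b \<sigma> h x * (32 * K^4 * (\<kappa> + 1) * q)"
    using den_le move_prob_nonneg by (intro mult_left_mono) auto
  finally show ?thesis using m_pos \<kappa>_pos by (simp add: field_simps)
qed

text \<open>This identity is the origin of the formula for \<open>\<lambda>\<close>: for a function \<open>f\<close> with
  \<open>f''(0) = M f'(0)\<close>, where \<open>M = (\<sigma>\<^sup>2 - 2 \<kappa> b) / (\<kappa> \<sigma>\<^sup>2)\<close> as in the sticky boundary condition, all
  terms of the local error up to second order cancel.\<close>

lemma move_prob_identity:
  defines "p \<equiv> move_prob \<kappa> b \<sigma> h x"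
  defines "EA \<equiv> (x^2 + (s * q)^2) / (2 * (s * q))" and "EY \<equiv> x^2 + s^2 * q^2 / 3"
  shows "p * (EA + b x * h) - x - b x * h
    + (s^2 - 2 * \<kappa> * b x) / (\<kappa> * s^2) / 2 * (p * EY - x^2 - s^2 * h) = 0"
proof -
  have M: "2 * \<kappa> * s^2 * ((s^2 - 2 * \<kappa> * b x) / (\<kappa> * s^2) / 2 * y) = (s^2 - 2 * \<kappa> * b x) * y" for y
    using s_pos \<kappa>_pos by simp
  \<comment> \<open>Up to the factor \<open>2 * \<kappa> * s^2\<close>, the denominator is the mean
    of f(w) = w + M/2 w^2 after a move (the drift entering to first order only), and the numerator
    is f(x) plus \<open>h\<close> times the generator formed with f'(0) and f''(0). As f(0) = 0, the
    ratio is the probability that balances the two.\<close>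
  have "2 * \<kappa> * s^2 * EA = \<kappa> * s / q * x^2 + s^3 * \<kappa> * q"
    unfolding EA_def using s_pos q_pos by (simp add: field_simps power2_eq_square power3_eq_cube)
  then have den: "den = 2 * \<kappa> * s^2 * (EA + b x * h + (s^2 - 2 * \<kappa> * b x) / (\<kappa> * s^2) / 2 * EY)"
    unfolding distrib_left M EY_def h_eq by (simp add: algebra_simps power4_eq_xxxx power2_eq_square)
  have num: "num = 2 * \<kappa> * s^2 * (x + b x * h + (s^2 - 2 * \<kappa> * b x) / (\<kappa> * s^2) / 2 * (x^2 + s^2 * h))"
    unfolding distrib_left[of "2 * \<kappa> * s^2"] M h_eq
    by (simp add: algebra_simps power4_eq_xxxx power2_eq_square)
  have "p * den = num" unfolding p_def move_prob_eq using den_pos by simp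
  then have "2 * \<kappa> * s^2 * (p * (EA + b x * h + (s^2 - 2 * \<kappa> * b x) / (\<kappa> * s^2) / 2 * EY))
     = 2 * \<kappa> * s^2 * (x + b x * h + (s^2 - 2 * \<kappa> * b x) / (\<kappa> * s^2) / 2 * (x^2 + s^2 * h))"
    unfolding num den by (simp only: mult_ac)
  then have "p * (EA + b x * h + (s^2 - 2 * \<kappa> * b x) / (\<kappa> * s^2) / 2 * EY)
     = x + b x * h + (s^2 - 2 * \<kappa> * b x) / (\<kappa> * s^2) / 2 * (x^2 + s^2 * h)"
    using s_pos \<kappa>_pos by simp
  then show ?thesis by (simp only: algebra_simps)
qed

text \<open>Order q^2 is enough: the defect is later multiplied by a difference of order x, or
  enters where a loss of order q^2 is allowed.\<close>

lemma second_moment_defect: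
  "\<bar>move_prob \<kappa> b \<sigma> h x * (x^2 + s^2 * q^2 / 3) - x^2 - s^2 * h\<bar> \<le> 6 * K^2 * q^2"
proof -
  define p EY where "p = move_prob \<kappa> b \<sigma> h x" and "EY = x^2 + s^2 * q^2 / 3"
  have p: "0 \<le> p" "p \<le> 1"
    unfolding p_def using move_prob_nonneg move_prob_le_1 by auto
  have x2: "x^2 \<le> s^2 * q^2"
    using power_mono[OF bd(3,1), of 2] by (simp add: power_mult_distrib)
  have s2: "s^2 * q^2 \<le> (2 * K)^2 * q^2"
    using nz s_pos by (intro mult_right_mono power_mono) auto
  have "0 \<le> EY" unfolding EY_def by simp
  then have "0 \<le> p * EY" "p * EY \<le> EY" using p by (auto intro: mult_left_le_one_le)
  moreover have "EY = x^2 + s^2 * h" by (simp add: EY_def h_eq)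
  moreover have "EY \<le> 4/3 * (s^2 * q^2)" using x2 unfolding EY_def by linarith
  ultimately have "\<bar>p * EY - x^2 - s^2 * h\<bar> \<le> 4/3 * (s^2 * q^2)" by linarith
  also have "\<dots> \<le> 4/3 * ((2 * K)^2 * q^2)" using s2 by (rule mult_left_mono) simp
  also have "\<dots> \<le> 6 * K^2 * q^2" by (simp add: power_mult_distrib mult_right_mono)
  finally show ?thesis unfolding p_def EY_def .
qed

end

end

section \<open>Local error in the boundary region\<close>

lemma abs_mult_mono: "\<bar>x\<bar> \<le> a \<Longrightarrow> \<bar>y\<bar> \<le> b \<Longrightarrow> \<bar>x * y\<bar> \<le> a * b" for x y a b :: real
  unfolding abs_mult by (rule mult_mono') auto

lemma measure_U_UNIV: "q > 0 \<Longrightarrow> measure (U q) UNIV = 1"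
  using prob_space.prob_space[OF prob_space_U] by simp

locale sticky_test_function = sticky_coeffs +
  fixes F :: "nat \<Rightarrow> real \<Rightarrow> real" and B :: real
  assumes derivs: "derivs_on {0..} 4 (F 0) F"
    and bound: "\<And>j x. 1 \<le> j \<Longrightarrow> j \<le> 4 \<Longrightarrow> 0 \<le> x \<Longrightarrow> \<bar>F j x\<bar> \<le> B"
    and boundary_condition:
      "(\<sigma> 0)^2 / 2 * F 1 0 = \<kappa> * (b 0 * F 1 0 + (\<sigma> 0)^2 / 2 * F 2 0)"
begin

text \<open>By the backward equation the generator term is minus the time derivative of u, so this
  is the one-step defect of u up to a Taylor remainder in time.\<close>

definition generator_error :: "real \<Rightarrow> real" where
  "generator_error x =
     kernel \<kappa> b \<sigma> h (F 0) x - F 0 x - h * (b x * F 1 x + (\<sigma> x)^2 / 2 * F 2 x)"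

lemma B_nonneg: "0 \<le> B" using bound[of 1 0] by simp

lemma F_cont: "continuous_on {0..} (F 0)"
  using derivs_on_continuous[of "{0..}" 3 "F 0" F] derivs by (simp add: numeral_eq_Suc)

lemma integrable_F:
  assumes "continuous_on UNIV w" "\<And>z. 0 \<le> w z"
  shows "integrable (U q) (\<lambda>z. F 0 (w z))"
  using assms q_pos by (intro integrable_U_cont continuous_on_compose2[OF F_cont]) auto

lemma Taylor4:
  assumes "0 \<le> x" "0 \<le> y"
  shows "\<bar>F 0 y - (F 0 x + F 1 x * (y - x) + F 2 x / 2 * (y - x)^2 + F 3 x / 6 * (y - x)^3)\<bar>
    \<le> B * (y - x)^4 / 6"
  using derivs_on_Taylor[OF derivs, of 3 B x y] bound[of 4] assms
  by (simp add: numeral_eq_Suc fact_numeral)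

lemma Taylor3:
  assumes "0 \<le> x" "0 \<le> y"
  shows "\<bar>F 0 y - (F 0 x + F 1 x * (y - x) + F 2 x / 2 * (y - x)^2)\<bar> \<le> B * \<bar>y - x\<bar>^3 / 2"
  using derivs_on_Taylor[OF derivs, of 2 B x y] bound[of 3] assms
  by (simp add: numeral_eq_Suc fact_numeral)

lemma Lip_F:
  assumes "0 \<le> x" "0 \<le> y"
  shows "\<bar>F 1 y - F 1 x\<bar> \<le> B * \<bar>y - x\<bar>" "\<bar>F 2 y - F 2 x\<bar> \<le> B * \<bar>y - x\<bar>"
proof -
  have d1: "derivs_on {0..} (Suc 2) (F 1) (\<lambda>j. F (Suc j))"
    using derivs derivs_on_shift[of "{0..}" 3 "F 0" F] by (simp add: numeral_eq_Suc)
  have d2: "derivs_on {0..} 2 (F 2) (\<lambda>j. F (Suc (Suc j)))"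
    using derivs_on_shift[OF d1] by (simp add: numeral_eq_Suc)
  show "\<bar>F 1 y - F 1 x\<bar> \<le> B * \<bar>y - x\<bar>"
    using derivs_on_Taylor[OF d1, of 0 B x y] bound[of 2] assms by (simp add: numeral_eq_Suc)
  show "\<bar>F 2 y - F 2 x\<bar> \<le> B * \<bar>y - x\<bar>"
    using derivs_on_Taylor[OF d2, of 0 B x y] bound[of 3] assms by (simp add: numeral_eq_Suc)
qed

text \<open>The outer modulus acts only if \<open>\<bar>y\<bar> \<le> \<bar>c\<bar>\<close>;
  dropping it elsewhere is free. The cubic remainder with a point below 5 K q gives 125/2, replacing
  its square by \<open>y^2\<close> gives 9/2; the sum 67 is rounded up to 68.\<close>

lemma reflected_expansion:
  fixes y c :: real
  assumes "\<bar>y\<bar> \<le> 4 * (K * q)" "\<bar>c\<bar> \<le> K * q^2"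
  shows "\<bar>F 0 \<bar>\<bar>y\<bar> + c\<bar> - (F 0 0 + F 1 0 * (\<bar>y\<bar> + c) + F 2 0 / 2 * y^2)\<bar>
    \<le> 2 * B * \<bar>c\<bar> * indicator {-\<bar>c\<bar>..\<bar>c\<bar>} y + 68 * B * K^3 * q^3"
proof -
  define W where "W = \<bar>\<bar>y\<bar> + c\<bar>"
  have Kq0: "0 \<le> K * q" and q1: "q \<le> 1" using K_ge_1 q_pos Kq by auto
  have "K * q^2 \<le> K * q" using q1 q_pos K_ge_1 by (simp add: power2_eq_square mult_left_le)
  then have W: "0 \<le> W" "W \<le> 5 * (K * q)" unfolding W_def using assms by linarith+
  have W3: "W^3 \<le> 125 * (K * q)^3"
    using power_mono[OF W(2,1), of 3] by (simp add: power_mult_distrib)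
  have e1: "\<bar>W - (\<bar>y\<bar> + c)\<bar> \<le> 2 * \<bar>c\<bar> * indicator {-\<bar>c\<bar>..\<bar>c\<bar>} y"
    unfolding W_def by (auto simp: indicator_def)
  have "W^2 - y^2 = 2 * \<bar>y\<bar> * c + c^2" unfolding W_def by (simp add: power2_eq_square algebra_simps)
  then have "\<bar>W^2 - y^2\<bar> \<le> \<bar>2 * \<bar>y\<bar> * c\<bar> + \<bar>c^2\<bar>" by linarith
  also have "\<dots> = 2 * \<bar>y\<bar> * \<bar>c\<bar> + \<bar>c\<bar> * \<bar>c\<bar>" by (simp add: abs_mult power2_eq_square)
  also have "\<dots> \<le> 2 * (4 * (K * q)) * (K * q^2) + (K * q) * (K * q^2)"
    using assms \<open>K * q^2 \<le> K * q\<close> Kq0 by (intro add_mono mult_mono) auto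
  also have "\<dots> = 9 * K^2 * q^3" by (simp add: power2_eq_square power3_eq_cube)
  also have "\<dots> \<le> 9 * K^3 * q^3"
    using K_ge_1 q_pos by (intro mult_right_mono mult_left_mono power_increasing) auto
  finally have e2: "\<bar>W^2 - y^2\<bar> \<le> 9 * K^3 * q^3" .
  have t: "\<bar>F 0 W - (F 0 0 + F 1 0 * W + F 2 0 / 2 * W^2)\<bar> \<le> B * W^3 / 2"
    using Taylor3[of 0 W] W by simp
  have "\<bar>F 1 0 * (W - (\<bar>y\<bar> + c))\<bar> \<le> B * (2 * \<bar>c\<bar> * indicator {-\<bar>c\<bar>..\<bar>c\<bar>} y)"
    unfolding abs_mult using bound[of 1 0] e1 B_nonneg by (intro mult_mono) auto
  moreover have "\<bar>F 2 0 / 2 * (W^2 - y^2)\<bar> \<le> B / 2 * (9 * K^3 * q^3)"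
    unfolding abs_mult using bound[of 2 0] e2 B_nonneg by (intro mult_mono) auto
  moreover have "B * W^3 / 2 \<le> B * (125 * (K * q)^3) / 2"
    using W3 B_nonneg by (intro divide_right_mono mult_left_mono) auto
  moreover have "F 0 W - (F 0 0 + F 1 0 * (\<bar>y\<bar> + c) + F 2 0 / 2 * y^2)
     = (F 0 W - (F 0 0 + F 1 0 * W + F 2 0 / 2 * W^2)) + F 1 0 * (W - (\<bar>y\<bar> + c)) + F 2 0 / 2 * (W^2 - y^2)"
    by (simp add: algebra_simps)
  moreover have "0 \<le> B * K^3 * q^3" using B_nonneg K_ge_1 q_pos by simp
  ultimately have "\<bar>F 0 W - (F 0 0 + F 1 0 * (\<bar>y\<bar> + c) + F 2 0 / 2 * y^2)\<bar>
    \<le> B * (125 * (K * q)^3) / 2 + B * (2 * \<bar>c\<bar> * indicator {-\<bar>c\<bar>..\<bar>c\<bar>} y) + B / 2 * (9 * K^3 * q^3)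
      + B * K^3 * q^3"
    using t by linarith
  then show ?thesis
    unfolding W_def[symmetric] power_mult_distrib by (simp add: algebra_simps)
qed

text \<open>\<open>2 * K^2 / m\<close> is the cost of a second reflection, \<open>68 * K^3\<close>
  the expansion of the moved point; the factor \<open>24 * K^5 / m^4 + 4 * K^2\<close> collects the
  errors of size q^2 x, converted by \<open>x_le_move_prob\<close>.\<close>

definition C_bdry :: real where
  "C_bdry = 2 * K^2 / m + 68 * K^3
     + (24 * K^5 / m^4 + 4 * K^2) * (32 * K^4 * (\<kappa> + 1) / (\<kappa> * m^2))"

text \<open>The expansion is made about 0, not about \<open>x\<close>, since the boundary condition
  links the first two derivatives only there. What does not cancel is multiplied by \<open>p\<close>
  or is of order q^2 x.\<close>

lemma local_error_boundary:
  assumes x: "x \<in> boundary_region \<sigma> h"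
  shows "\<bar>generator_error x\<bar> \<le> B * C_bdry * q^3 * move_prob \<kappa> b \<sigma> h x"
proof -
  define s c p where "s = \<sigma> x" and "c = b x * h" and "p = move_prob \<kappa> b \<sigma> h x"
  define EA EY where "EA = (x^2 + (s * q)^2) / (2 * (s * q))" and "EY = x^2 + s^2 * q^2 / 3"
  define M M0 where "M = (s^2 - 2 * \<kappa> * b x) / (\<kappa> * s^2)"
    and "M0 = ((\<sigma> 0)^2 - 2 * \<kappa> * b 0) / (\<kappa> * (\<sigma> 0)^2)"
  note bd = boundary_near_zero[OF x, folded s_def]
  note nz = near_zero[OF bd(1,2), folded s_def c_def]
  have s_pos: "s > 0" using nz m_pos by linarith
  have K0: "K > 0" using K_ge_1 by simp
  have sq: "s * q \<le> 2 * K * q" using nz q_pos by (intro mult_right_mono) auto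
  have p: "0 \<le> p" "p \<le> 1"
    unfolding p_def using move_prob_nonneg[OF x] move_prob_le_1[OF x] by auto

  define P where "P = F 0 0 + F 1 0 * (EA + c) + F 2 0 / 2 * EY"
  define EF where "EF = (\<integral>z. F 0 \<bar>\<bar>x + s * z\<bar> + c\<bar> \<partial>U q)"
  have P: "P = (\<integral>z. F 0 0 + F 1 0 * (\<bar>x + s * z\<bar> + c) + F 2 0 / 2 * (x + s * z)^2 \<partial>U q)"
  proof -
    have 1: "integrable (U q) (\<lambda>z. \<bar>x + s * z\<bar>)" "integrable (U q) (\<lambda>z. (x + s * z)^2)"
       "\<And>a. integrable (U q) (\<lambda>z. a::real)"
      using q_pos by (auto intro!: integrable_U_cont continuous_intros)
    have "(\<integral>z. F 0 0 + F 1 0 * (\<bar>x + s * z\<bar> + c) + F 2 0 / 2 * (x + s * z)^2 \<partial>U q)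
      = F 0 0 + F 1 0 * ((\<integral>z. \<bar>x + s * z\<bar> \<partial>U q) + c) + F 2 0 / 2 * (\<integral>z. (x + s * z)^2 \<partial>U q)"
      using 1 measure_U_UNIV[OF q_pos] by simp
    then show ?thesis
      using integral_U_abs[OF q_pos s_pos bd(1,3)] integral_U_shift_square[OF q_pos, of x s]
      by (simp add: P_def EA_def EY_def)
  qed
  have "\<bar>EF - P\<bar> \<le> 2 * B * \<bar>c\<bar> * (\<integral>z. indicator {-\<bar>c\<bar>..\<bar>c\<bar>} (x + s * z) \<partial>U q) + 68 * B * K^3 * q^3"
    unfolding EF_def P
  proof (rule integral_U_approx[OF q_pos])
    show "integrable (U q) (\<lambda>z. F 0 \<bar>\<bar>x + s * z\<bar> + c\<bar>)"
      by (intro integrable_F) (auto intro!: continuous_intros)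
    show "integrable (U q) (\<lambda>z. F 0 0 + F 1 0 * (\<bar>x + s * z\<bar> + c) + F 2 0 / 2 * (x + s * z)^2)"
      using q_pos by (auto intro!: integrable_U_cont continuous_intros)
    show "integrable (U q) (\<lambda>z. indicator {-\<bar>c\<bar>..\<bar>c\<bar>} (x + s * z) :: real)"
      using q_pos by (rule integrable_U_indicator_affine)
    fix z assume "\<bar>z\<bar> \<le> q"
    then have "\<bar>s * z\<bar> \<le> s * q" using s_pos by (simp add: abs_mult)
    then have "\<bar>x + s * z\<bar> \<le> 4 * (K * q)" using bd sq by (auto simp: abs_le_iff)
    then show "\<bar>F 0 \<bar>\<bar>x + s * z\<bar> + c\<bar> - (F 0 0 + F 1 0 * (\<bar>x + s * z\<bar> + c) + F 2 0 / 2 * (x + s * z)^2)\<bar>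
      \<le> 2 * B * \<bar>c\<bar> * indicator {-\<bar>c\<bar>..\<bar>c\<bar>} (x + s * z) + 68 * B * K^3 * q^3"
      using nz by (intro reflected_expansion) auto
  qed
  also have "2 * B * \<bar>c\<bar> * (\<integral>z. indicator {-\<bar>c\<bar>..\<bar>c\<bar>} (x + s * z) \<partial>U q)
     \<le> 2 * B * (K * q^2) * (K * q / m)"
  proof (intro mult_mono)
    have "(\<integral>z. indicator {-\<bar>c\<bar>..\<bar>c\<bar>} (x + s * z) \<partial>U q) \<le> (\<bar>c\<bar> - - \<bar>c\<bar>) / (2 * (s * q))"
      using s_pos q_pos by (intro integral_U_affine_le) auto
    also have "\<dots> = \<bar>c\<bar> / (s * q)" by simp
    also have "\<dots> \<le> K * q^2 / (m * q)"
      using nz m_pos q_pos s_pos K0 by (intro frac_le) auto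
    also have "\<dots> = K * q / m" using q_pos by (simp add: power2_eq_square)
    finally show "(\<integral>z. indicator {-\<bar>c\<bar>..\<bar>c\<bar>} (x + s * z) \<partial>U q) \<le> K * q / m" .
  qed (use nz B_nonneg K0 in auto)
  also have "2 * B * (K * q^2) * (K * q / m) + 68 * B * K^3 * q^3 = B * (2 * K^2 / m + 68 * K^3) * q^3"
    by (simp add: algebra_simps power2_eq_square power3_eq_cube)
  finally have EF: "\<bar>EF - P\<bar> \<le> B * (2 * K^2 / m + 68 * K^3) * q^3" by simp

  have \<sigma>0: "m \<le> \<sigma> 0" "\<sigma> 0 \<le> K" and b0: "\<bar>b 0\<bar> \<le> K"
    using elliptic[of 0] growth_\<sigma>[of 0] growth_b[of 0] nz bd by auto
  have \<sigma>0_pos: "\<sigma> 0 > 0" using \<sigma>0 m_pos by linarith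
  have F2: "F 2 0 = F 1 0 * M0"
    using boundary_condition \<sigma>0_pos \<kappa>_pos unfolding M0_def by (simp add: field_simps)
  \<comment> \<open>\<lambda> is built from the coefficients at \<open>x\<close>, the boundary
    condition from those at 0; Lipschitz continuity makes the mismatch linear in
    \<open>x\<close>.\<close>
  have MM0: "\<bar>M0 - M\<bar> \<le> 8 * K^3 / m^4 * x"
  proof -
    define A1 A2 where "A1 = (b x - b 0) * (\<sigma> 0)^2" and "A2 = b 0 * ((\<sigma> 0 - s) * (\<sigma> 0 + s))"
    have A1: "\<bar>A1\<bar> \<le> K * x * K^2"
      unfolding A1_def abs_mult using Lip_b[of x] bd nz \<sigma>0 \<sigma>0_pos K0
      by (intro mult_mono) (auto intro: power_mono)
    have A2: "\<bar>A2\<bar> \<le> K * ((K * x) * (3 * K))"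
      unfolding A2_def abs_mult using Lip_\<sigma>[of x] bd nz \<sigma>0 \<sigma>0_pos s_pos K0 b0
      by (intro mult_mono) (auto simp: s_def)
    have mm: "m^2 * m^2 \<le> s^2 * (\<sigma> 0)^2"
      using nz \<sigma>0 m_pos by (intro mult_mono power_mono) auto
    have "M0 - M = 2 * (A1 + A2) / (s^2 * (\<sigma> 0)^2)"
      unfolding M0_def M_def A1_def A2_def using \<sigma>0_pos s_pos \<kappa>_pos
      by (simp add: field_simps power2_eq_square)
    then have "\<bar>M0 - M\<bar> = \<bar>2 * (A1 + A2)\<bar> / (s^2 * (\<sigma> 0)^2)"
      by (simp only: abs_divide) simp
    also have "\<dots> \<le> 2 * (K * x * K^2 + K * ((K * x) * (3 * K))) / (m^2 * m^2)"
    proof (rule frac_le)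
      show "\<bar>2 * (A1 + A2)\<bar> \<le> 2 * (K * x * K^2 + K * ((K * x) * (3 * K)))"
      proof -
        have "\<bar>2 * (A1 + A2)\<bar> \<le> 2 * (u + v)" if "\<bar>A1\<bar> \<le> u" "\<bar>A2\<bar> \<le> v" for u v
          using that unfolding abs_le_iff by (simp add: algebra_simps)
        from this[OF A1 A2] show ?thesis .
      qed
    qed (use m_pos bd K0 mm in auto)
    also have "\<dots> = 8 * K^3 / m^4 * x" by (simp add: field_simps power2_eq_square power3_eq_cube power4_eq_xxxx)
    finally show ?thesis .
  qed
  define R where "R = p * EY - x^2 - s^2 * h"
  have R: "\<bar>R\<bar> \<le> 6 * K^2 * q^2"
    using second_moment_defect[OF x] unfolding R_def p_def EY_def s_def .
  have id: "p * (EA + c) - x - c + M / 2 * R = 0"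
    using move_prob_identity[OF x] unfolding p_def EA_def EY_def M_def s_def c_def R_def by simp
  \<comment> \<open>The second-order part of the local error, with the derivatives of
    \<open>F\<close> frozen at 0. By the identity for \<lambda> only the mismatch
    \<open>M0 - M\<close> times the second-moment defect survives.\<close>
  define Q where "Q = p * P + (1 - p) * F 0 0 - (F 0 0 + F 1 0 * x + F 2 0 / 2 * x^2)
     - h * (b x * F 1 0 + s^2 / 2 * F 2 0)"
  have "Q = F 1 0 * (p * (EA + c) - x - c) + F 2 0 / 2 * R"
    unfolding Q_def P_def R_def c_def by (simp add: algebra_simps)
  also have "\<dots> = F 1 0 * ((p * (EA + c) - x - c + M / 2 * R) + (M0 - M) / 2 * R)"
    unfolding F2 by (simp add: field_simps)
  finally have Q: "Q = F 1 0 * ((M0 - M) / 2 * R)" unfolding id by simp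
  have Qb: "\<bar>Q\<bar> \<le> B * ((8 * K^3 / m^4 * x) / 2 * (6 * K^2 * q^2))"
  proof -
    have "\<bar>(M0 - M) / 2\<bar> \<le> (8 * K^3 / m^4 * x) / 2" using MM0 by (simp add: mult_ac)
    then show ?thesis unfolding Q using bound[of 1 0] R by (intro abs_mult_mono) auto
  qed

  have T0: "\<bar>F 0 x - (F 0 0 + F 1 0 * x + F 2 0 / 2 * x^2)\<bar> \<le> B * (4 * K^2 * q^2 * x) / 2"
  proof -
    have "x^3 = x^2 * x" by (simp add: power3_eq_cube power2_eq_square)
    also have "\<dots> \<le> (2 * K * q)^2 * x" using bd sq by (intro mult_right_mono power_mono) auto
    finally have "B * x^3 / 2 \<le> B * ((2 * K * q)^2 * x) / 2"
      using B_nonneg by (intro divide_right_mono mult_left_mono) auto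
    then show ?thesis using Taylor3[of 0 x] bd by (simp add: power_mult_distrib)
  qed
  \<comment> \<open>The price of freezing the derivatives at 0 in the generator term.\<close>
  define E where "E = h * (b x * (F 1 x - F 1 0) + s^2 / 2 * (F 2 x - F 2 0))"
  have Eb: "\<bar>E\<bar> \<le> B * (2 * K^2 * q^2 * x)"
  proof -
    have "s^2 \<le> (2 * K)^2" using nz s_pos by (intro power_mono) auto
    then have s2: "\<bar>s^2 / 2\<bar> \<le> 2 * K^2" by (simp add: power_mult_distrib)
    have "\<bar>b x * (F 1 x - F 1 0)\<bar> \<le> 2 * K * (B * x)"
      unfolding abs_mult using Lip_F[of 0 x] bd nz K0 by (intro mult_mono) auto
    moreover have "2 * K * (B * x) \<le> 2 * K^2 * (B * x)"
      using K_ge_1 B_nonneg bd by (intro mult_right_mono mult_left_mono) (auto simp: power2_eq_square)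
    moreover have "\<bar>s^2 / 2 * (F 2 x - F 2 0)\<bar> \<le> 2 * K^2 * (B * x)"
      unfolding abs_mult using Lip_F[of 0 x] bd s2 by (intro mult_mono) auto
    ultimately have "\<bar>b x * (F 1 x - F 1 0) + s^2 / 2 * (F 2 x - F 2 0)\<bar> \<le> 4 * K^2 * (B * x)"
      by linarith
    then have "\<bar>E\<bar> \<le> h * (4 * K^2 * (B * x))"
      unfolding E_def abs_mult using h_pos by (simp add: mult_left_mono)
    also have "\<dots> = 4/3 * (B * (K^2 * q^2 * x))" by (simp add: h_eq)
    also have "\<dots> \<le> 2 * (B * (K^2 * q^2 * x))"
      using B_nonneg K0 bd by (intro mult_right_mono) auto
    finally show ?thesis by (simp add: mult_ac)
  qed

  have "kernel \<kappa> b \<sigma> h (F 0) x = p * EF + (1 - p) * F 0 0"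
    using kernel_boundary[OF x h_pos _ _ F_cont] p unfolding p_def EF_def c_def s_def sqrt_eq by simp
  then have "generator_error x
      = p * (EF - P) + Q - (F 0 x - (F 0 0 + F 1 0 * x + F 2 0 / 2 * x^2)) - E"
    unfolding generator_error_def Q_def E_def s_def[symmetric] by (simp add: algebra_simps)
  moreover have "\<bar>p * (EF - P)\<bar> \<le> p * (B * (2 * K^2 / m + 68 * K^3) * q^3)"
    unfolding abs_mult using EF p by (simp add: mult_left_mono)
  ultimately have "\<bar>generator_error x\<bar> \<le> p * (B * (2 * K^2 / m + 68 * K^3) * q^3)
      + B * ((8 * K^3 / m^4 * x) / 2 * (6 * K^2 * q^2)) + B * (4 * K^2 * q^2 * x) / 2
      + B * (2 * K^2 * q^2 * x)"
    using Qb T0 Eb by linarith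
  also have "\<dots> = B * (2 * K^2 / m + 68 * K^3) * q^3 * p + B * (24 * K^5 / m^4 + 4 * K^2) * q^2 * x"
    by (simp add: algebra_simps power2_eq_square power3_eq_cube numeral_eq_Suc)
  also have "\<dots> \<le> B * (2 * K^2 / m + 68 * K^3) * q^3 * p
      + B * (24 * K^5 / m^4 + 4 * K^2) * q^2 * (32 * K^4 * (\<kappa> + 1) / (\<kappa> * m^2) * q * p)"
    using x_le_move_prob[OF x] B_nonneg m_pos K0 unfolding p_def[symmetric]
    by (intro add_left_mono mult_left_mono) auto
  also have "\<dots> = B * C_bdry * q^3 * p"
    unfolding C_bdry_def by (simp add: distrib_left distrib_right power2_eq_square power3_eq_cube mult_ac)
  finally show ?thesis unfolding p_def .
qed

end

section \<open>Local error outside the boundary region\<close>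

context sticky_coeffs
begin

text \<open>Weight of the contribution of order \<open>q\<^sup>3\<close> of the state \<open>x\<close> to the weak error. The middle case
  consists of the points outside the boundary region from which the drift may lead to a reflection.\<close>

definition boundary_weight :: "real \<Rightarrow> real" where
  "boundary_weight x = (if x \<in> boundary_region \<sigma> h then move_prob \<kappa> b \<sigma> h x
     else if x + b x * h < \<bar>\<sigma> x\<bar> * q then 1 else 0)"

lemma drift_bound: "0 \<le> x \<Longrightarrow> \<bar>b x * h\<bar> \<le> K * (1 + x) * q^2 / 3"
  using mult_right_mono[OF growth_b[of x], of h] h_pos by (simp add: abs_mult h_eq)

lemma reflection_near_zero:
  assumes "0 \<le> x" "x \<notin> boundary_region \<sigma> h" "x + b x * h < \<bar>\<sigma> x\<bar> * q"
  shows "x \<le> K * (1 + x) * (2 * q)" "\<sigma> x * q < x"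
proof -
  have "\<bar>\<sigma> x\<bar> * q \<le> K * (1 + x) * q"
    using growth_\<sigma>[OF assms(1)] q_pos by (intro mult_right_mono) auto
  moreover have "K * (1 + x) * q^2 / 3 \<le> K * (1 + x) * q"
    using Kq q_pos K_ge_1 assms(1) by (simp add: power2_eq_square mult_left_le)
  ultimately show "x \<le> K * (1 + x) * (2 * q)"
    using drift_bound[OF assms(1)] assms(3) by (simp add: abs_le_iff)
  show "\<sigma> x * q < x" using assms by (auto simp: boundary_region_def sqrt_eq)
qed

end

context sticky_test_function
begin

text \<open>Outside the region the expansion is about \<open>x\<close>. A reflection requires the
  unreflected point to lie in an interval of length \<open>\<bar>c\<bar>\<close>, an event of
  probability of order q, and costs order q^2. The cubic remainder has no factor beyond q^3, which
  is acceptable since the weight is 1 here.\<close>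

lemma local_error_reflection:
  assumes x: "0 \<le> x" "x \<notin> boundary_region \<sigma> h" "x + b x * h < \<bar>\<sigma> x\<bar> * q"
  shows "\<bar>generator_error x\<bar> \<le> B * (2 * K^2 / m + 15 * K^3) * q^3"
proof -
  define s c where "s = \<sigma> x" and "c = b x * h"
  note rf = reflection_near_zero[OF x, folded s_def]
  note nz = near_zero[OF x(1) rf(1), folded s_def c_def]
  have s_pos: "s > 0" using nz m_pos by linarith
  have K0: "K > 0" using K_ge_1 by simp
  have q1: "q \<le> 1" using Kq by simp
  have sq: "s * q \<le> 2 * (K * q)" using nz q_pos mult_right_mono[of s "2 * K" q] by simp
  have Kqq: "K * q^2 \<le> K * q" using q1 q_pos K_ge_1 by (simp add: power2_eq_square mult_left_le)
  have x3: "x \<le> 3 * (K * q)"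
  proof -
    have "x + c < s * q" using x(3) s_pos unfolding s_def c_def by simp
    then show ?thesis using sq nz(7) Kqq by linarith
  qed
  let ?P = "\<lambda>z. F 0 x + F 1 x * (s * z + c) + F 2 x / 2 * (s * z + c)^2"
  let ?I = "\<lambda>z. indicator {-\<bar>c\<bar>..0} ((x + c) + s * z) :: real"
  have P: "(\<integral>z. ?P z \<partial>U q) = F 0 x + F 1 x * c + F 2 x / 2 * (s^2 * q^2 / 3 + c^2)"
  proof -
    have "(\<integral>z. ?P z \<partial>U q) = (\<integral>z. (F 0 x + F 1 x * c + F 2 x / 2 * c^2) + (F 1 x * s + F 2 x * c * s) * z
        + (F 2 x / 2 * s^2) * z^2 + 0 * z^3 \<partial>U q)"
      by (intro Bochner_Integration.integral_cong) (auto simp: algebra_simps power2_eq_square)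
    also have "\<dots> = (F 0 x + F 1 x * c + F 2 x / 2 * c^2) + (F 2 x / 2 * s^2) * q^2 / 3"
      by (rule integral_U_cubic[OF q_pos])
    finally show ?thesis by (simp add: algebra_simps)
  qed
  have "\<bar>(\<integral>z. F 0 \<bar>x + s * z + c\<bar> \<partial>U q) - (\<integral>z. ?P z \<partial>U q)\<bar>
      \<le> (3 * B * (K * q^2)) * (\<integral>z. ?I z \<partial>U q) + 14 * B * K^3 * q^3"
  proof (rule integral_U_approx[OF q_pos])
    show "integrable (U q) (\<lambda>z. F 0 \<bar>x + s * z + c\<bar>)"
      by (intro integrable_F) (auto intro!: continuous_intros)
    show "integrable (U q) ?P"
      using q_pos by (auto intro!: integrable_U_cont continuous_intros)
    show "integrable (U q) ?I" using q_pos by (rule integrable_U_indicator_affine)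
    fix z assume "\<bar>z\<bar> \<le> q"
    then have sz: "\<bar>s * z\<bar> \<le> s * q" using s_pos by (simp add: abs_mult)
    define W where "W = \<bar>x + s * z + c\<bar>"
    define Y where "Y = x + s * z + c"
    \<comment> \<open>As \<open>s * q < x\<close>, the noise alone cannot cross 0, so the drift
      bounds the overshoot.\<close>
    have "- \<bar>c\<bar> \<le> Y" using sz rf unfolding Y_def by (auto simp: abs_le_iff)
    then have e1: "\<bar>W - Y\<bar> \<le> 2 * \<bar>c\<bar> * ?I z"
      unfolding W_def Y_def by (auto simp: indicator_def algebra_simps)
    also have "\<dots> \<le> 2 * (K * q^2) * ?I z" using nz by (intro mult_right_mono) auto
    finally have e1: "\<bar>W - Y\<bar> \<le> 2 * (K * q^2) * ?I z" .
    have W2: "(W - x)^2 - (Y - x)^2 = - (2 * x * (W - Y))"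
      unfolding W_def Y_def[symmetric] by (simp add: power2_eq_square algebra_simps)
    have Wx: "\<bar>W - x\<bar> \<le> 3 * (K * q)"
      using sz sq nz Kqq x(1) unfolding W_def by (auto simp: abs_le_iff)
    have "\<bar>W - x\<bar>^3 \<le> (3 * (K * q))^3" using Wx by (intro power_mono) auto
    then have "B * \<bar>W - x\<bar>^3 / 2 \<le> B * (27 * (K * q)^3) / 2"
      using B_nonneg by (intro divide_right_mono mult_left_mono) (auto simp: power_mult_distrib)
    then have t: "\<bar>F 0 W - (F 0 x + F 1 x * (W - x) + F 2 x / 2 * (W - x)^2)\<bar> \<le> B * (27 * (K * q)^3) / 2"
      using Taylor3[of x W] x(1) unfolding W_def by auto
    have 1: "\<bar>F 1 x * (W - Y)\<bar> \<le> B * (2 * (K * q^2) * ?I z)"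
      unfolding abs_mult using bound[of 1 x] x(1) e1 B_nonneg by (intro mult_mono) auto
    have "\<bar>F 2 x * x * (W - Y)\<bar> \<le> B * (1/2) * (2 * (K * q^2) * ?I z)"
      unfolding abs_mult using bound[of 2 x] x(1) x3 Kq(1) e1 B_nonneg by (intro mult_mono) auto
    moreover have "F 2 x / 2 * (W - x)^2 - F 2 x / 2 * (Y - x)^2 = - (F 2 x * x * (W - Y))"
      unfolding right_diff_distrib[symmetric] W2 by simp
    ultimately have 2: "\<bar>F 2 x / 2 * (W - x)^2 - F 2 x / 2 * (Y - x)^2\<bar> \<le> B * (K * q^2) * ?I z"
      by simp
    have 3: "F 1 x * (W - x) - F 1 x * (Y - x) = F 1 x * (W - Y)" by (simp add: algebra_simps)
    have "\<bar>F 0 W - (F 0 x + F 1 x * (Y - x) + F 2 x / 2 * (Y - x)^2)\<bar>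
      \<le> B * (27 * (K * q)^3) / 2 + B * (2 * (K * q^2) * ?I z) + B * (K * q^2) * ?I z"
      using t 1[folded 3] 2 by linarith
    also have "\<dots> \<le> (3 * B * (K * q^2)) * ?I z + 14 * B * K^3 * q^3"
      using B_nonneg K0 q_pos by (simp add: power_mult_distrib)
    finally show "\<bar>F 0 \<bar>x + s * z + c\<bar> - ?P z\<bar> \<le> (3 * B * (K * q^2)) * ?I z + 14 * B * K^3 * q^3"
      unfolding W_def Y_def by simp
  qed
  also have "(3 * B * (K * q^2)) * (\<integral>z. ?I z \<partial>U q) \<le> (3 * B * (K * q^2)) * (K * q / (2 * m))"
  proof (intro mult_left_mono)
    have "(\<integral>z. ?I z \<partial>U q) \<le> (0 - - \<bar>c\<bar>) / (2 * (s * q))"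
      using s_pos q_pos by (intro integral_U_affine_le) auto
    also have "\<dots> = \<bar>c\<bar> / (2 * (s * q))" by simp
    also have "\<dots> \<le> K * q^2 / (2 * (m * q))"
      using nz m_pos q_pos s_pos K0 by (intro frac_le) auto
    also have "\<dots> = K * q / (2 * m)" using q_pos by (simp add: power2_eq_square)
    finally show "(\<integral>z. ?I z \<partial>U q) \<le> K * q / (2 * m)" .
  qed (use B_nonneg K0 in auto)
  finally have 1: "\<bar>(\<integral>z. F 0 \<bar>x + s * z + c\<bar> \<partial>U q) - (\<integral>z. ?P z \<partial>U q)\<bar>
     \<le> (3 * B * (K * q^2)) * (K * q / (2 * m)) + 14 * B * K^3 * q^3" by simp
  have "kernel \<kappa> b \<sigma> h (F 0) x = (\<integral>z. F 0 \<bar>x + s * z + c\<bar> \<partial>U q)"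
    using kernel_outside[OF x(2)] by (simp add: s_def c_def sqrt_eq)
  then have "generator_error x = (\<integral>z. F 0 \<bar>x + s * z + c\<bar> \<partial>U q) - F 0 x - h * (b x * F 1 x + s^2 / 2 * F 2 x)"
    by (simp only: generator_error_def s_def)
  moreover have "h * (b x * F 1 x + s^2 / 2 * F 2 x) = F 1 x * c + F 2 x / 2 * (s^2 * q^2 / 3)"
    by (simp add: c_def h_eq algebra_simps)
  ultimately have ge: "generator_error x = ((\<integral>z. F 0 \<bar>x + s * z + c\<bar> \<partial>U q) - (\<integral>z. ?P z \<partial>U q)) + F 2 x / 2 * c^2"
    unfolding P by (simp add: algebra_simps)
  have "c^2 \<le> K^3 * q^3"
  proof -
    have "c^2 \<le> (K * q^2)^2" using nz by (subst abs_le_square_iff[symmetric]) auto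
    also have "\<dots> = K^2 * q^4" by (simp add: power_mult_distrib flip: power_mult)
    also have "\<dots> \<le> K^3 * q^3"
      using K_ge_1 q1 q_pos by (intro mult_mono power_increasing power_decreasing) auto
    finally show ?thesis .
  qed
  then have 2: "\<bar>F 2 x / 2 * c^2\<bar> \<le> B / 2 * (K^3 * q^3)"
    unfolding abs_mult using bound[of 2 x] x(1) B_nonneg by (intro mult_mono) auto
  define \<alpha> \<beta> where "\<alpha> = B * K^2 / m * q^3" and "\<beta> = B * K^3 * q^3"
  have "0 \<le> \<alpha>" "0 \<le> \<beta>" unfolding \<alpha>_def \<beta>_def using B_nonneg K0 q_pos m_pos by auto
  moreover have "(3 * B * (K * q^2)) * (K * q / (2 * m)) = 3/2 * \<alpha>"
    by (simp add: \<alpha>_def power2_eq_square power3_eq_cube)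
  moreover have "14 * B * K^3 * q^3 = 14 * \<beta>" "B / 2 * (K^3 * q^3) = \<beta> / 2"
    by (simp_all add: \<beta>_def)
  moreover have "B * (2 * K^2 / m + 15 * K^3) * q^3 = 2 * \<alpha> + 15 * \<beta>"
    by (simp add: \<alpha>_def \<beta>_def algebra_simps)
  moreover have "\<bar>generator_error x\<bar>
    \<le> ((3 * B * (K * q^2)) * (K * q / (2 * m)) + 14 * B * K^3 * q^3) + B / 2 * (K^3 * q^3)"
    unfolding ge by (rule order_trans[OF abs_triangle_ineq add_mono[OF 1 2]])
  ultimately show ?thesis by linarith
qed

text \<open>No noise value leads to a reflection, so the modulus disappears and a third-order
  expansion is available. The cubic moment of the noise vanishes, and every remaining term beyond
  the generator contains two factors of the drift or one together with q^2. \<open>A \<ge> 1\<close>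
  and \<open>q \<le> 1\<close> round all of them up to \<open>A^4 * q^4\<close>.\<close>

lemma local_error_interior:
  assumes x: "0 \<le> x" "x \<notin> boundary_region \<sigma> h" "\<not> x + b x * h < \<bar>\<sigma> x\<bar> * q"
  shows "\<bar>generator_error x\<bar> \<le> 3 * B * K^4 * (1 + x)^4 * q^4"
proof -
  define s c A where "s = \<sigma> x" and "c = b x * h" and "A = K * (1 + x)"
  have K0: "K > 0" using K_ge_1 by simp
  have A1: "A \<ge> 1" unfolding A_def using mult_mono[of 1 K 1 "1 + x"] K_ge_1 x(1) by simp
  have q1: "q \<le> 1" using Kq by simp
  have c: "\<bar>c\<bar> \<le> A * q^2 / 3" unfolding c_def A_def by (rule drift_bound[OF x(1)])
  have s: "\<bar>s\<bar> \<le> A" unfolding s_def A_def by (rule growth_\<sigma>[OF x(1)])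
  have "A * q^2 \<le> A * q" using q1 q_pos A1 by (simp add: power2_eq_square mult_left_le)
  then have cq: "\<bar>c\<bar> \<le> A * q" using c by linarith
  let ?P = "\<lambda>z. F 0 x + F 1 x * (s * z + c) + F 2 x / 2 * (s * z + c)^2 + F 3 x / 6 * (s * z + c)^3"
  have P: "(\<integral>z. ?P z \<partial>U q) = F 0 x + F 1 x * c + F 2 x / 2 * (s^2 * q^2 / 3 + c^2)
      + F 3 x / 6 * (s^2 * q^2 * c + c^3)"
  proof -
    have "(\<integral>z. ?P z \<partial>U q) = (\<integral>z. (F 0 x + F 1 x * c + F 2 x / 2 * c^2 + F 3 x / 6 * c^3)
        + (F 1 x * s + F 2 x * c * s + F 3 x / 2 * c^2 * s) * z
        + (F 2 x / 2 * s^2 + F 3 x / 2 * c * s^2) * z^2 + (F 3 x / 6 * s^3) * z^3 \<partial>U q)"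
      by (intro Bochner_Integration.integral_cong)
         (auto simp: field_simps power2_eq_square power3_eq_cube)
    also have "\<dots> = (F 0 x + F 1 x * c + F 2 x / 2 * c^2 + F 3 x / 6 * c^3)
        + (F 2 x / 2 * s^2 + F 3 x / 2 * c * s^2) * q^2 / 3"
      by (rule integral_U_cubic[OF q_pos])
    finally show ?thesis by (simp add: field_simps)
  qed
  have "\<bar>(\<integral>z. F 0 \<bar>x + s * z + c\<bar> \<partial>U q) - (\<integral>z. ?P z \<partial>U q)\<bar>
      \<le> 0 * (\<integral>z. 0 \<partial>U q) + 8/3 * B * A^4 * q^4"
  proof (rule integral_U_approx[OF q_pos])
    show "integrable (U q) (\<lambda>z. F 0 \<bar>x + s * z + c\<bar>)"
      by (intro integrable_F) (auto intro!: continuous_intros)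
    show "integrable (U q) ?P"
      using q_pos by (auto intro!: integrable_U_cont continuous_intros)
    fix z assume z: "\<bar>z\<bar> \<le> q"
    then have sz: "\<bar>s * z\<bar> \<le> \<bar>s\<bar> * q" by (simp add: abs_mult mult_left_mono)
    then have Y: "\<bar>x + s * z + c\<bar> = x + (s * z + c)"
      using x(3) unfolding s_def[symmetric] c_def[symmetric] by (auto simp: abs_le_iff)
    have Y0: "0 \<le> x + (s * z + c)" using abs_ge_zero[of "x + s * z + c"] unfolding Y .
    have "\<bar>s\<bar> * q \<le> A * q" using s q_pos by (intro mult_right_mono) auto
    then have "\<bar>s * z + c\<bar> \<le> 2 * (A * q)" using sz cq by linarith
    then have "\<bar>s * z + c\<bar>^4 \<le> (2 * (A * q))^4" by (intro power_mono) auto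
    then have "(s * z + c)^4 \<le> 16 * (A^4 * q^4)" by (simp add: power_mult_distrib)
    then have "B * (s * z + c)^4 / 6 \<le> B * (16 * (A^4 * q^4)) / 6"
      using B_nonneg by (intro divide_right_mono mult_left_mono) auto
    then show "\<bar>F 0 \<bar>x + s * z + c\<bar> - ?P z\<bar> \<le> 0 * 0 + 8/3 * B * A^4 * q^4"
      using Taylor4[OF x(1), of "x + (s * z + c)"] Y0 unfolding Y by simp
  qed auto
  then have 1: "\<bar>(\<integral>z. F 0 \<bar>x + s * z + c\<bar> \<partial>U q) - (\<integral>z. ?P z \<partial>U q)\<bar> \<le> 8/3 * B * A^4 * q^4" by simp
  have "kernel \<kappa> b \<sigma> h (F 0) x = (\<integral>z. F 0 \<bar>x + s * z + c\<bar> \<partial>U q)"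
    using kernel_outside[OF x(2)] by (simp add: s_def c_def sqrt_eq)
  then have "generator_error x = (\<integral>z. F 0 \<bar>x + s * z + c\<bar> \<partial>U q) - F 0 x - h * (b x * F 1 x + s^2 / 2 * F 2 x)"
    by (simp only: generator_error_def s_def)
  moreover have "h * (b x * F 1 x + s^2 / 2 * F 2 x) = F 1 x * c + F 2 x / 2 * (s^2 * q^2 / 3)"
    by (simp add: c_def h_eq algebra_simps)
  ultimately have ge: "generator_error x = ((\<integral>z. F 0 \<bar>x + s * z + c\<bar> \<partial>U q) - (\<integral>z. ?P z \<partial>U q))
      + F 2 x / 2 * c^2 + F 3 x / 6 * (s^2 * q^2 * c + c^3)"
    unfolding P by (simp add: algebra_simps)
  have q4: "A^i * q^j \<le> A^4 * q^4" if "i \<le> 4" "4 \<le> j" for i j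
    using that A1 q1 q_pos by (intro mult_mono power_increasing power_decreasing) auto
  have "\<bar>c^2\<bar> \<le> (A * q^2 / 3)^2" using power_mono[OF c, of 2] by simp
  also have "\<dots> = A^2 * q^4 / 9" by (simp add: power_divide power_mult_distrib flip: power_mult)
  also have "\<dots> \<le> A^4 * q^4 / 9" using q4[of 2 4] by simp
  finally have 2: "\<bar>c^2\<bar> \<le> A^4 * q^4 / 9" .
  have "\<bar>c^3\<bar> \<le> (A * q^2 / 3)^3" using power_mono[OF c, of 3] by (simp add: power_abs)
  also have "\<dots> = A^3 * q^6 / 27" by (simp add: power_divide power_mult_distrib flip: power_mult)
  also have "\<dots> \<le> A^4 * q^4 / 27" using q4[of 3 6] by simp
  finally have 3: "\<bar>c^3\<bar> \<le> A^4 * q^4 / 27" .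
  have "\<bar>s^2 * q^2 * c\<bar> \<le> A^2 * q^2 * (A * q^2 / 3)"
    unfolding abs_mult using s c A1 q_pos power_mono[OF s, of 2] by (intro mult_mono) auto
  also have "\<dots> = A^3 * q^4 / 3" by (simp add: power2_eq_square numeral_eq_Suc)
  also have "\<dots> \<le> A^4 * q^4 / 3" using q4[of 3 4] by simp
  finally have 4: "\<bar>s^2 * q^2 * c + c^3\<bar> \<le> A^4 * q^4 / 2"
    using 3 abs_triangle_ineq[of "s^2 * q^2 * c" "c^3"] abs_ge_zero[of "c^3"] by linarith
  have 5: "\<bar>F 2 x / 2 * c^2\<bar> \<le> B / 2 * (A^4 * q^4 / 9)"
    unfolding abs_mult using bound[of 2 x] 2 x(1) B_nonneg by (intro mult_mono) auto
  have 6: "\<bar>F 3 x / 6 * (s^2 * q^2 * c + c^3)\<bar> \<le> B / 6 * (A^4 * q^4 / 2)"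
    unfolding abs_mult using bound[of 3 x] 4 x(1) B_nonneg by (intro mult_mono) auto
  have "\<bar>generator_error x\<bar> \<le> 8/3 * B * A^4 * q^4 + B / 2 * (A^4 * q^4 / 9) + B / 6 * (A^4 * q^4 / 2)"
    unfolding ge
    by (rule order_trans[OF abs_triangle_ineq add_mono[OF order_trans[OF abs_triangle_ineq add_mono[OF 1 5]] 6]])
  also have "\<dots> = (8/3 + 1/18 + 1/12) * (B * A^4 * q^4)" by (simp add: algebra_simps)
  also have "\<dots> \<le> 3 * (B * A^4 * q^4)" using B_nonneg A1 q_pos by (intro mult_right_mono) auto
  finally show ?thesis by (simp add: A_def power_mult_distrib mult_ac)
qed

lemma C_bdry_ge: "2 * K^2 / m + 15 * K^3 \<le> C_bdry"
proof -
  have "0 \<le> (24 * K^5 / m^4 + 4 * K^2) * (32 * K^4 * (\<kappa> + 1) / (\<kappa> * m^2))" "0 \<le> K^3"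
    using K_ge_1 m_pos \<kappa>_pos by auto
  then show ?thesis unfolding C_bdry_def by linarith
qed

lemma local_error:
  assumes "0 \<le> x"
  shows "\<bar>generator_error x\<bar>
    \<le> B * C_bdry * q^3 * boundary_weight x + 3 * B * K^4 * (1 + x)^4 * q^4"
proof -
  have nn: "0 \<le> 3 * B * K^4 * (1 + x)^4 * q^4" using B_nonneg K_ge_1 assms q_pos by auto
  have "B * (2 * K^2 / m + 15 * K^3) * q^3 \<le> B * C_bdry * q^3"
    using C_bdry_ge B_nonneg q_pos by (intro mult_right_mono mult_left_mono) auto
  moreover consider "x \<in> boundary_region \<sigma> h" | "x \<notin> boundary_region \<sigma> h" "x + b x * h < \<bar>\<sigma> x\<bar> * q"
    | "x \<notin> boundary_region \<sigma> h" "\<not> x + b x * h < \<bar>\<sigma> x\<bar> * q" by blast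
  then show ?thesis
  proof cases
    case 1
    then show ?thesis
      using local_error_boundary[OF 1] nn by (simp only: boundary_weight_def if_True)
  next
    case 2
    then have "boundary_weight x = 1" by (simp add: boundary_weight_def)
    then have "B * C_bdry * q^3 * boundary_weight x = B * C_bdry * q^3" by simp
    then show ?thesis using local_error_reflection[OF assms 2] calculation nn by linarith
  next
    case 3
    then have "boundary_weight x = 0" by (simp add: boundary_weight_def)
    then show ?thesis using local_error_interior[OF assms 3] by simp
  qed
qed

end

section \<open>Visits to the boundary layer and moments\<close>

text \<open>Taken even in \<open>y\<close>, so that a reflection at 0 leaves its value
  unchanged.\<close>

definition hinge :: "real \<Rightarrow> real \<Rightarrow> real" where
  "hinge a y = max 0 (\<bar>y\<bar> - a)"

lemma hinge_cont: "continuous_on S (hinge a)"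
  unfolding hinge_def[abs_def] by (intro continuous_intros)

context sticky_coeffs
begin

text \<open>The convex function \<open>hinge kink\<close> acts as a discrete local time: up to terms of order \<open>q\<^sup>2\<close> it
  increases in mean, and near the boundary by an amount of order \<open>q\<close>. This bounds the expected number
  of visits to the boundary layer by a multiple of \<open>1/q\<close>.\<close>

definition kink where "kink = m * q / 4"

text \<open>\<open>2 * K\<close> pays for the drift with and without a jump; the other summand
  bounds |M| times half of the second-moment defect.\<close>

definition C_gain :: real where
  "C_gain = 2 * K + (1 / \<kappa> + 4 * K / m^2) * (3 * K^2)"

text \<open>The gain is the gap between the convex hinge and its affine piece, at least
  \<open>kink / 2\<close> on \<open>{0..kink / 2}\<close>. That interval lies in the range of
  \<open>y + s * z\<close>, so it has probability \<open>kink / (4 * s * q)\<close>, bounded below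
  independently of \<open>q\<close>. With \<open>kink = m * q / 4\<close> and
  \<open>s \<le> 2 * K\<close> the product is at least m^2 q / (256 K). The term \<open>e\<close>
  absorbs a drift applied after the reflection.\<close>

lemma hinge_integral_ge:
  fixes s :: real
  assumes "s > 0" "y - s * q \<le> 0" "kink / 2 \<le> y + s * q" "s \<le> 2 * K"
    and le: "\<And>z. \<bar>z\<bar> \<le> q \<Longrightarrow> g z - kink + (kink / 2) * indicator {0..kink / 2} (y + s * z) - e \<le> f z"
    and int: "integrable (U q) f" "integrable (U q) g"
  shows "(\<integral>z. g z \<partial>U q) - kink + m^2 / (256 * K) * q - e \<le> (\<integral>z. f z \<partial>U q)"
proof -
  have a0: "0 \<le> kink" using m_pos q_pos by (simp add: kink_def)
  let ?I = "\<lambda>z. indicator {0..kink / 2} (y + s * z) :: real"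
  have I: "integrable (U q) ?I" using q_pos by (rule integrable_U_indicator_affine)
  interpret prob_space "U q" using q_pos by (rule prob_space_U)
  have "m^2 / (256 * K) * q = (m * q / 4)^2 / (8 * (2 * K * q))"
    using q_pos K_ge_1 by (simp add: field_simps power2_eq_square)
  also have "\<dots> \<le> kink^2 / (8 * (s * q))"
    unfolding kink_def using assms q_pos by (intro frac_le) auto
  also have "\<dots> = (kink / 2) * ((kink / 2 - 0) / (2 * (s * q)))"
    by (simp add: power2_eq_square)
  also have "(kink / 2 - 0) / (2 * (s * q)) = (\<integral>z. ?I z \<partial>U q)"
    using assms q_pos a0 by (intro integral_U_affine[symmetric]) auto
  finally have "(\<integral>z. g z \<partial>U q) - kink + m^2 / (256 * K) * q - e
     \<le> (\<integral>z. g z \<partial>U q) - kink + (kink / 2) * (\<integral>z. ?I z \<partial>U q) - e" by simp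
  also have "\<dots> = (\<integral>z. g z - kink + (kink / 2) * ?I z - e \<partial>U q)"
    using int I measure_U_UNIV[OF q_pos] by simp
  also have "\<dots> \<le> (\<integral>z. f z \<partial>U q)"
    using int I le by (intro integral_U_mono) auto
  finally show ?thesis .
qed

lemma hinge_ge: "0 \<le> kink \<Longrightarrow> \<bar>y\<bar> - kink + (kink / 2) * indicator {0..kink / 2} y \<le> hinge kink y"
  by (auto simp: hinge_def indicator_def)

text \<open>A jump to 0 gives the hinge the value 0, so only the moved part, weighted by
  \<open>p\<close>, contributes. If the hinge vanishes at \<open>x\<close> it can only grow;
  otherwise it is affine at \<open>x\<close>, and the identity for \<lambda> shows that jumping and
  moving preserve the mean up to order q^2.\<close>

lemma hinge_gain_boundary:
  assumes x: "x \<in> boundary_region \<sigma> h"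
  shows "m^2 / (256 * K) * q * move_prob \<kappa> b \<sigma> h x - C_gain * q^2 \<le> kernel \<kappa> b \<sigma> h (hinge kink) x - hinge kink x"
proof -
  define s c p where "s = \<sigma> x" and "c = b x * h" and "p = move_prob \<kappa> b \<sigma> h x"
  define EA EY where "EA = (x^2 + (s * q)^2) / (2 * (s * q))" and "EY = x^2 + s^2 * q^2 / 3"
  define M where "M = (s^2 - 2 * \<kappa> * b x) / (\<kappa> * s^2)"
  note bd = boundary_near_zero[OF x, folded s_def]
  note nz = near_zero[OF bd(1,2), folded s_def c_def]
  have s_pos: "s > 0" using nz m_pos by linarith
  have K0: "K > 0" using K_ge_1 by simp
  have a0: "0 \<le> kink" using m_pos q_pos by (simp add: kink_def)
  have p: "0 \<le> p" "p \<le> 1"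
    unfolding p_def using move_prob_nonneg[OF x] move_prob_le_1[OF x] by auto
  have mq: "m * q \<le> s * q" using nz q_pos by (intro mult_right_mono) auto
  define G where "G = (\<integral>z. hinge kink \<bar>\<bar>x + s * z\<bar> + c\<bar> \<partial>U q)"
  have ker: "kernel \<kappa> b \<sigma> h (hinge kink) x = p * G"
    using kernel_boundary[OF x h_pos, where \<kappa> = \<kappa> and b = b and g = "hinge kink"] p a0 hinge_cont
    unfolding p_def G_def c_def s_def sqrt_eq by (simp add: hinge_def)
  have "(\<integral>z. \<bar>x + s * z\<bar> \<partial>U q) - kink + m^2 / (256 * K) * q - \<bar>c\<bar> \<le> G"
    unfolding G_def
  proof (rule hinge_integral_ge[OF s_pos])
    show "x - s * q \<le> 0" "s \<le> 2 * K" using bd nz by auto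
    show "kink / 2 \<le> x + s * q" using mq bd a0 by (auto simp: kink_def)
    show "integrable (U q) (\<lambda>z. hinge kink \<bar>\<bar>x + s * z\<bar> + c\<bar>)" "integrable (U q) (\<lambda>z. \<bar>x + s * z\<bar>)"
      using q_pos by (auto intro!: integrable_U_cont continuous_intros continuous_on_compose2[OF hinge_cont])
    fix z
    have "hinge kink (x + s * z) - \<bar>c\<bar> \<le> hinge kink \<bar>\<bar>x + s * z\<bar> + c\<bar>"
      unfolding hinge_def by (auto simp: max_def)
    then show "\<bar>x + s * z\<bar> - kink + (kink / 2) * indicator {0..kink / 2} (x + s * z) - \<bar>c\<bar>
        \<le> hinge kink \<bar>\<bar>x + s * z\<bar> + c\<bar>"
      using hinge_ge[OF a0, of "x + s * z"] by linarith
  qed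
  then have G: "EA - kink + m^2 / (256 * K) * q - \<bar>c\<bar> \<le> G"
    unfolding integral_U_abs[OF q_pos s_pos bd(1,3)] EA_def .
  then have "p * (EA - kink + m^2 / (256 * K) * q - \<bar>c\<bar>) \<le> p * G"
    using p by (intro mult_left_mono)
  then have pG: "p * EA - p * kink + m^2 / (256 * K) * q * p - p * \<bar>c\<bar> \<le> p * G"
    by (simp add: algebra_simps)
  have pc: "p * \<bar>c\<bar> \<le> K * q^2"
    using mult_left_le_one_le[of "\<bar>c\<bar>" p] p nz by linarith
  show ?thesis
  proof (cases "x \<le> kink")
    case True
    \<comment> \<open>The mean after a move is at least \<open>m * q / 2\<close>, twice the
      kink.\<close>
    have "s * q / 2 \<le> EA"
      unfolding EA_def using s_pos q_pos by (simp add: field_simps power2_eq_square)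
    then have "0 \<le> EA - kink" using mq a0 unfolding kink_def by linarith
    then have "0 \<le> p * (EA - kink)" using p by simp
    moreover have "hinge kink x = 0" using True bd by (simp add: hinge_def)
    moreover have "K * q^2 \<le> C_gain * q^2"
      unfolding C_gain_def using K0 \<kappa>_pos m_pos by (intro mult_right_mono) (auto simp: add_increasing2)
    ultimately show ?thesis using pG pc ker unfolding p_def[symmetric]
      by (simp add: algebra_simps)
  next
    case False
    define R where "R = p * EY - x^2 - s^2 * h"
    have R: "\<bar>R\<bar> \<le> 6 * K^2 * q^2"
    using second_moment_defect[OF x] unfolding R_def p_def EY_def s_def .
    have id: "p * (EA + c) - x - c + M / 2 * R = 0"
      using move_prob_identity[OF x] unfolding p_def EA_def EY_def M_def s_def c_def R_def by simp
    have "\<bar>M\<bar> \<le> 1 / \<kappa> + 4 * K / m^2"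
    proof -
      have "M = 1 / \<kappa> - 2 * b x / s^2" unfolding M_def using s_pos \<kappa>_pos by (simp add: field_simps)
      moreover have "\<bar>2 * b x / s^2\<bar> \<le> 4 * K / m^2"
        unfolding abs_divide using nz m_pos K0 by (intro frac_le) (auto intro!: power_mono)
      moreover have "\<bar>1 / \<kappa>\<bar> = 1 / \<kappa>" using \<kappa>_pos by simp
      ultimately show ?thesis using abs_triangle_ineq4[of "1 / \<kappa>" "2 * b x / s^2"] by linarith
    qed
    then have "\<bar>M / 2 * R\<bar> \<le> (1 / \<kappa> + 4 * K / m^2) / 2 * (6 * K^2 * q^2)"
      unfolding abs_mult using R \<kappa>_pos K0 by (intro mult_mono) auto
    also have "\<dots> = (1 / \<kappa> + 4 * K / m^2) * (3 * K^2) * q^2" by simp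
    finally have MR: "\<bar>M / 2 * R\<bar> \<le> (1 / \<kappa> + 4 * K / m^2) * (3 * K^2) * q^2" .
    have "(1 - p) * \<bar>c\<bar> \<le> K * q^2"
      using mult_left_le_one_le[of "\<bar>c\<bar>" "1 - p"] p nz by linarith
    then have "- (K * q^2) \<le> (1 - p) * c"
      using p mult_left_mono[OF abs_ge_minus_self[of c], of "1 - p"] by simp
    \<comment> \<open>Here the identity for \<lambda> serves as a first-moment balance: the state
      \<open>x\<close> is reproduced on average, apart from drift and defect.\<close>
    moreover have "p * EA = x + (1 - p) * c - M / 2 * R"
      using id by (simp add: algebra_simps)
    ultimately have "x - K * q^2 - (1 / \<kappa> + 4 * K / m^2) * (3 * K^2) * q^2 \<le> p * EA"
      using abs_le_D1[OF MR] by linarith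
    moreover have "p * kink \<le> kink" using mult_left_le_one_le[OF a0 p] .
    moreover have "hinge kink x = x - kink" using False bd by (simp add: hinge_def)
    moreover have "C_gain * q^2 = 2 * (K * q^2) + (1 / \<kappa> + 4 * K / m^2) * (3 * K^2) * q^2"
      unfolding C_gain_def by (simp add: distrib_right)
    ultimately show ?thesis using pG pc ker unfolding p_def[symmetric] by linarith
  qed
qed

text \<open>The noise range starts at or below 0 by hypothesis and, the drift being at most
  \<open>m * q / 8\<close>, ends above \<open>kink / 2\<close>. The drift stays inside the
  integrand, so the lemma on the gain is used with \<open>e\<close> equal to 0.\<close>

lemma hinge_gain_reflection:
  assumes x: "0 \<le> x" "x \<notin> boundary_region \<sigma> h" "x + b x * h < \<bar>\<sigma> x\<bar> * q"
  shows "m^2 / (256 * K) * q - K * q^2 \<le> kernel \<kappa> b \<sigma> h (hinge kink) x - hinge kink x"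
proof -
  define s c where "s = \<sigma> x" and "c = b x * h"
  note rf = reflection_near_zero[OF x, folded s_def]
  note nz = near_zero[OF x(1) rf(1), folded s_def c_def]
  have s_pos: "s > 0" using nz m_pos by linarith
  have a0: "0 \<le> kink" using m_pos q_pos by (simp add: kink_def)
  have mq: "m * q \<le> s * q" using nz q_pos by (intro mult_right_mono) auto
  have "K * q * q \<le> m / 8 * q" using Kq q_pos by (intro mult_right_mono) auto
  then have c: "\<bar>c\<bar> \<le> m * q / 8" using nz by (simp add: power2_eq_square mult_ac)
  have "(\<integral>z. x + s * z + c \<partial>U q) - kink + m^2 / (256 * K) * q - 0 \<le> (\<integral>z. hinge kink \<bar>x + s * z + c\<bar> \<partial>U q)"
  proof (rule hinge_integral_ge[OF s_pos])
    show "(x + c) - s * q \<le> 0" using x(3) s_pos by (simp add: s_def c_def)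
    show "s \<le> 2 * K" using nz by auto
    show "kink / 2 \<le> (x + c) + s * q" using mq rf c a0 unfolding kink_def by (auto simp: abs_le_iff)
    show "integrable (U q) (\<lambda>z. hinge kink \<bar>x + s * z + c\<bar>)" "integrable (U q) (\<lambda>z. x + s * z + c)"
      using q_pos by (auto intro!: integrable_U_cont continuous_intros continuous_on_compose2[OF hinge_cont])
    fix z
    show "x + s * z + c - kink + (kink / 2) * indicator {0..kink / 2} ((x + c) + s * z) - 0 \<le> hinge kink \<bar>x + s * z + c\<bar>"
      using hinge_ge[OF a0, of "(x + c) + s * z"] by (simp add: hinge_def algebra_simps)
  qed
  moreover have "(\<integral>z. x + s * z + c \<partial>U q) = x + c"
    using integral_U_cubic[OF q_pos, of "x + c" s 0 0] by (simp add: algebra_simps)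
  moreover have "kernel \<kappa> b \<sigma> h (hinge kink) x = (\<integral>z. hinge kink \<bar>x + s * z + c\<bar> \<partial>U q)"
    using kernel_outside[OF x(2)] by (simp add: s_def c_def sqrt_eq)
  moreover have "hinge kink x = x - kink" using x(1) rf mq a0 by (simp add: hinge_def kink_def)
  ultimately show ?thesis using nz(7) by linarith
qed

text \<open>Jensen's inequality through the two minorants 0 and \<open>y - kink\<close>; only the
  mean drift is lost.\<close>

lemma hinge_gain_interior:
  assumes x: "0 \<le> x" "x \<notin> boundary_region \<sigma> h"
  shows "- (K * (1 + x) * q^2) \<le> kernel \<kappa> b \<sigma> h (hinge kink) x - hinge kink x"
proof -
  define s c where "s = \<sigma> x" and "c = b x * h"
  have c: "\<bar>c\<bar> \<le> K * (1 + x) * q^2 / 3" unfolding c_def by (rule drift_bound[OF x(1)])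
  have ker: "kernel \<kappa> b \<sigma> h (hinge kink) x = (\<integral>z. hinge kink \<bar>x + s * z + c\<bar> \<partial>U q)"
    using kernel_outside[OF x(2)] by (simp add: s_def c_def sqrt_eq)
  have int: "integrable (U q) (\<lambda>z. hinge kink \<bar>x + s * z + c\<bar>)" "integrable (U q) (\<lambda>z. x + s * z + c - kink)"
    using q_pos by (auto intro!: integrable_U_cont continuous_intros continuous_on_compose2[OF hinge_cont])
  have "x + c - kink = (\<integral>z. x + s * z + c - kink \<partial>U q)"
    using integral_U_cubic[OF q_pos, of "x + c - kink" s 0 0] by (simp add: algebra_simps)
  also have "\<dots> \<le> (\<integral>z. hinge kink \<bar>x + s * z + c\<bar> \<partial>U q)"
    using int by (intro integral_U_mono) (auto simp: hinge_def)
  finally have "x + c - kink \<le> kernel \<kappa> b \<sigma> h (hinge kink) x" unfolding ker .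
  moreover have "0 \<le> kernel \<kappa> b \<sigma> h (hinge kink) x"
    unfolding ker by (intro Bochner_Integration.integral_nonneg) (simp add: hinge_def)
  moreover have "0 \<le> K * (1 + x) * q^2" using K_ge_1 x(1) by simp
  ultimately show ?thesis using x(1) c by (auto simp: hinge_def abs_le_iff max_def)
qed

lemma hinge_gain:
  assumes "0 \<le> x"
  shows "m^2 / (256 * K) * q * boundary_weight x - C_gain * (1 + x) * q^2
    \<le> kernel \<kappa> b \<sigma> h (hinge kink) x - hinge kink x"
proof -
  have C: "K \<le> C_gain" unfolding C_gain_def using K_ge_1 \<kappa>_pos m_pos by (auto simp: add_increasing2)
  then have C0: "0 \<le> C_gain" using K_ge_1 by linarith
  have "K * (1 + x) * q^2 \<le> C_gain * (1 + x) * q^2"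
    using C assms by (intro mult_right_mono) auto
  moreover have Cx: "C_gain * q^2 \<le> C_gain * (1 + x) * q^2"
    using C0 assms mult_left_mono[of 1 "1 + x" C_gain] by (intro mult_right_mono) auto
  moreover have "K * q^2 \<le> C_gain * q^2" using C by (intro mult_right_mono) auto
  moreover consider "x \<in> boundary_region \<sigma> h" | "x \<notin> boundary_region \<sigma> h" "x + b x * h < \<bar>\<sigma> x\<bar> * q"
    | "x \<notin> boundary_region \<sigma> h" "\<not> x + b x * h < \<bar>\<sigma> x\<bar> * q" by blast
  then show ?thesis
  proof cases
    case 1
    then show ?thesis
      using hinge_gain_boundary[OF 1] Cx by (simp only: boundary_weight_def if_True)
  next
    case 2
    then have "m^2 / (256 * K) * q * boundary_weight x = m^2 / (256 * K) * q"
      by (simp add: boundary_weight_def)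
    then show ?thesis using hinge_gain_reflection[OF assms 2] calculation by linarith
  next
    case 3
    then have "m^2 / (256 * K) * q * boundary_weight x = 0" by (simp add: boundary_weight_def)
    then show ?thesis using hinge_gain_interior[OF assms 3(1)] calculation by linarith
  qed
qed

section \<open>Growth of the fourth moment\<close>

lemma one_plus_pow4:
  assumes "0 \<le> (x::real)"
  shows "(1 + x)^4 \<le> 8 * (1 + x^4)"
proof -
  \<comment> \<open>The power mean inequality, with its double zero at \<open>x = 1\<close> factored
    out.\<close>
  have "0 \<le> (x - 1)^2 * (7 * x^2 + 10 * x + 7)" using assms by simp
  also have "\<dots> = 8 * (1 + x^4) - (1 + x)^4" by (simp add: algebra_simps power2_eq_square power4_eq_xxxx)
  finally show ?thesis by simp
qed

text \<open>In the boundary region the new state is at most 5 K q. Outside, the odd noise terms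
  average out, leaving the drift (5 K^2 q^2 t^4) and the noise variance (13/3 of the same unit);
  their sum is below 14, and \<open>one_plus_pow4\<close> contributes the factor 8 of 112.\<close>

lemma moment_growth:
  assumes "0 \<le> x"
  shows "kernel \<kappa> b \<sigma> h (\<lambda>y. 1 + y^4) x \<le> (1 + 112 * K^2 * q^2) * (1 + x^4)"
proof (cases "x \<in> boundary_region \<sigma> h")
  case True
  define s c p where "s = \<sigma> x" and "c = b x * h" and "p = move_prob \<kappa> b \<sigma> h x"
  note bd = boundary_near_zero[OF True, folded s_def]
  note nz = near_zero[OF bd(1,2), folded s_def c_def]
  have s_pos: "s > 0" using nz m_pos by linarith
  have K0: "K > 0" using K_ge_1 by simp
  have p: "0 \<le> p" "p \<le> 1"
    unfolding p_def using move_prob_nonneg[OF True] move_prob_le_1[OF True] by auto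
  have sq: "s * q \<le> 2 * (K * q)" using nz q_pos mult_right_mono[of s "2 * K" q] by simp
  have Kqq: "K * q^2 \<le> K * q" using Kq q_pos K_ge_1 by (simp add: power2_eq_square mult_left_le)
  define G where "G = (\<integral>z. 1 + \<bar>\<bar>x + s * z\<bar> + c\<bar>^4 \<partial>U q)"
  have "G \<le> (\<integral>z. 1 + 25 * K^2 * q^2 \<partial>U q)"
    unfolding G_def
  proof (rule integral_U_mono)
    fix z assume "\<bar>z\<bar> \<le> q"
    then have "\<bar>s * z\<bar> \<le> s * q" using s_pos by (simp add: abs_mult)
    then have W: "\<bar>\<bar>x + s * z\<bar> + c\<bar> \<le> 5 * (K * q)" (is "?W \<le> _") using sq bd nz(7) Kqq by linarith
    \<comment> \<open>One square is kept as order q^2, the other is at most 1 because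
      \<open>K * q \<le> 1/8\<close>.\<close>
    have "?W^4 = ?W^2 * ?W^2" by (simp flip: power_add)
    also have "\<dots> \<le> (5 * (K * q))^2 * 1^2"
      using W Kq by (intro mult_mono power_mono) auto
    finally show "1 + ?W^4 \<le> 1 + 25 * K^2 * q^2" by (simp add: power_mult_distrib)
  qed (use q_pos in \<open>auto intro!: integrable_U_cont continuous_intros\<close>)
  then have G: "G \<le> 1 + 25 * K^2 * q^2" using measure_U_UNIV[OF q_pos] by simp
  have "kernel \<kappa> b \<sigma> h (\<lambda>y. 1 + y^4) x = p * G + (1 - p) * (1 + 0^4)"
    unfolding p_def G_def s_def c_def
    using kernel_boundary[OF True h_pos, where \<kappa> = \<kappa> and b = b and g = "\<lambda>y. 1 + y^4"] p
    by (simp add: p_def sqrt_eq continuous_intros del: power_abs power_even_abs_numeral)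
  also have "\<dots> \<le> p * (1 + 25 * K^2 * q^2) + (1 - p) * 1"
    using G p by (intro add_mono mult_left_mono) auto
  also have "\<dots> = 1 + p * (25 * K^2 * q^2)" by (simp add: algebra_simps)
  also have "\<dots> \<le> 1 + 25 * K^2 * q^2"
    using p by (intro add_left_mono mult_left_le_one_le) auto
  also have "\<dots> \<le> 1 + 112 * K^2 * q^2"
    by (intro add_left_mono mult_right_mono) auto
  also have "\<dots> \<le> (1 + 112 * K^2 * q^2) * (1 + x^4)"
    using mult_left_mono[of 1 "1 + x^4" "1 + 112 * K^2 * q^2"] bd by simp
  finally show ?thesis .
next
  case False
  define s c y t where "s = \<sigma> x" and "c = b x * h" and "y = x + c" and "t = 1 + x"
  have t: "t \<ge> 1" using assms by (simp add: t_def)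
  have K0: "K > 0" using K_ge_1 by simp
  have s: "\<bar>s\<bar> \<le> K * t" unfolding s_def t_def by (rule growth_\<sigma>[OF assms])
  define \<epsilon> where "\<epsilon> = K * q^2 / 3"
  have e: "0 \<le> \<epsilon>" "\<epsilon> \<le> 1/100"
  proof -
    show "0 \<le> \<epsilon>" using K0 by (simp add: \<epsilon>_def)
    have "K * q * q \<le> 1/8 * (1/8)" using Kq q_pos K0 by (intro mult_mono) auto
    then show "\<epsilon> \<le> 1/100" by (simp add: \<epsilon>_def power2_eq_square)
  qed
  have c: "\<bar>c\<bar> \<le> \<epsilon> * t" using drift_bound[OF assms] by (simp add: c_def \<epsilon>_def t_def mult_ac)
  have y: "\<bar>y\<bar> \<le> x + \<epsilon> * t" using c assms by (simp add: y_def)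
  have y4: "y^4 \<le> x^4 + 15 * \<epsilon> * t^4"
  proof -
    define d where "d = \<epsilon> * t"
    have d: "0 \<le> d" "d \<le> t" using e t mult_left_le_one_le[of t \<epsilon>] by (auto simp: d_def)
    have xt: "0 \<le> x" "x \<le> t" using assms by (auto simp: t_def)
    have "y^4 = \<bar>y\<bar>^4" by simp
    also have "\<dots> \<le> (x + d)^4" using y by (intro power_mono) (auto simp: d_def)
    also have "\<dots> = x^4 + d * (4 * x^3 + 6 * x^2 * d + 4 * x * d^2 + d^3)"
      by (simp add: algebra_simps power2_eq_square power3_eq_cube power4_eq_xxxx)
    also have "\<dots> \<le> x^4 + d * (4 * t^3 + 6 * t^2 * t + 4 * t * t^2 + t^3)"
      using d xt by (intro add_left_mono mult_left_mono add_mono mult_mono power_mono) auto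
    also have "\<dots> = x^4 + 15 * \<epsilon> * t^4" by (simp add: d_def power2_eq_square power3_eq_cube power4_eq_xxxx)
    finally show ?thesis .
  qed
  have y2: "y^2 \<le> 2 * t^2"
  proof -
    have "\<epsilon> * t \<le> 1/100 * t" using e t by (intro mult_right_mono) auto
    then have "\<bar>y\<bar> \<le> 5/4 * t" using y by (simp add: t_def)
    then have "y^2 \<le> (5/4 * t)^2" using power_mono[of "\<bar>y\<bar>" _ 2] by simp
    also have "\<dots> = 25/16 * t^2" by (simp add: power2_eq_square)
    also have "\<dots> \<le> 2 * t^2" by (intro mult_right_mono) auto
    finally show ?thesis .
  qed
  have s2: "s^2 \<le> K^2 * t^2" using power_mono[OF s, of 2] by (simp add: power_mult_distrib)
  have "kernel \<kappa> b \<sigma> h (\<lambda>y. 1 + y^4) x = (\<integral>z. 1 + \<bar>x + s * z + c\<bar>^4 \<partial>U q)"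
    using kernel_outside[OF False] by (simp add: s_def c_def sqrt_eq)
  also have "\<dots> \<le> (\<integral>z. (1 + y^4) + (4 * y^3 * s) * z + (6 * y^2 * s^2 + s^4 * q^2) * z^2 + (4 * y * s^3) * z^3 \<partial>U q)"
  proof (rule integral_U_mono)
    fix z assume "\<bar>z\<bar> \<le> q"
    then have "z^2 \<le> q^2" using power_mono[of "\<bar>z\<bar>" q 2] by simp
    \<comment> \<open>Trading two powers of \<open>z\<close> for \<open>q^2\<close> keeps the
      majorant cubic, so that \<open>integral_U_cubic\<close> applies.\<close>
    then have "s^4 * (z^2 * z^2) \<le> s^4 * (q^2 * z^2)" by (intro mult_left_mono mult_right_mono) auto
    moreover have "\<bar>x + s * z + c\<bar>^4 = (y + s * z)^4" by (simp add: y_def algebra_simps)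
    moreover have "(y + s * z)^4 = y^4 + 4 * y^3 * s * z + 6 * y^2 * s^2 * z^2 + 4 * y * s^3 * z^3 + s^4 * (z^2 * z^2)"
      by (simp add: algebra_simps power2_eq_square power3_eq_cube power4_eq_xxxx)
    ultimately show "1 + \<bar>x + s * z + c\<bar>^4 \<le> (1 + y^4) + (4 * y^3 * s) * z + (6 * y^2 * s^2 + s^4 * q^2) * z^2 + (4 * y * s^3) * z^3"
      by (simp add: algebra_simps)
  qed (use q_pos in \<open>auto intro!: integrable_U_cont continuous_intros\<close>)
  also have "\<dots> = (1 + y^4) + (6 * y^2 * s^2 + s^4 * q^2) * q^2 / 3"
    by (rule integral_U_cubic[OF q_pos])
  also have "\<dots> \<le> (1 + (x^4 + 15 * \<epsilon> * t^4)) + (13 * (K^2 * t^4)) * q^2 / 3"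
  proof -
    have "y^2 * s^2 \<le> (2 * t^2) * (K^2 * t^2)" using y2 s2 t by (intro mult_mono) auto
    also have "\<dots> = 2 * (K^2 * t^4)" by (simp add: power2_eq_square power4_eq_xxxx)
    finally have 1: "y^2 * s^2 \<le> 2 * (K^2 * t^4)" .
    have "s^4 * q^2 = s^2 * s^2 * q^2" by (simp flip: power_add)
    also have "\<dots> \<le> (K^2 * t^2) * (K^2 * t^2) * q^2" using s2 by (intro mult_mono) auto
    also have "\<dots> = (K * q)^2 * (K^2 * t^4)" by (simp add: power2_eq_square power4_eq_xxxx)
    also have "\<dots> \<le> 1^2 * (K^2 * t^4)"
      using Kq K0 q_pos t by (intro mult_right_mono power_mono) auto
    finally have "6 * y^2 * s^2 + s^4 * q^2 \<le> 13 * (K^2 * t^4)" using 1 by simp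
    then show ?thesis using y4 by (intro add_mono divide_right_mono mult_right_mono) auto
  qed
  also have "\<dots> \<le> (1 + x^4) + 14 * K^2 * q^2 * t^4"
  proof -
    have "15 * \<epsilon> * t^4 = 5 * (K * q^2 * t^4)" by (simp add: \<epsilon>_def)
    also have "\<dots> \<le> 5 * (K^2 * q^2 * t^4)"
      using K_ge_1 t by (intro mult_left_mono mult_right_mono) (auto simp: power2_eq_square)
    finally have "15 * \<epsilon> * t^4 \<le> 5 * (K^2 * q^2 * t^4)" .
    moreover have "0 \<le> K^2 * q^2 * t^4" by simp
    moreover have "13 * (K^2 * t^4) * q^2 / 3 = 13 / 3 * (K^2 * q^2 * t^4)"
      "14 * K^2 * q^2 * t^4 = 14 * (K^2 * q^2 * t^4)" by simp_all
    ultimately show ?thesis by linarith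
  qed
  also have "\<dots> \<le> (1 + x^4) + 14 * K^2 * q^2 * (8 * (1 + x^4))"
    unfolding t_def using one_plus_pow4[OF assms] by (intro add_left_mono mult_left_mono) auto
  also have "\<dots> = (1 + 112 * K^2 * q^2) * (1 + x^4)" by (simp add: algebra_simps)
  finally show ?thesis .
qed

end

section \<open>The weak error\<close>

locale weak_error =
  run: scheme_run M \<kappa> b \<sigma> h N x\<^sub>0 X Z V K +
  coeffs: sticky_coeffs \<kappa> b \<sigma> K m r h q
  for M :: "'b measure" and \<kappa> b \<sigma> h N x\<^sub>0 X Z V K m r q
begin

text \<open>Discrete Gronwall: as q^2 = 3 h, the factor per step is at most the exponential of 336
  K^2 h, so only the total time \<open>real N * h\<close> enters.\<close>

lemma moment_bound:
  assumes "k \<le> N"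
  shows "(\<integral>\<omega>. 1 + (X k \<omega>)^4 \<partial>M) \<le> exp (336 * K^2 * (real N * h)) * (1 + x\<^sub>0^4)"
proof -
  let ?c = "1 + 112 * K^2 * q^2"
  have cont: "continuous_on UNIV (\<lambda>y::real. 1 + y^4)" by (intro continuous_intros)
  have "(\<integral>\<omega>. 1 + (X k \<omega>)^4 \<partial>M) \<le> ?c^k * (1 + x\<^sub>0^4)"
    using assms
  proof (induction k)
    case 0
    have "(\<integral>\<omega>. 1 + (X 0 \<omega>)^4 \<partial>M) = (\<integral>\<omega>. 1 + x\<^sub>0^4 \<partial>M)"
      using run.X_0 by (intro Bochner_Integration.integral_cong) auto
    then show ?case using run.prob_space by simp
  next
    case (Suc k)
    have "(\<integral>\<omega>. 1 + (X (Suc k) \<omega>)^4 \<partial>M) = (\<integral>\<omega>. kernel \<kappa> b \<sigma> h (\<lambda>y. 1 + y^4) (X k \<omega>) \<partial>M)"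
      using run.kernel_expectation(2)[OF _ cont] Suc.prems by simp
    also have "\<dots> \<le> (\<integral>\<omega>. ?c * (1 + (X k \<omega>)^4) \<partial>M)"
      using run.kernel_expectation(1)[OF _ cont] run.integrable_X[OF _ cont] Suc.prems run.X_nonneg
      by (intro integral_mono coeffs.moment_growth integrable_mult_right) auto
    also have "\<dots> = ?c * (\<integral>\<omega>. 1 + (X k \<omega>)^4 \<partial>M)" by (rule integral_mult_right_zero)
    also have "\<dots> \<le> ?c * (?c^k * (1 + x\<^sub>0^4))"
      using Suc by (intro mult_left_mono) auto
    finally show ?case by simp
  qed
  also have "\<dots> \<le> exp (336 * K^2 * (real N * h)) * (1 + x\<^sub>0^4)"
  proof (intro mult_right_mono)
    have "?c^k \<le> ?c^N" using assms by (intro power_increasing) auto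
    also have "\<dots> \<le> exp (112 * K^2 * q^2)^N" by (intro power_mono exp_ge_add_one_self) auto
    also have "\<dots> = exp (336 * K^2 * (real N * h))"
      by (simp add: coeffs.h_eq mult_ac flip: exp_of_nat_mult)
    finally show "?c^k \<le> exp (336 * K^2 * (real N * h))" .
  qed auto
  finally show ?thesis .
qed

end

text \<open>The increments of \<open>v\<close> telescope, so their total is bounded by the terminal
  mean of \<open>v\<close>, with no factor \<open>N\<close>; the initial one is nonnegative and is
  dropped. The constants 9 and 3 come from q^4 = 9 h^2 and q^2 = 3 h.\<close>

lemma (in weak_error) telescoped_error:
  fixes u :: "nat \<Rightarrow> real \<Rightarrow> real" and v :: "real \<Rightarrow> real"
  assumes cont_u: "\<And>k. k \<le> N \<Longrightarrow> continuous_on UNIV (u k)" and cont_v: "continuous_on UNIV v"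
    and v: "\<And>x. 0 \<le> x \<Longrightarrow> 0 \<le> v x" "\<And>x. 0 \<le> x \<Longrightarrow> v x \<le> x"
    and A: "0 \<le> A" and D: "0 \<le> D"
    and step_le: "\<And>k x. k < N \<Longrightarrow> 0 \<le> x \<Longrightarrow> \<bar>kernel \<kappa> b \<sigma> h (u (Suc k)) x - u k x\<bar>
      \<le> A * q^4 * (1 + x^4) + D * q^2 * (kernel \<kappa> b \<sigma> h v x - v x)"
  shows "\<bar>(\<integral>\<omega>. u N (X N \<omega>) \<partial>M) - u 0 x\<^sub>0\<bar>
    \<le> (9 * A * (real N * h) + 3 * D) * exp (336 * K^2 * (real N * h)) * (1 + x\<^sub>0^4) * h"
proof -
  define Q where "Q = exp (336 * K^2 * (real N * h)) * (1 + x\<^sub>0^4)"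
  define eu ev where "eu k = (\<integral>\<omega>. u k (X k \<omega>) \<partial>M)" and "ev k = (\<integral>\<omega>. v (X k \<omega>) \<partial>M)" for k
  have cont4: "continuous_on UNIV (\<lambda>y::real. 1 + y^4)" by (intro continuous_intros)
  have step: "\<bar>eu (Suc k) - eu k\<bar> \<le> A * q^4 * Q + D * q^2 * (ev (Suc k) - ev k)" if k: "k < N" for k
  proof -
    note int = run.integrable_X[OF less_imp_le[OF k] cont_u[OF less_imp_le[OF k]]]
      run.integrable_X[OF less_imp_le[OF k] cont_v] run.integrable_X[OF less_imp_le[OF k] cont4]
      run.kernel_expectation(1)[OF k cont_u[OF Suc_leI[OF k]]] run.kernel_expectation(1)[OF k cont_v]
    note i1 = integrable_mult_right[OF int(3), of "A * q^4"]
    note i2 = integrable_mult_right[OF Bochner_Integration.integrable_diff[OF int(5,2)], of "D * q^2"]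
    have "eu (Suc k) - eu k = (\<integral>\<omega>. kernel \<kappa> b \<sigma> h (u (Suc k)) (X k \<omega>) - u k (X k \<omega>) \<partial>M)"
      using run.kernel_expectation(2)[OF k cont_u[OF Suc_leI[OF k]]] int by (simp add: eu_def)
    then have "\<bar>eu (Suc k) - eu k\<bar> \<le> (\<integral>\<omega>. \<bar>kernel \<kappa> b \<sigma> h (u (Suc k)) (X k \<omega>) - u k (X k \<omega>)\<bar> \<partial>M)"
      using integral_abs_bound by simp
    also have "\<dots> \<le> (\<integral>\<omega>. A * q^4 * (1 + (X k \<omega>)^4)
        + D * q^2 * (kernel \<kappa> b \<sigma> h v (X k \<omega>) - v (X k \<omega>)) \<partial>M)"
    proof (rule integral_mono[OF integrable_abs[OF Bochner_Integration.integrable_diff[OF int(4,1)]]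
          Bochner_Integration.integrable_add[OF i1 i2]])
      fix \<omega> assume "\<omega> \<in> space M"
      then have "0 \<le> X k \<omega>" using k by (simp add: run.X_nonneg)
      with k show "\<bar>kernel \<kappa> b \<sigma> h (u (Suc k)) (X k \<omega>) - u k (X k \<omega>)\<bar> \<le> A * q^4 * (1 + (X k \<omega>)^4)
        + D * q^2 * (kernel \<kappa> b \<sigma> h v (X k \<omega>) - v (X k \<omega>))" by (rule step_le)
    qed
    also have "\<dots> = A * q^4 * (\<integral>\<omega>. 1 + (X k \<omega>)^4 \<partial>M)
        + D * q^2 * ((\<integral>\<omega>. kernel \<kappa> b \<sigma> h v (X k \<omega>) \<partial>M) - (\<integral>\<omega>. v (X k \<omega>) \<partial>M))"
      by (simp only: Bochner_Integration.integral_add[OF i1 i2] integral_mult_right_zero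
          Bochner_Integration.integral_diff[OF int(5,2)])
    also have "\<dots> = A * q^4 * (\<integral>\<omega>. 1 + (X k \<omega>)^4 \<partial>M) + D * q^2 * (ev (Suc k) - ev k)"
      using run.kernel_expectation(2)[OF k cont_v] by (simp add: ev_def)
    also have "\<dots> \<le> A * q^4 * Q + D * q^2 * (ev (Suc k) - ev k)"
      unfolding Q_def using moment_bound[OF less_imp_le[OF k]] A
      by (intro add_right_mono mult_left_mono) auto
    finally show ?thesis .
  qed
  have "\<bar>eu n - eu 0\<bar> \<le> real n * (A * q^4 * Q) + D * q^2 * (ev n - ev 0)" if "n \<le> N" for n
    using that
  proof (induction n)
    case (Suc n)
    have "eu (Suc n) - eu 0 = (eu (Suc n) - eu n) + (eu n - eu 0)" by simp
    then have "\<bar>eu (Suc n) - eu 0\<bar> \<le> \<bar>eu (Suc n) - eu n\<bar> + \<bar>eu n - eu 0\<bar>"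
      by (metis abs_triangle_ineq)
    also have "\<dots> \<le> (A * q^4 * Q + D * q^2 * (ev (Suc n) - ev n))
        + (real n * (A * q^4 * Q) + D * q^2 * (ev n - ev 0))"
      using Suc step[of n] by (intro add_mono) auto
    also have "\<dots> = real (Suc n) * (A * q^4 * Q) + D * q^2 * (ev (Suc n) - ev 0)"
      by (simp add: algebra_simps)
    finally show ?case .
  qed simp
  then have main: "\<bar>eu N - eu 0\<bar> \<le> real N * (A * q^4 * Q) + D * q^2 * (ev N - ev 0)" by blast
  have "ev N \<le> (\<integral>\<omega>. 1 + (X N \<omega>)^4 \<partial>M)"
    unfolding ev_def
  proof (rule integral_mono)
    show "integrable M (\<lambda>\<omega>. v (X N \<omega>))" "integrable M (\<lambda>\<omega>. 1 + (X N \<omega>)^4)"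
      using run.integrable_X cont_v cont4 by auto
    fix \<omega> assume "\<omega> \<in> space M"
    then have X: "0 \<le> X N \<omega>" by (simp add: run.X_nonneg)
    have "X N \<omega> \<le> 1 + (X N \<omega>)^4"
    proof (cases "X N \<omega> \<le> 1")
      case False
      then show ?thesis using power_increasing[of 1 4 "X N \<omega>"] by simp
    qed (simp add: add_increasing2)
    with v(2)[OF X] show "v (X N \<omega>) \<le> 1 + (X N \<omega>)^4" by simp
  qed
  also have "\<dots> \<le> Q" unfolding Q_def by (rule moment_bound) simp
  finally have "ev N \<le> Q" .
  moreover have "0 \<le> ev 0"
    unfolding ev_def using run.X_nonneg[of 0] v(1) by (intro Bochner_Integration.integral_nonneg_AE) auto
  ultimately have "D * q^2 * (ev N - ev 0) \<le> D * q^2 * Q" using D by (intro mult_left_mono) auto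
  with main have "\<bar>eu N - eu 0\<bar> \<le> real N * (A * q^4 * Q) + D * q^2 * Q" by linarith
  also have "\<dots> = (9 * A * (real N * h) + 3 * D) * Q * h"
    by (simp add: coeffs.h_eq algebra_simps power2_eq_square power4_eq_xxxx)
  finally have "\<bar>eu N - eu 0\<bar> \<le> (9 * A * (real N * h) + 3 * D) * Q * h" .
  moreover have "eu 0 = u 0 x\<^sub>0"
  proof -
    have "eu 0 = (\<integral>\<omega>. u 0 x\<^sub>0 \<partial>M)"
      unfolding eu_def using run.X_0 by (intro Bochner_Integration.integral_cong) auto
    then show ?thesis using run.prob_space by simp
  qed
  ultimately show ?thesis by (simp add: eu_def Q_def mult.assoc)
qed

context sticky_test_function
begin

text \<open>\<open>hinge_gain\<close> multiplied by \<open>256 * K / m^2 * B * C_bdry * q^2\<close>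
  replaces the weighted q^3-error by an increment of the hinge function; its loss of order q^2
  becomes order q^4 and joins the interior error.\<close>

lemma one_step_error:
  assumes "0 \<le> x"
  shows "\<bar>generator_error x\<bar>
    \<le> (512 * K / m^2 * B * C_bdry * C_gain + 24 * B * K^4) * q^4 * (1 + x^4)
      + 256 * K / m^2 * B * C_bdry * q^2 * (kernel \<kappa> b \<sigma> h (hinge kink) x - hinge kink x)"
proof -
  define G where "G = kernel \<kappa> b \<sigma> h (hinge kink) x - hinge kink x"
  define E where "E = 256 * K / m^2 * B * C_bdry"
  have K0: "K > 0" using K_ge_1 by simp
  have C0: "0 \<le> C_bdry" unfolding C_bdry_def using K0 m_pos \<kappa>_pos by auto
  have G0: "0 \<le> C_gain" unfolding C_gain_def using K0 m_pos \<kappa>_pos by auto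
  have E0: "0 \<le> E" unfolding E_def using C0 B_nonneg K0 by simp
  have x1: "1 + x \<le> 2 * (1 + x^4)"
  proof (cases "x \<le> 1")
    case True
    then show ?thesis by (simp add: add_increasing2)
  next
    case False
    then show ?thesis using power_increasing[of 1 4 x] by simp
  qed
  have "B * C_bdry * q^3 * boundary_weight x = E * q^2 * (m^2 / (256 * K) * q * boundary_weight x)"
    unfolding E_def using K0 m_pos by (simp add: field_simps power2_eq_square power3_eq_cube)
  also have "\<dots> \<le> E * q^2 * (G + C_gain * (1 + x) * q^2)"
    using hinge_gain[OF assms] E0 unfolding G_def by (intro mult_left_mono) auto
  also have "\<dots> = E * q^2 * G + E * C_gain * q^4 * (1 + x)"
    by (simp add: algebra_simps power2_eq_square power4_eq_xxxx)
  also have "\<dots> \<le> E * q^2 * G + E * C_gain * q^4 * (2 * (1 + x^4))"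
    using x1 E0 G0 by (intro add_left_mono mult_left_mono) auto
  finally have 1: "B * C_bdry * q^3 * boundary_weight x \<le> E * q^2 * G + E * C_gain * q^4 * (2 * (1 + x^4))" .
  have "3 * B * K^4 * (1 + x)^4 * q^4 \<le> 3 * B * K^4 * (8 * (1 + x^4)) * q^4"
    using one_plus_pow4[OF assms] B_nonneg K0 by (intro mult_right_mono mult_left_mono) auto
  with 1 local_error[OF assms]
  have "\<bar>generator_error x\<bar> \<le> E * q^2 * G + E * C_gain * q^4 * (2 * (1 + x^4))
    + 3 * B * K^4 * (8 * (1 + x^4)) * q^4" by linarith
  also have "\<dots> = (2 * E * C_gain + 24 * B * K^4) * q^4 * (1 + x^4) + E * q^2 * G"
    by (simp add: algebra_simps)
  also have "2 * E * C_gain = 512 * K / m^2 * B * C_bdry * C_gain" unfolding E_def by simp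
  finally show ?thesis unfolding E_def G_def .
qed

end

section \<open>Choice of constants and assembly\<close>

lemma kernel_cong:
  "(\<And>y. 0 \<le> y \<Longrightarrow> f y = g y) \<Longrightarrow> kernel \<kappa> b \<sigma> h f x = kernel \<kappa> b \<sigma> h g x"
  by (simp add: kernel_def scheme_step_nonneg)

lemma bounded_C2_on_Lipschitz:
  assumes "bounded_C2_on {0..r} f"
  shows "\<exists>C\<ge>0. \<forall>x\<in>{0..r}. \<bar>f x - f 0\<bar> \<le> C * x"
proof -
  obtain D where D: "derivs_on {0..r} 2 f D" and "bounded (D 1 ` {0..r})"
    using assms unfolding bounded_C2_on_def by force
  then obtain C where C: "\<And>x. x \<in> {0..r} \<Longrightarrow> \<bar>D 1 x\<bar> \<le> C"
    unfolding bounded_iff by fastforce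
  have "\<bar>f x - f 0\<bar> \<le> max 0 C * x" if x: "x \<in> {0..r}" for x
  proof -
    have "D 0 0 = f 0" using D x unfolding derivs_on_def by auto
    then show ?thesis
      using derivs_on_Taylor[OF D, of 0 "max 0 C" 0 x] C x by (simp add: le_max_iff_disj)
  qed
  then show ?thesis by (intro exI[of _ "max 0 C"]) auto
qed

lemma sticky_coeffs_constants:
  assumes "locally_regular b \<sigma>" "linear_growth b \<sigma>"
  obtains K m r where "K \<ge> 1" "m > 0" "r > 0"
    and "\<And>x. 0 \<le> x \<Longrightarrow> \<bar>b x\<bar> \<le> K * (1 + x)" "\<And>x. 0 \<le> x \<Longrightarrow> \<bar>\<sigma> x\<bar> \<le> K * (1 + x)"
    and "\<And>x. 0 \<le> x \<Longrightarrow> x \<le> r \<Longrightarrow> m \<le> \<sigma> x"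
    and "\<And>x. 0 \<le> x \<Longrightarrow> x \<le> r \<Longrightarrow> \<bar>b x - b 0\<bar> \<le> K * x"
    and "\<And>x. 0 \<le> x \<Longrightarrow> x \<le> r \<Longrightarrow> \<bar>\<sigma> x - \<sigma> 0\<bar> \<le> K * x"
proof -
  from assms(1) obtain r m where r: "r > 0" and m: "m > 0" "\<forall>x\<in>{0..r}. m \<le> \<sigma> x"
    and reg: "bounded_C2_on {0..r} b" "bounded_C2_on {0..r} \<sigma>"
    unfolding locally_regular_def by blast
  obtain Cb where Cb: "Cb \<ge> 0" "\<forall>x\<in>{0..r}. \<bar>b x - b 0\<bar> \<le> Cb * x"
    using bounded_C2_on_Lipschitz[OF reg(1)] by blast
  obtain Cs where Cs: "Cs \<ge> 0" "\<forall>x\<in>{0..r}. \<bar>\<sigma> x - \<sigma> 0\<bar> \<le> Cs * x"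
    using bounded_C2_on_Lipschitz[OF reg(2)] by blast
  obtain L where L: "L > 0" "\<forall>x\<ge>0. \<bar>b x\<bar> + \<bar>\<sigma> x\<bar> \<le> L * (1 + x)"
    using assms(2) unfolding linear_growth_def by blast
  \<comment> \<open>One constant serves as growth and Lipschitz bound; the summand 1 secures
    \<open>K \<ge> 1\<close>, on which the rounding up of powers of \<open>K\<close> relies.\<close>
  define K where "K = 1 + Cb + Cs + L"
  have LK: "L * (1 + x) \<le> K * (1 + x)" if "0 \<le> x" for x
    using that Cb Cs unfolding K_def by (intro mult_right_mono) auto
  have bK: "\<bar>b x\<bar> + \<bar>\<sigma> x\<bar> \<le> K * (1 + x)" if "0 \<le> x" for x
    using order_trans[OF _ LK[OF that]] L(2) that by blast
  have CK: "Cb * x \<le> K * x" "Cs * x \<le> K * x" if "0 \<le> x" for x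
    using that Cb Cs L unfolding K_def by (auto intro!: mult_right_mono)
  show ?thesis
  proof (rule that[of K m r])
    show "K \<ge> 1" using Cb Cs L by (simp add: K_def)
    show "\<bar>b x - b 0\<bar> \<le> K * x" if "0 \<le> x" "x \<le> r" for x
      using order_trans[OF bspec[OF Cb(2)] CK(1)] that by simp
    show "\<bar>\<sigma> x - \<sigma> 0\<bar> \<le> K * x" if "0 \<le> x" "x \<le> r" for x
      using order_trans[OF bspec[OF Cs(2)] CK(2)] that by simp
    show "\<bar>b x\<bar> \<le> K * (1 + x)" "\<bar>\<sigma> x\<bar> \<le> K * (1 + x)" if "0 \<le> x" for x
      using bK[OF that] by auto
  qed (use r m in auto)
qed

text \<open>Only the values of the coefficients on \<open>[0,\<infinity>)\<close> matter, but measurability on the whole line is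
  convenient; hence the passage to \<open>b \<circ> max 0\<close>.\<close>

lemma sticky_scheme_run:
  assumes "sticky_scheme \<kappa> b \<sigma> h N x\<^sub>0 M X" "h > 0" "0 \<le> x\<^sub>0"
    and "b \<in> borel_measurable (restrict_space borel {0..})"
    and "\<sigma> \<in> borel_measurable (restrict_space borel {0..})"
    and growth: "\<And>x. 0 \<le> x \<Longrightarrow> \<bar>b x\<bar> \<le> K * (1 + x)" "\<And>x. 0 \<le> x \<Longrightarrow> \<bar>\<sigma> x\<bar> \<le> K * (1 + x)"
  obtains Z V where "scheme_run M \<kappa> (\<lambda>x. b (max 0 x)) (\<lambda>x. \<sigma> (max 0 x)) h N x\<^sub>0 X Z V K"
proof -
  interpret prob_space M using assms(1) by (simp add: sticky_scheme_def)
  obtain Z V where ZV: "indep_vars (\<lambda>_. borel) (case_sum Z V) ({..<N} <+> {..<N})"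
      "\<And>k. k < N \<Longrightarrow> distr M borel (Z k) = U (sqrt (3 * h))"
      "\<And>k. k < N \<Longrightarrow> distr M borel (V k) = uniform_measure lborel {0..1}"
    and X: "\<And>\<omega>. \<omega> \<in> space M \<Longrightarrow> X 0 \<omega> = x\<^sub>0"
      "\<And>k \<omega>. k < N \<Longrightarrow> \<omega> \<in> space M \<Longrightarrow> X (Suc k) \<omega> = scheme_step \<kappa> b \<sigma> h (X k \<omega>) (Z k \<omega>) (V k \<omega>)"
    using assms(1) unfolding sticky_scheme_def by blast
  have X0: "0 \<le> X k \<omega>" if "k < N" "\<omega> \<in> space M" for k \<omega>
    using that by (cases k) (auto simp: X assms(3) scheme_step_nonneg)
  have max: "(\<lambda>x::real. max 0 x) \<in> borel \<rightarrow>\<^sub>M restrict_space borel {0..}"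
    by (rule measurable_restrict_space2) auto
  have "scheme_step \<kappa> (\<lambda>x. b (max 0 x)) (\<lambda>x. \<sigma> (max 0 x)) h x z v = scheme_step \<kappa> b \<sigma> h x z v"
    if "0 \<le> x" for x z v
    using that by (simp add: scheme_step_def boundary_region_def move_prob_def)
  then have "scheme_run M \<kappa> (\<lambda>x. b (max 0 x)) (\<lambda>x. \<sigma> (max 0 x)) h N x\<^sub>0 X Z V K"
    using assms ZV X X0 measurable_compose[OF max assms(4)] measurable_compose[OF max assms(5)]
    by unfold_locales auto
  then show ?thesis by (rule that)
qed

theorem theorem4p6:
  fixes \<kappa> T :: real and b \<sigma> \<phi> :: "real \<Rightarrow> real"
    and P :: "real \<Rightarrow> real \<Rightarrow> 'a measure" and Y :: "real \<Rightarrow> real \<Rightarrow> real \<Rightarrow> 'a \<Rightarrow> real"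
  assumes "\<kappa> > 0" and "T > 0"
    and "b \<in> borel_measurable (restrict_space borel {0..})"
    and "\<sigma> \<in> borel_measurable (restrict_space borel {0..})"
    and "locally_regular b \<sigma>" and "linear_growth b \<sigma>"
    and "\<forall>t\<in>{0..T}. \<forall>x\<ge>0. sticky_diffusion \<kappa> b \<sigma> t T x (P t x) (Y t x)"
    and "regular_backward_solution \<kappa> b \<sigma> T \<phi> (backward_value T \<phi> P Y)"
  shows "\<exists>\<delta>>0. \<exists>C>0. \<forall>h x\<^sub>0 N. \<forall>M :: 'b measure. \<forall>X.
           0 < h \<and> h < \<delta> \<and> real N * h = T \<and> 0 \<le> x\<^sub>0 \<and> sticky_scheme \<kappa> b \<sigma> h N x\<^sub>0 M X \<longrightarrow>
           \<bar>(\<integral>\<omega>. \<phi> (X N \<omega>) \<partial>M) - (\<integral>\<omega>. \<phi> (Y 0 x\<^sub>0 T \<omega>) \<partial>P 0 x\<^sub>0)\<bar> \<le> C * (1 + x\<^sub>0 ^ 4) * h"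
proof -
  define u where "u = backward_value T \<phi> P Y"
  obtain ux ut where
    ux: "\<And>t. t \<in> {0..T} \<Longrightarrow> derivs_on {0..} 4 (u t) (\<lambda>j. ux j t)" and
    ut: "\<And>x. 0 \<le> x \<Longrightarrow> derivs_on {0..T} 2 (\<lambda>t. u t x) (\<lambda>j t. ut j t x)" and
    pde: "\<And>t x. t \<in> {0..T} \<Longrightarrow> 0 \<le> x \<Longrightarrow> ut 1 t x + b x * ux 1 t x + (\<sigma> x)\<^sup>2 / 2 * ux 2 t x = 0" and
    terminal: "\<And>x. 0 \<le> x \<Longrightarrow> u T x = \<phi> x" and
    bc: "\<And>t. t \<in> {0..T} \<Longrightarrow> (\<sigma> 0)\<^sup>2 / 2 * ux 1 t 0 = \<kappa> * (b 0 * ux 1 t 0 + (\<sigma> 0)\<^sup>2 / 2 * ux 2 t 0)" and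
    bdx: "\<forall>j\<in>{1..4}. bounded ((\<lambda>(t, x). ux j t x) ` ({0..T} \<times> {0..}))" and
    bdt: "bounded ((\<lambda>(t, x). ut 2 t x) ` ({0..T} \<times> {0..}))"
    using assms(8) unfolding regular_backward_solution_def u_def[symmetric] by blast
  obtain K m r where K: "K \<ge> 1" "m > 0" "r > 0"
    and growth: "\<And>x. 0 \<le> x \<Longrightarrow> \<bar>b x\<bar> \<le> K * (1 + x)" "\<And>x. 0 \<le> x \<Longrightarrow> \<bar>\<sigma> x\<bar> \<le> K * (1 + x)"
    and ell: "\<And>x. 0 \<le> x \<Longrightarrow> x \<le> r \<Longrightarrow> m \<le> \<sigma> x"
    and Lip: "\<And>x. 0 \<le> x \<Longrightarrow> x \<le> r \<Longrightarrow> \<bar>b x - b 0\<bar> \<le> K * x"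
      "\<And>x. 0 \<le> x \<Longrightarrow> x \<le> r \<Longrightarrow> \<bar>\<sigma> x - \<sigma> 0\<bar> \<le> K * x"
    using sticky_coeffs_constants[OF assms(5,6)] by blast
  have "\<forall>j\<in>{1..4}. \<exists>B. \<forall>t\<in>{0..T}. \<forall>x\<ge>0. \<bar>ux j t x\<bar> \<le> B"
    using bdx unfolding bounded_iff by fastforce
  then obtain Bx where Bx: "\<And>j t x. j \<in> {1..4} \<Longrightarrow> t \<in> {0..T} \<Longrightarrow> 0 \<le> x \<Longrightarrow> \<bar>ux j t x\<bar> \<le> Bx j"
    by metis
  define B where "B = (\<Sum>j\<in>{1..4}. \<bar>Bx j\<bar>)"
  have B: "\<bar>ux j t x\<bar> \<le> B" if "1 \<le> j" "j \<le> 4" "t \<in> {0..T}" "0 \<le> x" for j t x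
  proof -
    have "\<bar>Bx j\<bar> \<le> B" unfolding B_def using that by (intro member_le_sum) auto
    then show ?thesis using Bx[of j t x] that by simp
  qed
  have B0: "0 \<le> B" unfolding B_def by (intro sum_nonneg) auto
  obtain Bt where Bt: "\<And>t x. t \<in> {0..T} \<Longrightarrow> 0 \<le> x \<Longrightarrow> \<bar>ut 2 t x\<bar> \<le> Bt"
    using bdt unfolding bounded_iff by fastforce
  have Bt0: "0 \<le> Bt" using Bt[of 0 0] assms(2) by simp

  \<comment> \<open>Exported from their locales these constants depend on \<kappa>, \<open>K\<close>
    and \<open>m\<close> alone, hence not on \<open>h\<close>, the time or the initial
    state.\<close>
  define cb cg where "cb = sticky_test_function.C_bdry \<kappa> K m" and "cg = sticky_coeffs.C_gain \<kappa> K m"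
  define A D where "A = 512 * K / m^2 * B * cb * cg + 24 * B * K^4 + Bt"
    and "D = 256 * K / m^2 * B * cb"
  \<comment> \<open>The summand 1 makes \<open>C\<close> positive even if \<open>A\<close> and
    \<open>D\<close> vanish.\<close>
  define C where "C = (9 * A * T + 3 * D) * exp (336 * K^2 * T) + 1"
  \<comment> \<open>The three smallness conditions on the noise width, solved for it.\<close>
  define q\<^sub>0 where "q\<^sub>0 = min (1 / (8 * K)) (min (m / (8 * K)) (r / (4 * K)))"
  define b' \<sigma>' where "b' = (\<lambda>x. b (max 0 x))" and "\<sigma>' = (\<lambda>x. \<sigma> (max 0 x))"
  have q0: "q\<^sub>0 > 0" using K by (simp add: q\<^sub>0_def)
  have coeffs: "sticky_coeffs \<kappa> b' \<sigma>' K m r h (sqrt (3 * h))" if h: "0 < h" "h < q\<^sub>0^2 / 3" for h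
  proof -
    have "sqrt (3 * h) < sqrt (q\<^sub>0^2)" using h by (intro real_sqrt_less_mono) simp
    then have "sqrt (3 * h) < q\<^sub>0" using q0 by simp
    then have "sqrt (3 * h) < 1 / (8 * K)" "sqrt (3 * h) < m / (8 * K)" "sqrt (3 * h) < r / (4 * K)"
      by (auto simp: q\<^sub>0_def)
    then have small: "8 * K * sqrt (3 * h) \<le> 1" "8 * K * sqrt (3 * h) \<le> m" "4 * K * sqrt (3 * h) \<le> r"
      using K by (auto simp: field_simps simp del: real_sqrt_mult)
    show ?thesis
      unfolding b'_def \<sigma>'_def
      by unfold_locales (use assms(1) K growth ell Lip h small in auto)
  qed
  have cb0: "0 \<le> cb" and cg0: "0 \<le> cg"
  proof -
    \<comment> \<open>The signs of the constants are read off from their definitions in an instance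
      of the locales; any admissible step size and any time in \<open>{0..T}\<close> will
      do.\<close>
    define h where "h = q\<^sub>0^2 / 6"
    have h: "0 < h" "h < q\<^sub>0^2 / 3" using q0 by (simp_all add: h_def)
    interpret c: sticky_coeffs \<kappa> b' \<sigma>' K m r h "sqrt (3 * h)" using coeffs[OF h] .
    show "0 \<le> cg" unfolding cg_def c.C_gain_def using K assms(1) by auto
    interpret t: sticky_test_function \<kappa> b' \<sigma>' K m r h "sqrt (3 * h)" "\<lambda>j. ux j T" B
      by unfold_locales
         (use ux[of T] B[of _ T] bc[of T] assms(2) in \<open>auto simp: derivs_on_def b'_def \<sigma>'_def\<close>)
    show "0 \<le> cb" unfolding cb_def t.C_bdry_def using K assms(1) by auto
  qed
  have A0: "0 \<le> A" unfolding A_def using K B0 Bt0 cb0 cg0 by auto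
  have D0: "0 \<le> D" unfolding D_def using K B0 cb0 by auto
  have C0: "0 < C" unfolding C_def using A0 D0 assms(2) by (intro add_nonneg_pos) auto

  have "\<bar>(\<integral>\<omega>. \<phi> (X N \<omega>) \<partial>M) - (\<integral>\<omega>. \<phi> (Y 0 x\<^sub>0 T \<omega>) \<partial>P 0 x\<^sub>0)\<bar> \<le> C * (1 + x\<^sub>0 ^ 4) * h"
    if h: "0 < h" "h < q\<^sub>0^2 / 3" and N: "real N * h = T" and x0: "0 \<le> x\<^sub>0"
      and scheme: "sticky_scheme \<kappa> b \<sigma> h N x\<^sub>0 M X"
    for h x\<^sub>0 N and M :: "'b measure" and X
  proof -
    obtain Z V where run: "scheme_run M \<kappa> b' \<sigma>' h N x\<^sub>0 X Z V K"
      using sticky_scheme_run[OF scheme h(1) x0 assms(3,4) growth] unfolding b'_def \<sigma>'_def by blast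
    define q where "q = sqrt (3 * h)"
    interpret weak_error M \<kappa> b' \<sigma>' h N x\<^sub>0 X Z V K m r q
      using run coeffs[OF h] unfolding q_def by (rule weak_error.intro)
    have time: "real k * h \<in> {0..T}" if "k \<le> N" for k
      using that h(1) unfolding N[symmetric] by (auto intro!: mult_right_mono)
    \<comment> \<open>The modulus extends u continuously from the half-line to the whole line; the
      chain is nonnegative and does not see the difference.\<close>
    let ?u = "\<lambda>k x. u (real k * h) \<bar>x\<bar>"
    have cont: "continuous_on UNIV (?u k)" if "k \<le> N" for k
    proof -
      have "continuous_on {0..} (u (real k * h))"
        using derivs_on_continuous[of "{0..}" 3] ux[OF time[OF that]] by (simp add: numeral_eq_Suc)
      then show ?thesis by (rule continuous_on_compose2) (auto intro!: continuous_intros)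
    qed
    have step_le: "\<bar>kernel \<kappa> b' \<sigma>' h (?u (Suc k)) x - ?u k x\<bar>
      \<le> A * q^4 * (1 + x^4)
        + D * q^2 * (kernel \<kappa> b' \<sigma>' h (hinge coeffs.kink) x - hinge coeffs.kink x)"
      if k: "k < N" and x: "0 \<le> x" for k x
    proof -
      define t where "t = real k * h"
      have t: "t \<in> {0..T}" "t + h \<in> {0..T}"
        using time[of k] time[of "Suc k"] k by (simp_all add: t_def algebra_simps)
      have Suc_k: "real (Suc k) * h = t + h" by (simp add: t_def algebra_simps)
      interpret test: sticky_test_function \<kappa> b' \<sigma>' K m r h q "\<lambda>j. ux j (t + h)" B
        by unfold_locales
           (use ux[OF t(2)] B[OF _ _ t(2)] bc[OF t(2)] in \<open>auto simp: derivs_on_def b'_def \<sigma>'_def\<close>)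
      have ux0: "ux 0 (t + h) y = u (t + h) y" if "0 \<le> y" for y
        using ux[OF t(2)] that by (simp add: derivs_on_def)
      have ut0: "ut 0 (t + h) x = u (t + h) x"
        using ut[OF x] t by (simp add: derivs_on_def)
      \<comment> \<open>The expansion in time runs backwards from \<open>t + h\<close>, because the
        kernel acts on u at time \<open>t + h\<close> and the backward equation is used
        there.\<close>
      have "\<bar>u t x - (\<Sum>i\<le>1. ut i (t + h) x * (t - (t + h))^i / fact i)\<bar>
          \<le> Bt * \<bar>t - (t + h)\<bar>^Suc 1 / fact 1"
        using Bt x t by (intro derivs_on_Taylor[OF ut[OF x]]) (auto simp: numeral_2_eq_2)
      then have ut_bound: "\<bar>u t x - (u (t + h) x - h * ut 1 (t + h) x)\<bar> \<le> Bt * h^2"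
        using ut0 by (simp add: power2_eq_square algebra_simps)
      have pde': "b' x * ux 1 (t + h) x + (\<sigma>' x)^2 / 2 * ux 2 (t + h) x = - ut 1 (t + h) x"
        using pde[OF t(2) x] x by (simp add: b'_def \<sigma>'_def)
      have "kernel \<kappa> b' \<sigma>' h (?u (Suc k)) x = kernel \<kappa> b' \<sigma>' h (ux 0 (t + h)) x"
        by (rule kernel_cong) (simp only: Suc_k ux0 abs_of_nonneg)
      then have "test.generator_error x
          = kernel \<kappa> b' \<sigma>' h (?u (Suc k)) x - (u (t + h) x - h * ut 1 (t + h) x)"
        unfolding test.generator_error_def ux0[OF x] pde' by simp
      with ut_bound have "\<bar>kernel \<kappa> b' \<sigma>' h (?u (Suc k)) x - u t x\<bar>
          \<le> \<bar>test.generator_error x\<bar> + Bt * h^2" by linarith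
      moreover have "Bt * h^2 \<le> Bt * q^4 * (1 + x^4)"
      proof -
        have "h^2 \<le> q^4 * 1" by (simp add: coeffs.h_eq power_divide flip: power_mult)
        also have "\<dots> \<le> q^4 * (1 + x^4)" by (intro mult_left_mono) auto
        finally show ?thesis using Bt0 by (simp add: mult.assoc mult_left_mono)
      qed
      ultimately have "\<bar>kernel \<kappa> b' \<sigma>' h (?u (Suc k)) x - u t x\<bar>
          \<le> (512 * K / m^2 * B * cb * cg + 24 * B * K^4) * q^4 * (1 + x^4)
            + D * q^2 * (kernel \<kappa> b' \<sigma>' h (hinge coeffs.kink) x - hinge coeffs.kink x)
            + Bt * q^4 * (1 + x^4)"
        using test.one_step_error[OF x] unfolding cb_def cg_def D_def by linarith
      also have "\<dots> = A * q^4 * (1 + x^4)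
        + D * q^2 * (kernel \<kappa> b' \<sigma>' h (hinge coeffs.kink) x - hinge coeffs.kink x)"
        unfolding A_def by (simp only: distrib_right)
      finally show ?thesis using x by (simp add: t_def)
    qed
    have hinge: "0 \<le> hinge coeffs.kink x" "hinge coeffs.kink x \<le> x" if "0 \<le> x" for x
      using that K coeffs.q_pos by (auto simp: hinge_def coeffs.kink_def)
    have err: "\<bar>(\<integral>\<omega>. ?u N (X N \<omega>) \<partial>M) - ?u 0 x\<^sub>0\<bar>
      \<le> (9 * A * (real N * h) + 3 * D) * exp (336 * K^2 * (real N * h)) * (1 + x\<^sub>0^4) * h"
      using telescoped_error[where u = ?u and v = "hinge coeffs.kink",
          OF cont hinge_cont hinge A0 D0 step_le] .
    have "(\<integral>\<omega>. ?u N (X N \<omega>) \<partial>M) = (\<integral>\<omega>. \<phi> (X N \<omega>) \<partial>M)"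
      using run.X_nonneg[of N] terminal unfolding N
      by (intro Bochner_Integration.integral_cong) auto
    moreover have "?u 0 x\<^sub>0 = (\<integral>\<omega>. \<phi> (Y 0 x\<^sub>0 T \<omega>) \<partial>P 0 x\<^sub>0)"
      using x0 by (simp add: u_def backward_value_def)
    ultimately have "\<bar>(\<integral>\<omega>. \<phi> (X N \<omega>) \<partial>M) - (\<integral>\<omega>. \<phi> (Y 0 x\<^sub>0 T \<omega>) \<partial>P 0 x\<^sub>0)\<bar>
      \<le> (C - 1) * (1 + x\<^sub>0^4) * h"
      using err unfolding N C_def by simp
    also have "\<dots> \<le> C * (1 + x\<^sub>0^4) * h"
      using h by (intro mult_right_mono) auto
    finally show ?thesis .
  qed
  moreover have "0 < q\<^sub>0^2 / 3" using q0 by simp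
  ultimately show ?thesis using C0 by blast
qed

end
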